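(* Let $p$ and $q$ be primes with $p \equiv q \equiv 1 \bmod 8$ and $(p/q) = +1$. Let $\mathcal{O}_p$, $\mathcal{O}_q$ be the rings of integers of $\mathbb{Q}(\sqrt{p}\,)$, $\mathbb{Q}(\sqrt{q}\,)$, let $\varepsilon_p$, $\varepsilon_q$ be their fundamental units, and let $h(p)$ be the class number of $\mathbb{Q}(\sqrt{p}\,)$. Write $q\mathcal{O}_p = \mathfrak{q}\mathfrak{q}'$ and $p\mathcal{O}_q = \mathfrak{p}\mathfrak{p}'$, and assume that $[\varepsilon_p/\mathfrak{q}] = [\varepsilon_q/\mathfrak{p}] = +1$. Let $\mathfrak{l}$ be a prime ideal of $\mathcal{O}_p$ above $2$, and let $\lambda_p \in \mathcal{O}_p$ be totally positive with $\mathfrak{l}^{h(p)} = (\lambda_p)$. Then the following are equivalent: (1) $[\lambda_p/\mathfrak{q}] = +1$; (2) there is a hyper-primary $\rho \in \mathcal{O}_p$ with $\mathfrak{q}^{h(p)} = (\rho)$; (3) the ideal classes of the prime ideals above $2$ in $F = \mathbb{Q}(\sqrt{pq}\,)$ are fourth powers in the ideal class group $\mathrm{Cl}(F)$.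
   Context: For a quadratic number field with ring of integers $\mathcal{O}$, a prime ideal $\mathfrak{P} \nmid 2\alpha$ and $\alpha \in \mathcal{O}$, the quadratic residue symbol $[\alpha/\mathfrak{P}] \in \{\pm 1\}$ is defined by $[\alpha/\mathfrak{P}] \equiv \alpha^{(N\mathfrak{P}-1)/2} \bmod \mathfrak{P}$. An element $\alpha$ of the ring of integers $\mathcal{O}_K$ of a number field $K$ with odd norm is called primary if $\alpha$ is totally positive and $\alpha \equiv \xi^2 \bmod 4$ for some $\xi \in \mathcal{O}_K$ (equivalently, $K(\sqrt{\alpha}\,)/K$ is unramified at all primes above $2\infty$); it is called hyper-primary if, writing $2\mathcal{O}_K = \mathfrak{l}_1^{e_1}\cdots\mathfrak{l}_r^{e_r}$, $\alpha$ is primary and $\alpha \equiv \xi_j^2 \bmod \mathfrak{l}_j^{2e_j+1}$ for some $\xi_j \in \mathcal{O}_K$, for all $j$ (equivalently, every prime above $2$ splits in $K(\sqrt{\alpha}\,)/K$). Squares are allowed. $\mathrm{Cl}(F)$ denotes the ideal class group in the usual (wide) sense. *)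

theory Defs
  imports "HOL-Computational_Algebra.Polynomial" "HOL-Number_Theory.Number_Theory"
begin

text \<open>Real quadratic fields Q(sqrt d) (d > 1 squarefree) are realised as subfields of the reals;
  the two real embeddings are the identity and the conjugation.\<close>

definition quad_field :: "int \<Rightarrow> real set" where
  "quad_field d = {x. \<exists>a b. a \<in> \<rat> \<and> b \<in> \<rat> \<and> x = a + b * sqrt (of_int d)}"

definition alg_integer :: "real \<Rightarrow> bool" where
  "alg_integer x \<longleftrightarrow> (\<exists>P :: int poly. lead_coeff P = 1 \<and> poly (map_poly of_int P) x = 0)"

definition OK :: "int \<Rightarrow> real set" where
  "OK d = {x \<in> quad_field d. alg_integer x}"

definition qconj :: "int \<Rightarrow> real \<Rightarrow> real" where
  "qconj d x = (THE y. \<exists>a b. a \<in> \<rat> \<and> b \<in> \<rat> \<and> x = a + b * sqrt (of_int d) \<and> y = a - b * sqrt (of_int d))"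

definition elem_norm :: "int \<Rightarrow> real \<Rightarrow> real" where
  "elem_norm d x = x * qconj d x"

definition totally_positive :: "int \<Rightarrow> real \<Rightarrow> bool" where
  "totally_positive d x \<longleftrightarrow> x > 0 \<and> qconj d x > 0"

definition units_of_ring :: "real set \<Rightarrow> real set" where
  "units_of_ring R = {x \<in> R. \<exists>y \<in> R. x * y = 1}"

definition fund_unit :: "int \<Rightarrow> real" where
  "fund_unit d = (THE e. e \<in> units_of_ring (OK d) \<and> e > 1 \<and>
       (\<forall>u \<in> units_of_ring (OK d). u > 1 \<longrightarrow> e \<le> u))"

definition is_ideal :: "real set \<Rightarrow> real set \<Rightarrow> bool" where
  "is_ideal R I \<longleftrightarrow> I \<subseteq> R \<and> 0 \<in> I \<and> (\<forall>x\<in>I. \<forall>y\<in>I. x + y \<in> I) \<and> (\<forall>r\<in>R. \<forall>x\<in>I. r * x \<in> I)"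

definition principal_ideal :: "real set \<Rightarrow> real \<Rightarrow> real set" where
  "principal_ideal R a = (\<lambda>r. r * a) ` R"

definition ideal_mult :: "real set \<Rightarrow> real set \<Rightarrow> real set \<Rightarrow> real set" where
  "ideal_mult R I J = \<Inter>{K. is_ideal R K \<and> {x * y |x y. x \<in> I \<and> y \<in> J} \<subseteq> K}"

primrec ideal_pow :: "real set \<Rightarrow> real set \<Rightarrow> nat \<Rightarrow> real set" where
  "ideal_pow R I 0 = R"
| "ideal_pow R I (Suc n) = ideal_mult R I (ideal_pow R I n)"

definition prime_ideal :: "real set \<Rightarrow> real set \<Rightarrow> bool" where
  "prime_ideal R P \<longleftrightarrow> is_ideal R P \<and> P \<noteq> R \<and> P \<noteq> {0} \<and>
     (\<forall>x\<in>R. \<forall>y\<in>R. x * y \<in> P \<longrightarrow> x \<in> P \<or> y \<in> P)"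

definition ideal_norm :: "real set \<Rightarrow> real set \<Rightarrow> nat" where
  "ideal_norm R I = card {{y \<in> R. y - x \<in> I} |x. x \<in> R}"

definition qr_symbol :: "real set \<Rightarrow> real \<Rightarrow> real set \<Rightarrow> int" where
  "qr_symbol R a P = (THE s. s \<in> {1, -1} \<and> a ^ ((ideal_norm R P - 1) div 2) - of_int s \<in> P)"

definition ram_index2 :: "real set \<Rightarrow> real set \<Rightarrow> nat" where
  "ram_index2 R P = (GREATEST e. principal_ideal R 2 \<subseteq> ideal_pow R P e)"

definition primary :: "int \<Rightarrow> real \<Rightarrow> bool" where
  "primary d a \<longleftrightarrow> a \<in> OK d \<and> (\<exists>n::int. odd n \<and> elem_norm d a = of_int n) \<and>
     totally_positive d a \<and> (\<exists>\<xi> \<in> OK d. a - \<xi>^2 \<in> principal_ideal (OK d) 4)"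

definition hyper_primary :: "int \<Rightarrow> real \<Rightarrow> bool" where
  "hyper_primary d a \<longleftrightarrow> primary d a \<and>
     (\<forall>L. prime_ideal (OK d) L \<and> 2 \<in> L \<longrightarrow>
        (\<exists>\<xi> \<in> OK d. a - \<xi>^2 \<in> ideal_pow (OK d) L (2 * ram_index2 (OK d) L + 1)))"

definition ideal_equiv :: "real set \<Rightarrow> (real set \<times> real set) set" where
  "ideal_equiv R = {(I, J). is_ideal R I \<and> I \<noteq> {0} \<and> is_ideal R J \<and> J \<noteq> {0} \<and>
     (\<exists>a\<in>R. \<exists>b\<in>R. a \<noteq> 0 \<and> b \<noteq> 0 \<and> (\<lambda>x. a * x) ` I = (\<lambda>x. b * x) ` J)}"

definition class_number :: "real set \<Rightarrow> nat" where
  "class_number R = card ({I. is_ideal R I \<and> I \<noteq> {0}} // ideal_equiv R)"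

definition class_is_fourth_power :: "real set \<Rightarrow> real set \<Rightarrow> bool" where
  "class_is_fourth_power R I \<longleftrightarrow> (\<exists>J. is_ideal R J \<and> J \<noteq> {0} \<and> (I, ideal_pow R J 4) \<in> ideal_equiv R)"

end

theory Submission
  imports Defs "HOL-Computational_Algebra.Nth_Powers" "HOL-Computational_Algebra.Squarefree"
    "HOL-Analysis.Kronecker_Approximation_Theorem"
begin

text \<open>
  Write \<open>h = h(p)\<close>, which is odd, \<open>\<lambda> = (a + b \<surd>p) / 2\<close> with \<open>a\<^sup>2 - p b\<^sup>2 = 2\<^bsup>h+2\<^esup>\<close>, and let
  \<open>C + D \<surd>p\<close> of norm \<open>q\<^sup>h\<close> be a totally positive generator of the \<open>h\<close>-th power of the prime above
  \<open>q\<close>. Modulo that prime \<open>\<surd>p = -C/D\<close>, so symbols of elements become Legendre symbols of resultants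
  such as \<open>a D - b C\<close>, and ordinary quadratic reciprocity turns them into conditions modulo \<open>8\<close>:
  \<open>[\<lambda>/q] = 1\<close> iff \<open>C + D \<equiv> \<plusminus>1 (mod 8)\<close>, while \<open>[\<epsilon>/q] = 1\<close> iff \<open>C \<equiv> 1 (mod 4)\<close>. Since \<open>4\<close> divides
  \<open>D\<close>, the generator is hyper-primary iff \<open>C + D \<equiv> 1 (mod 8)\<close>.

  For (3), compose \<open>a\<^sup>2 - 2\<^bsup>h+2\<^esup> = p b\<^sup>2\<close> with \<open>e\<^sup>2 - 2 g\<^sup>2 = q\<close> in \<open>\<int>[\<surd>2]\<close>; this gives
  \<open>x\<^sup>2 - p q b\<^sup>2 = 2 W\<^sup>2\<close> with \<open>[\<lambda>/q] = (W/q)\<close>. The element \<open>(x + b \<surd>(pq)) / 2\<close> times a prime above \<open>2\<close>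
  has norm \<open>W\<^sup>2\<close>, so that the class of the prime is the class of \<open>M\<^sup>2\<close> for an ideal \<open>M\<close> whose genus character is
  \<open>(W/q)\<close>. It is a fourth power iff \<open>M\<close> lies in the principal genus: such an \<open>M\<close> is equivalent to a square
  by Legendre's theorem on ternary forms, and conversely an ideal whose square is principal lies in the principal genus.
  If the square has a generator of positive norm, this is Hilbert 90; a single such ideal whose square has a
  generator of negative norm is obtained by composing \<open>T\<^sup>2 + 1 = p U\<^sup>2\<close> with \<open>f\<^sup>2 + g\<^sup>2 = q\<close> in
  \<open>\<int>[i]\<close>, and its character is \<open>[\<epsilon>/q] = 1\<close>.
\<close>

section \<open>Legendre symbols\<close>

text \<open>Classes in (3) are taken in the wide sense, so a generator of a square may have negative
  norm, beyond the reach of Hilbert 90. One explicit ideal of that kind suffices: multiplying by it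
  makes the norm positive, and its own character is known. The sign ambiguity in passing between
  equivalent ideals is harmless because \<open>-1\<close> is a square modulo \<open>q\<close>.
  Oddness of \<open>h\<close> enters twice: the symbols of \<open>q^h\<close> and
  \<open>2^(h+2)\<close> are those of \<open>q\<close> and \<open>2\<close>, and
  \<open>2^(h+2)\<close> is twice a square, which permits the composition with
  \<open>e^2 - 2 g^2 = q\<close>. It comes from \<open>t^2 - p u^2 = -1\<close>: a unit of norm
  \<open>-1\<close> adjusts signs, so every ideal with principal square is equivalent to one fixed
  by conjugation. Ideals are explicit lattices. The norm of \<open>I\<close> is the generator of the
  product of \<open>I\<close> with its conjugate, and a square root of an ideal \<open>K\<close> of
  norm \<open>k^2\<close> is built from the sum \<open>K + (k)\<close>. Both fields have
  \<open>d mod 8 = 1\<close>, so one development serves \<open>p\<close> and \<open>p q\<close>: the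
  integers are \<open>(u + v sqrt d) / 2\<close> with \<open>u\<close>, \<open>v\<close> of equal
  parity, and 2 splits.\<close>

lemma Legendre_cong:
  assumes "[a = b] (mod m)"
  shows "Legendre a m = Legendre b m"
proof -
  have "[x = a] (mod m) \<longleftrightarrow> [x = b] (mod m)" "[a = x] (mod m) \<longleftrightarrow> [b = x] (mod m)" for x
    using assms by (meson cong_sym cong_trans)+
  then show ?thesis unfolding Legendre_def QuadRes_def by simp
qed

lemma Legendre_eq_0_iff: "Legendre a (int q) = 0 \<longleftrightarrow> int q dvd a"
  by (auto simp: Legendre_def cong_0_iff)

lemma Legendre_values: "\<not> int q dvd a \<Longrightarrow> Legendre a (int q) = 1 \<or> Legendre a (int q) = -1"
  by (auto simp: Legendre_def cong_0_iff)

lemma small_cong_imp_eq: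
  fixes x y :: int
  assumes "[x = y] (mod m)" "\<bar>x\<bar> \<le> 1" "\<bar>y\<bar> \<le> 1" "m > 2"
  shows "x = y"
proof (rule ccontr)
  assume "x \<noteq> y"
  moreover have "m dvd x - y" using assms(1) by (simp add: cong_iff_dvd_diff)
  ultimately have "\<bar>m\<bar> \<le> \<bar>x - y\<bar>" using dvd_imp_le_int by auto
  then show False using assms by linarith
qed

lemma Legendre_abs_le: "\<bar>Legendre a m\<bar> \<le> 1"
  by (auto simp: Legendre_def)

text \<open>By Euler's criterion both sides are congruent modulo \<open>q\<close>, and integers of
  absolute value at most 1 that agree modulo \<open>q > 2\<close> are equal.\<close>

lemma Legendre_mult:
  assumes "prime q" "2 < q"
  shows "Legendre (a * b) (int q) = Legendre a (int q) * Legendre b (int q)"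
proof -
  have "[Legendre (a * b) (int q) = (a * b) ^ ((q - 1) div 2)] (mod int q)"
    using euler_criterion[OF assms] by blast
  moreover have "[Legendre a (int q) * Legendre b (int q) = a ^ ((q - 1) div 2) * b ^ ((q - 1) div 2)] (mod int q)"
    using euler_criterion[OF assms] by (intro cong_mult) blast+
  ultimately have "[Legendre (a * b) (int q) = Legendre a (int q) * Legendre b (int q)] (mod int q)"
    by (metis cong_sym cong_trans power_mult_distrib)
  moreover have "\<bar>Legendre a (int q) * Legendre b (int q)\<bar> \<le> 1"
    by (auto simp: Legendre_def)
  ultimately show ?thesis
    using small_cong_imp_eq Legendre_abs_le assms(2) by (metis of_nat_less_iff of_nat_numeral)
qed

lemma Legendre_square: "\<not> int q dvd a \<Longrightarrow> prime q \<Longrightarrow> Legendre (a^2) (int q) = 1"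
  by (auto simp: Legendre_def cong_0_iff QuadRes_def prime_dvd_power_iff intro!: exI[of _ a])

lemma Legendre_1: "prime q \<Longrightarrow> Legendre 1 (int q) = 1"
  using Legendre_square[of q 1] by (metis int_dvd_int_iff of_nat_1 not_prime_unit one_power2)

lemma Legendre_eq_1_if_square:
  assumes "[a = x^2] (mod int q)" "\<not> int q dvd a" "prime q"
  shows "Legendre a (int q) = 1"
  using assms by (auto simp: Legendre_def cong_0_iff QuadRes_def intro!: exI[of _ x] intro: cong_sym)

lemma Legendre_eq_1_imp_square:
  assumes "Legendre a (int q) = 1"
  obtains x where "[x^2 = a] (mod int q)"
  using assms by (auto simp: Legendre_def QuadRes_def split: if_splits)

lemma Legendre_eq_if_mult_square:
  assumes "prime q" "2 < q" "[a * b = x^2] (mod int q)" "\<not> int q dvd a * b"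
  shows "Legendre a (int q) = Legendre b (int q)"
proof -
  have "Legendre a (int q) * Legendre b (int q) = 1"
    using Legendre_eq_1_if_square[OF assms(3,4,1)] Legendre_mult[OF assms(1,2)] by simp
  moreover have "\<not> int q dvd a" "\<not> int q dvd b" using assms(4) by auto
  ultimately show ?thesis
    using Legendre_values[of q a] Legendre_values[of q b] by auto
qed

lemma Legendre_minus1:
  assumes "prime q" "2 < q"
  shows "Legendre (-1) (int q) = (if q mod 4 = 1 then 1 else -1)"
proof -
  have "odd q" using assms prime_odd_nat by auto
  have "[Legendre (-1) (int q) = (-1) ^ ((q - 1) div 2)] (mod int q)"
    using euler_criterion[OF assms] by blast
  moreover have "\<bar>(-1::int) ^ n\<bar> \<le> 1" for n by (simp add: power_abs)
  ultimately have "Legendre (-1) (int q) = (-1) ^ ((q - 1) div 2)"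
    using small_cong_imp_eq Legendre_abs_le assms(2) by (metis of_nat_less_iff of_nat_numeral)
  moreover have "even ((q - 1) div 2) \<longleftrightarrow> q mod 4 = 1"
    using \<open>odd q\<close> by presburger
  ultimately show ?thesis by simp
qed

text \<open>Gauss's lemma with multiplier 2: the residues counted are the doubles of the integers
  above \<open>(q - 1) / 4\<close> and up to \<open>m\<close>, and the parity of their number
  depends only on \<open>q\<close> modulo 8.\<close>

lemma Legendre_2:
  assumes "prime q" "2 < q"
  shows "Legendre 2 (int q) = (if q mod 8 = 1 \<or> q mod 8 = 7 then 1 else -1)"
proof -
  have "odd q" using assms prime_odd_nat by auto
  have nd: "\<not> int q dvd 2" using assms zdvd_not_zless by auto
  interpret G: GAUSS q 2
    by unfold_locales (use assms nd in \<open>auto simp: cong_0_iff\<close>)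
  define m where "m = (int q - 1) div 2"
  define A where "A = {(int q - 1) div 4 <.. m}"
  have q: "int q = 2 * m + 1" unfolding m_def using \<open>odd q\<close> by presburger
  \<comment> \<open>Doubles of numbers up to \<open>m\<close> stay below \<open>q\<close>, so no
    reduction modulo \<open>q\<close> takes place.\<close>
  have "G.C = (\<lambda>x. x * 2) ` {0<..m}"
    unfolding G.C_def G.B_def G.A_def image_image m_def[symmetric]
    by (rule image_cong) (use q in auto)
  then have "G.E = (\<lambda>x. x * 2) ` A"
    unfolding G.E_def A_def using q
    by (auto simp: m_def[symmetric])
  then have "card G.E = card A"
    by (simp add: card_image inj_on_def)
  also have "\<dots> = nat (m - (int q - 1) div 4)" by (simp add: A_def)
  finally have c: "card G.E = nat (m - (int q - 1) div 4)" .
  have "(int q - 1) div 4 \<le> m" using q by linarith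
  then have "even (card G.E) \<longleftrightarrow> even (m - (int q - 1) div 4)"
    unfolding c by (simp add: even_nat_iff)
  also have "\<dots> \<longleftrightarrow> q mod 8 = 1 \<or> q mod 8 = 7"
  proof -
    define t where "t = int (q div 8)"
    have "q mod 8 < 8" "odd (q mod 8)" using \<open>odd q\<close> by (simp, presburger)
    then have "q mod 8 = 1 \<or> q mod 8 = 3 \<or> q mod 8 = 5 \<or> q mod 8 = 7" by presburger
    moreover have "int q = 8 * t + int (q mod 8)" unfolding t_def by presburger
    moreover have "m = 4 * t" "(int q - 1) div 4 = 2 * t" if "int q = 8 * t + 1"
      using that by (auto simp: m_def)
    moreover have "m = 4 * t + 1" "(int q - 1) div 4 = 2 * t" if "int q = 8 * t + 3"
      using that by (auto simp: m_def)
    moreover have "m = 4 * t + 2" "(int q - 1) div 4 = 2 * t + 1" if "int q = 8 * t + 5"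
      using that by (auto simp: m_def)
    moreover have "m = 4 * t + 3" "(int q - 1) div 4 = 2 * t + 1" if "int q = 8 * t + 7"
      using that by (auto simp: m_def)
    ultimately show ?thesis by auto
  qed
  finally show ?thesis using G.gauss_lemma by simp
qed

lemma Legendre_reciprocity_1_mod_4:
  assumes "prime l" "prime q" "2 < l" "2 < q" "l \<noteq> q" "q mod 4 = 1"
  shows "Legendre (int l) (int q) = Legendre (int q) (int l)"
proof -
  have "even ((q - 1) div 2)" using assms(6) by presburger
  then have "Legendre (int l) (int q) * Legendre (int q) (int l) = 1"
    using Quadratic_Reciprocity[of l q] assms(1-5) by (simp add: minus_one_power_iff)
  then show ?thesis
    using zmult_eq_1_iff by metis
qed

text \<open>Reduces an identity between symbols of composite arguments to the primes dividing the
  argument, where reciprocity applies.\<close>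

lemma multiplicative_eqI:
  fixes f g :: "nat \<Rightarrow> int"
  assumes "n > 0" "f 1 = g 1"
    and "\<And>a b. f (a * b) = f a * f b" "\<And>a b. g (a * b) = g a * g b"
    and "\<And>l. prime l \<Longrightarrow> l dvd n \<Longrightarrow> f l = g l"
  shows "f n = g n"
  using assms(1,5)
proof (induction n rule: prime_divisors_induct)
  case (unit x)
  then have "x = 1" by simp
  then show ?case using assms(2) by blast
next
  case (factor l x)
  have "x > 0" using factor.prems(1) by (cases x) auto
  moreover have "f r = g r" if "prime r" "r dvd x" for r
    using factor.prems(2)[OF that(1) dvd_mult[OF that(2)]] .
  ultimately have "f x = g x" by (rule factor.IH)
  moreover have "f l = g l"
    using factor.prems(2)[OF factor.hyps(1) dvd_triv_left] .
  ultimately show ?case using assms(3)[of l x] assms(4)[of l x] by argo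
next
  case zero
  then show ?case by blast
qed

text \<open>The Jacobi symbol \<open>(2/n)\<close> as a function of \<open>n\<close>, extended by 0
  to even \<open>n\<close>.\<close>

definition chi8 :: "nat \<Rightarrow> int" where
  "chi8 n = (if n mod 8 \<in> {1, 7} then 1 else if n mod 8 \<in> {3, 5} then -1 else 0)"

text \<open>The Jacobi symbol \<open>(-1/n)\<close>, extended by 0 to even \<open>n\<close>. Unlike
  \<open>(2/n)\<close> it is an odd character on the integers, so signs matter wherever it is
  used.\<close>

definition chi4 :: "nat \<Rightarrow> int" where
  "chi4 n = (if n mod 4 = 1 then 1 else if n mod 4 = 3 then -1 else 0)"

lemma chi8_mult: "chi8 (a * b) = chi8 a * chi8 b"
proof -
  have ab: "(a * b) mod 8 = ((a mod 8) * (b mod 8)) mod 8" by (simp add: mod_mult_eq)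
  have "a mod 8 < 8" "b mod 8 < 8" by auto
  then have "a mod 8 \<in> {0,1,2,3,4,5,6,7}" "b mod 8 \<in> {0,1,2,3,4,5,6,7}" by auto
  then show ?thesis unfolding chi8_def ab
    by (elim insertE emptyE; simp)
qed

lemma chi4_mult: "chi4 (a * b) = chi4 a * chi4 b"
proof -
  have ab: "(a * b) mod 4 = ((a mod 4) * (b mod 4)) mod 4" by (simp add: mod_mult_eq)
  have "a mod 4 < 4" "b mod 4 < 4" by auto
  then have "a mod 4 \<in> {0,1,2,3}" "b mod 4 \<in> {0,1,2,3}" by auto
  then show ?thesis unfolding chi4_def ab
    by (elim insertE emptyE; simp)
qed

section \<open>Symbols modulo a prime congruent to 1 modulo 8\<close>

context
  fixes q :: nat
  assumes q: "prime q" "q mod 8 = 1"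
begin

lemma q_gt_2: "2 < q"
  using q prime_gt_1_nat[of q] by (cases "q = 2") auto

lemma Legendre_2_eq_1: "Legendre 2 (int q) = 1"
  using Legendre_2[OF q(1) q_gt_2] q(2) by simp

lemma Legendre_minus1_eq_1: "Legendre (-1) (int q) = 1"
proof -
  have "q mod 4 = 1" using q(2) by presburger
  then show ?thesis using Legendre_minus1[OF q(1) q_gt_2] by simp
qed

lemma Legendre_minus: "Legendre (- a) (int q) = Legendre a (int q)"
  using Legendre_mult[OF q(1) q_gt_2, of "-1" a] Legendre_minus1_eq_1 by simp

lemma Legendre_abs: "Legendre \<bar>a\<bar> (int q) = Legendre a (int q)"
  using Legendre_minus[of a] by (cases "a \<ge> 0") auto

lemma Legendre_reciprocity: "prime l \<Longrightarrow> 2 < l \<Longrightarrow> l \<noteq> q \<Longrightarrow> Legendre (int l) (int q) = Legendre (int q) (int l)"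
proof -
  have "q mod 4 = 1" using q(2) by presburger
  then show "prime l \<Longrightarrow> 2 < l \<Longrightarrow> l \<noteq> q \<Longrightarrow> ?thesis"
    using Legendre_reciprocity_1_mod_4[of l q] q q_gt_2 by simp
qed

text \<open>The sign of \<open>a\<close> is absorbed because \<open>-1\<close> is a square modulo
  \<open>q\<close>, so comparing with \<open>g\<close> at the primes dividing \<open>a\<close> is
  enough.\<close>

lemma Legendre_eq_multiplicative:
  fixes g :: "nat \<Rightarrow> int"
  assumes "a \<noteq> 0" "g 1 = 1" "\<And>a b. g (a * b) = g a * g b"
    and "\<And>l. prime l \<Longrightarrow> int l dvd a \<Longrightarrow> Legendre (int l) (int q) = g l"
  shows "Legendre a (int q) = g (nat \<bar>a\<bar>)"
proof -
  have "Legendre (int (nat \<bar>a\<bar>)) (int q) = g (nat \<bar>a\<bar>)"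
  proof (rule multiplicative_eqI[where f = "\<lambda>n. Legendre (int n) (int q)"])
    show "Legendre (int (a * b)) (int q) = Legendre (int a) (int q) * Legendre (int b) (int q)" for a b
      using Legendre_mult[OF q(1) q_gt_2] by simp
    show "Legendre (int l) (int q) = g l" if "prime l" "l dvd nat \<bar>a\<bar>" for l
    proof -
      have "int l dvd int (nat \<bar>a\<bar>)" using that(2) by (simp only: int_dvd_int_iff)
      then show ?thesis using assms(4) that(1) by simp
    qed
    show "0 < nat \<bar>a\<bar>" using assms(1) by simp
    show "Legendre (int 1) (int q) = g 1" using assms(2) Legendre_1[OF q(1)] by simp
  qed (rule assms(3))
  then show ?thesis using Legendre_abs by simp
qed

lemma Legendre_eq_1_if_primes:
  assumes "a \<noteq> 0"
    and "\<And>l. prime l \<Longrightarrow> 2 < l \<Longrightarrow> int l dvd a \<Longrightarrow> Legendre (int l) (int q) = 1"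
  shows "Legendre a (int q) = 1"
proof (rule Legendre_eq_multiplicative[where g = "\<lambda>_. 1"])
  show "Legendre (int l) (int q) = 1" if "prime l" "int l dvd a" for l
  proof (cases "l = 2")
    case True
    then show ?thesis using Legendre_2_eq_1 by simp
  next
    case False
    then have "2 < l" using prime_ge_2_nat[OF that(1)] by linarith
    then show ?thesis using assms(2) that by blast
  qed
qed (use assms(1) in simp_all)

end

section \<open>Ideal arithmetic in a subring of the reals\<close>

text \<open>Two-element orbits of \<open>f\<close> are removed one at a time. The application is to
  inversion on the nontrivial ideal classes.\<close>

lemma even_card_involution:
  assumes "finite A" "\<And>x. x \<in> A \<Longrightarrow> f x \<in> A" "\<And>x. x \<in> A \<Longrightarrow> f (f x) = x" "\<And>x. x \<in> A \<Longrightarrow> f x \<noteq> x"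
  shows "even (card A)"
  using assms
proof (induction A rule: finite_psubset_induct)
  case (psubset A)
  show ?case
  proof (cases "A = {}")
    case False
    then obtain x where x: "x \<in> A" by blast
    define B where "B = A - {x, f x}"
    have fx: "f x \<in> A" "f x \<noteq> x" using x psubset.prems by auto
    have "even (card B)"
    proof (rule psubset.IH)
      show "B \<subset> A" using x by (auto simp: B_def)
      show "f y \<in> B" if "y \<in> B" for y
        using that psubset.prems(1,2) x unfolding B_def by (metis DiffE DiffI insert_iff empty_iff)
    qed (use psubset.prems in \<open>auto simp: B_def\<close>)
    moreover have "card A = card B + 2"
    proof -
      have "A = insert x (insert (f x) B)" using x fx by (auto simp: B_def)
      moreover have "x \<notin> insert (f x) B" "f x \<notin> B" using fx by (auto simp: B_def)
      moreover have "finite B" using psubset.hyps by (auto simp: B_def)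
      ultimately show ?thesis by simp
    qed
    ultimately show ?thesis by simp
  qed simp
qed

locale real_subring =
  fixes R :: "real set"
  assumes one_R: "1 \<in> R"
    and diff_R: "\<And>x y. x \<in> R \<Longrightarrow> y \<in> R \<Longrightarrow> x - y \<in> R"
    and mult_R: "\<And>x y. x \<in> R \<Longrightarrow> y \<in> R \<Longrightarrow> x * y \<in> R"
begin

abbreviation idl :: "real set \<Rightarrow> bool" where "idl I \<equiv> is_ideal R I"
abbreviation imul :: "real set \<Rightarrow> real set \<Rightarrow> real set" (infixl "\<star>" 70) where "I \<star> J \<equiv> ideal_mult R I J"
abbreviation pr :: "real \<Rightarrow> real set" where "pr a \<equiv> principal_ideal R a"
abbreviation ipow :: "real set \<Rightarrow> nat \<Rightarrow> real set" where "ipow I n \<equiv> ideal_pow R I n"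

definition nzi :: "real set \<Rightarrow> bool" where "nzi I \<longleftrightarrow> idl I \<and> I \<noteq> {0}"

definition eqv :: "real set \<Rightarrow> real set \<Rightarrow> bool" where "eqv I J \<longleftrightarrow> (I, J) \<in> ideal_equiv R"

lemma zero_R: "0 \<in> R" using diff_R[OF one_R one_R] by simp
lemma uminus_R: "x \<in> R \<Longrightarrow> - x \<in> R" using diff_R[OF zero_R] by simp
lemma add_R: "x \<in> R \<Longrightarrow> y \<in> R \<Longrightarrow> x + y \<in> R" using diff_R[of x "-y"] uminus_R by simp
lemma power_R: "x \<in> R \<Longrightarrow> x ^ n \<in> R" by (induction n) (auto simp: one_R mult_R)
lemma of_nat_R: "of_nat n \<in> R" by (induction n) (auto simp: zero_R one_R add_R)
lemma of_int_R: "of_int n \<in> R"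
  using of_nat_R uminus_R by (cases n rule: int_cases2) auto

lemma idl_R: "idl R" by (auto simp: is_ideal_def zero_R add_R mult_R)

lemma nzi_R: "nzi R" using idl_R one_R by (auto simp: nzi_def)

lemma nzi_idl: "nzi I \<Longrightarrow> idl I" by (simp add: nzi_def)

lemma idlD:
  assumes "idl I"
  shows "I \<subseteq> R" "0 \<in> I" "x \<in> I \<Longrightarrow> y \<in> I \<Longrightarrow> x + y \<in> I" "r \<in> R \<Longrightarrow> x \<in> I \<Longrightarrow> r * x \<in> I"
    "r \<in> R \<Longrightarrow> x \<in> I \<Longrightarrow> x * r \<in> I"
  using assms by (auto simp: is_ideal_def mult.commute)

lemma idl_uminus: "idl I \<Longrightarrow> x \<in> I \<Longrightarrow> - x \<in> I"
  using idlD(4)[of I "-1" x] uminus_R[OF one_R] by simp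

lemma idl_diff: "idl I \<Longrightarrow> x \<in> I \<Longrightarrow> y \<in> I \<Longrightarrow> x - y \<in> I"
  using idlD(3)[of I x "-y"] idl_uminus by simp

lemma idl_in_R: "idl I \<Longrightarrow> x \<in> I \<Longrightarrow> x \<in> R" using idlD(1) by blast

lemma nzi_obtain:
  assumes "nzi I" obtains x where "x \<in> I" "x \<noteq> 0"
  using assms idlD(2)[of I] by (auto simp: nzi_def)

lemma idl_eq_R: "idl I \<Longrightarrow> 1 \<in> I \<Longrightarrow> I = R"
  using idlD(1)[of I] idlD(4)[of I _ 1] by auto

lemma pr_iff: "x \<in> pr a \<longleftrightarrow> (\<exists>r\<in>R. x = r * a)"
  by (auto simp: principal_ideal_def)

lemma idl_pr:
  assumes "a \<in> R" shows "idl (pr a)"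
  unfolding is_ideal_def
proof (intro conjI ballI)
  show "pr a \<subseteq> R" using assms mult_R by (auto simp: pr_iff)
  show "0 \<in> pr a" using zero_R by (force simp: pr_iff)
  show "x + y \<in> pr a" if "x \<in> pr a" "y \<in> pr a" for x y
    using that add_R by (auto simp: pr_iff) (metis distrib_right)
  show "r * x \<in> pr a" if "r \<in> R" "x \<in> pr a" for r x
    using that mult_R by (auto simp: pr_iff)
qed

lemma pr_self: "a \<in> pr a" using one_R by (force simp: pr_iff)

lemma pr_1: "pr 1 = R" by (auto simp: pr_iff)

lemma nzi_pr: "a \<in> R \<Longrightarrow> a \<noteq> 0 \<Longrightarrow> nzi (pr a)"
  using idl_pr pr_self[of a] by (auto simp: nzi_def)

lemma pr_subset: "idl I \<Longrightarrow> a \<in> I \<Longrightarrow> pr a \<subseteq> I"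
  using idlD by (auto simp: pr_iff)

lemma idl_imul: "idl I \<Longrightarrow> idl J \<Longrightarrow> idl (I \<star> J)"
proof -
  assume IJ: "idl I" "idl J"
  let ?F = "{K. idl K \<and> {x * y |x y. x \<in> I \<and> y \<in> J} \<subseteq> K}"
  \<comment> \<open>The family intersected in \<open>ideal_mult\<close> is nonempty because
    \<open>R\<close> belongs to it; this keeps the intersection inside \<open>R\<close>.\<close>
  have "R \<in> ?F" using idl_R IJ[THEN idlD(1)] mult_R by blast
  then show ?thesis unfolding ideal_mult_def is_ideal_def
    by (intro conjI ballI InterI) (auto simp: is_ideal_def)
qed

lemma imul_mem: "x \<in> I \<Longrightarrow> y \<in> J \<Longrightarrow> x * y \<in> I \<star> J"
  by (auto simp: ideal_mult_def)

lemma imul_least: "idl K \<Longrightarrow> (\<And>x y. x \<in> I \<Longrightarrow> y \<in> J \<Longrightarrow> x * y \<in> K) \<Longrightarrow> I \<star> J \<subseteq> K"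
  by (auto simp: ideal_mult_def)

lemma imul_comm: "I \<star> J = J \<star> I"
proof -
  have "{x * y |x y. x \<in> I \<and> y \<in> J} = {x * y |x y. x \<in> J \<and> y \<in> I}" for I J :: "real set"
    by (auto simp: mult.commute) (metis mult.commute)+
  then show ?thesis unfolding ideal_mult_def by metis
qed

text \<open>A product is known only as a smallest ideal, so the argument is by minimality: for fixed
  \<open>k\<close>, the \<open>z\<close> with \<open>z * k\<close> in the right-hand side form an
  ideal containing every \<open>x * y\<close>.\<close>

lemma imul_assoc_subset:
  assumes "idl I" "idl J" "idl K"
  shows "(I \<star> J) \<star> K \<subseteq> I \<star> (J \<star> K)"
proof (rule imul_least)
  show id: "idl (I \<star> (J \<star> K))" using assms idl_imul by blast
  fix z k assume z: "z \<in> I \<star> J" and k: "k \<in> K"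
  let ?S = "{z \<in> R. z * k \<in> I \<star> (J \<star> K)}"
  have kR: "k \<in> R" using k assms idl_in_R by blast
  have "I \<star> J \<subseteq> ?S"
  proof (rule imul_least)
    show "idl ?S" unfolding is_ideal_def
      using idlD[OF id] zero_R add_R mult_R by (auto simp: distrib_right mult.assoc)
    fix x y assume "x \<in> I" "y \<in> J"
    then show "x * y \<in> ?S"
      using k assms idl_in_R mult_R imul_mem[of x I "y * k" "J \<star> K"] imul_mem[of y J k K]
      by (auto simp: mult.assoc)
  qed
  then show "z * k \<in> I \<star> (J \<star> K)" using z by blast
qed

lemma imul_assoc:
  assumes "idl I" "idl J" "idl K"
  shows "(I \<star> J) \<star> K = I \<star> (J \<star> K)"
proof
  show "(I \<star> J) \<star> K \<subseteq> I \<star> (J \<star> K)" using imul_assoc_subset assms by blast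
  have "(K \<star> J) \<star> I \<subseteq> K \<star> (J \<star> I)" using imul_assoc_subset assms by blast
  then show "I \<star> (J \<star> K) \<subseteq> (I \<star> J) \<star> K" by (metis imul_comm)
qed

lemma imul_mono: "idl I \<Longrightarrow> idl J \<Longrightarrow> I' \<subseteq> I \<Longrightarrow> J' \<subseteq> J \<Longrightarrow> I' \<star> J' \<subseteq> I \<star> J"
  by (rule imul_least) (auto intro: idl_imul imul_mem)

lemma imul_R: "idl I \<Longrightarrow> I \<star> R = I"
proof
  assume I: "idl I"
  then show "I \<star> R \<subseteq> I" by (intro imul_least) (auto dest: idlD)
  show "I \<subseteq> I \<star> R" using imul_mem[of _ I 1 R] one_R by auto
qed

lemma R_imul: "idl I \<Longrightarrow> R \<star> I = I" using imul_R imul_comm by metis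

lemma imul_subset_left: "idl I \<Longrightarrow> idl J \<Longrightarrow> I \<star> J \<subseteq> I"
  by (rule imul_least) (auto dest: idlD)

text \<open>Translates the scaled sets in \<open>ideal_equiv\<close> into products with principal
  ideals, so that equivalence can be handled inside ideal multiplication.\<close>

lemma pr_imul:
  assumes "idl I" "a \<in> R"
  shows "pr a \<star> I = (\<lambda>x. a * x) ` I"
proof
  show "pr a \<star> I \<subseteq> (\<lambda>x. a * x) ` I"
  proof (rule imul_least)
    show "idl ((\<lambda>x. a * x) ` I)" unfolding is_ideal_def
    proof (intro conjI ballI)
      show "(*) a ` I \<subseteq> R" using assms idlD mult_R by blast
      show "0 \<in> (*) a ` I" using idlD(2)[OF assms(1)] by force
      show "x + y \<in> (*) a ` I" if "x \<in> (*) a ` I" "y \<in> (*) a ` I" for x y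
        using that idlD(3)[OF assms(1)] by (auto simp: image_iff) (metis distrib_left)
      show "r * x \<in> (*) a ` I" if "r \<in> R" "x \<in> (*) a ` I" for r x
        using that idlD(4)[OF assms(1)] by (auto simp: image_iff)
    qed
    fix x y assume "x \<in> pr a" "y \<in> I"
    then show "x * y \<in> (*) a ` I" using idlD(4)[OF assms(1)]
      by (auto simp: pr_iff image_iff)
  qed
  show "(\<lambda>x. a * x) ` I \<subseteq> pr a \<star> I" using imul_mem[of a "pr a" _ I] pr_self by auto
qed

lemma pr_imul_pr: "a \<in> R \<Longrightarrow> b \<in> R \<Longrightarrow> pr a \<star> pr b = pr (a * b)"
  using pr_imul[OF idl_pr, of b a] by (simp add: principal_ideal_def image_image mult_ac)

lemma nzi_imul: "nzi I \<Longrightarrow> nzi J \<Longrightarrow> nzi (I \<star> J)"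
proof -
  assume IJ: "nzi I" "nzi J"
  obtain x where x: "x \<in> I" "x \<noteq> 0" using nzi_obtain[OF IJ(1)] .
  obtain y where y: "y \<in> J" "y \<noteq> 0" using nzi_obtain[OF IJ(2)] .
  have "x * y \<in> I \<star> J" "x * y \<noteq> 0" using imul_mem x y by auto
  then show ?thesis using IJ idl_imul by (auto simp: nzi_def)
qed

lemma idl_ipow: "idl I \<Longrightarrow> idl (ipow I n)"
  by (induction n) (auto simp: idl_R idl_imul)

lemma nzi_ipow: "nzi I \<Longrightarrow> nzi (ipow I n)"
  by (induction n) (auto simp: nzi_R nzi_imul)

lemma imul_left_comm: "idl I \<Longrightarrow> idl J \<Longrightarrow> idl K \<Longrightarrow> I \<star> (J \<star> K) = J \<star> (I \<star> K)"
  by (metis imul_assoc imul_comm)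

lemma imul_swap: "idl I \<Longrightarrow> idl J \<Longrightarrow> idl K \<Longrightarrow> idl L \<Longrightarrow> (I \<star> J) \<star> (K \<star> L) = (I \<star> K) \<star> (J \<star> L)"
  by (simp add: imul_assoc idl_imul imul_left_comm)

lemma pr_cancel:
  assumes "a \<in> R" "a \<noteq> 0" "idl I" "idl J" "pr a \<star> I = pr a \<star> J"
  shows "I = J"
proof -
  have "inj (\<lambda>x::real. a * x)" using assms(2) by (auto simp: inj_on_def)
  then show ?thesis using assms by (simp add: pr_imul inj_image_eq_iff)
qed

lemma eqv_iff: "eqv I J \<longleftrightarrow> nzi I \<and> nzi J \<and> (\<exists>a\<in>R. \<exists>b\<in>R. a \<noteq> 0 \<and> b \<noteq> 0 \<and> pr a \<star> I = pr b \<star> J)"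
proof -
  have "(\<lambda>x. a * x) ` I = (\<lambda>x. b * x) ` J \<longleftrightarrow> pr a \<star> I = pr b \<star> J" if "idl I" "idl J" "a \<in> R" "b \<in> R" for a b
    using that by (simp add: pr_imul)
  then show ?thesis unfolding eqv_def ideal_equiv_def nzi_def mem_Collect_eq case_prod_conv by meson
qed

lemma eqvI: "nzi I \<Longrightarrow> nzi J \<Longrightarrow> a \<in> R \<Longrightarrow> b \<in> R \<Longrightarrow> a \<noteq> 0 \<Longrightarrow> b \<noteq> 0 \<Longrightarrow> pr a \<star> I = pr b \<star> J \<Longrightarrow> eqv I J"
  unfolding eqv_iff by blast

lemma eqv_refl: "nzi I \<Longrightarrow> eqv I I"
  using one_R by (intro eqvI[of I I 1 1]) simp_all

lemma eqv_sym: "eqv I J \<Longrightarrow> eqv J I"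
  unfolding eqv_iff by metis

lemma eqv_trans:
  assumes "eqv I J" "eqv J K" shows "eqv I K"
proof -
  obtain a b where ab: "a \<in> R" "b \<in> R" "a \<noteq> 0" "b \<noteq> 0" "pr a \<star> I = pr b \<star> J"
    using assms(1) by (auto simp: eqv_iff)
  obtain c d where cd: "c \<in> R" "d \<in> R" "c \<noteq> 0" "d \<noteq> 0" "pr c \<star> J = pr d \<star> K"
    using assms(2) by (auto simp: eqv_iff)
  have n: "nzi I" "nzi J" "nzi K" using assms by (auto simp: eqv_iff)
  note [simp] = idl_pr n[THEN nzi_idl] ab cd mult_R
  have "pr (c * a) \<star> I = pr c \<star> (pr a \<star> I)" by (simp add: pr_imul_pr[symmetric] imul_assoc del: ab(5))
  also have "\<dots> = pr b \<star> (pr c \<star> J)" by (simp add: imul_left_comm del: cd(5))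
  also have "\<dots> = pr (b * d) \<star> K" by (simp add: pr_imul_pr[symmetric] imul_assoc)
  finally show ?thesis using n by (intro eqvI[of I K "c * a" "b * d"]) auto
qed

lemma eqv_imul:
  assumes "eqv I J" "eqv I' J'" shows "eqv (I \<star> I') (J \<star> J')"
proof -
  obtain a b where ab: "a \<in> R" "b \<in> R" "a \<noteq> 0" "b \<noteq> 0" "pr a \<star> I = pr b \<star> J"
    using assms(1) by (auto simp: eqv_iff)
  obtain c d where cd: "c \<in> R" "d \<in> R" "c \<noteq> 0" "d \<noteq> 0" "pr c \<star> I' = pr d \<star> J'"
    using assms(2) by (auto simp: eqv_iff)
  have n: "nzi I" "nzi J" "nzi I'" "nzi J'" using assms by (auto simp: eqv_iff)
  have "pr (a * c) \<star> (I \<star> I') = (pr a \<star> I) \<star> (pr c \<star> I')"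
    using n ab cd by (simp add: pr_imul_pr[symmetric] imul_swap idl_pr nzi_idl)
  also have "\<dots> = pr (b * d) \<star> (J \<star> J')"
    using n ab(1,2) cd(1,2) unfolding ab(5) cd(5) by (simp add: pr_imul_pr[symmetric] imul_swap idl_pr nzi_idl)
  finally show ?thesis using n ab cd
    by (intro eqvI[of "I \<star> I'" "J \<star> J'" "a * c" "b * d"]) (auto simp: nzi_imul mult_R)
qed

lemma eqv_nzi: "eqv I J \<Longrightarrow> nzi I" "eqv I J \<Longrightarrow> nzi J"
  by (auto simp: eqv_iff)

lemma eqv_pr_R: "a \<in> R \<Longrightarrow> a \<noteq> 0 \<Longrightarrow> eqv (pr a) R"
  using one_R by (intro eqvI[of _ _ 1 a]) (auto simp: nzi_pr nzi_R pr_1 R_imul imul_R idl_pr)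

text \<open>From \<open>a I = (b)\<close> the number \<open>b\<close> has the form
  \<open>a c\<close> with \<open>c\<close> in \<open>I\<close>; cancelling \<open>a\<close> shows
  that this \<open>c\<close> is a generator.\<close>

lemma eqv_R_imp_pr:
  assumes "eqv I R" obtains a where "a \<in> R" "a \<noteq> 0" "I = pr a"
proof -
  obtain a b where ab: "a \<in> R" "b \<in> R" "a \<noteq> 0" "b \<noteq> 0" "pr a \<star> I = pr b \<star> R"
    using assms by (auto simp: eqv_iff)
  have I: "idl I" using assms by (auto simp: eqv_iff nzi_def)
  have "pr a \<star> I = pr b" using ab by (simp add: imul_R idl_pr)
  then have "b \<in> (\<lambda>x. a * x) ` I" using pr_self[of b] pr_imul[OF I ab(1)] by simp
  then obtain c where c: "c \<in> I" "b = a * c" by blast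
  then have cR: "c \<in> R" using I idl_in_R by blast
  have "pr a \<star> I = pr a \<star> pr c" using \<open>pr a \<star> I = pr b\<close> c cR ab by (simp add: pr_imul_pr)
  then have "I = pr c" using pr_cancel ab I idl_pr cR by blast
  then show ?thesis using that c cR ab by auto
qed

lemma eqv_mult_pr: "nzi I \<Longrightarrow> a \<in> R \<Longrightarrow> a \<noteq> 0 \<Longrightarrow> eqv (pr a \<star> I) I"
  using eqv_imul[OF eqv_pr_R eqv_refl, of a I] R_imul nzi_idl by metis

lemma equiv_ideal_equiv: "equiv {I. nzi I} (ideal_equiv R)"
proof (rule equivI)
  show "ideal_equiv R \<subseteq> {I. nzi I} \<times> {I. nzi I}" by (auto simp: ideal_equiv_def nzi_def)
  show "refl_on {I. nzi I} (ideal_equiv R)"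
    using eqv_refl by (auto simp: refl_on_def eqv_def)
  show "sym (ideal_equiv R)" using eqv_sym by (auto simp: sym_def eqv_def)
  show "trans (ideal_equiv R)" using eqv_trans unfolding trans_def eqv_def by blast
qed

end

section \<open>The group of ideal classes\<close>

locale real_subring_class_group = real_subring +
  assumes inverse_ex: "\<And>I. nzi I \<Longrightarrow> \<exists>J. nzi J \<and> eqv (I \<star> J) R"
    and finite_classes: "finite ({I. nzi I} // ideal_equiv R)"
begin

definition cls :: "real set \<Rightarrow> real set set" where "cls I = ideal_equiv R `` {I}"

text \<open>Multiplies arbitrarily chosen representatives; \<open>cmul_cls\<close> shows that the
  choice does not matter on classes of nonzero ideals.\<close>

definition cmul :: "real set set \<Rightarrow> real set set \<Rightarrow> real set set" where
  "cmul X Y = cls ((SOME I. I \<in> X) \<star> (SOME J. J \<in> Y))"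

definition ClG :: "real set set monoid" where
  "ClG = \<lparr>carrier = {I. nzi I} // ideal_equiv R, mult = cmul, one = cls R\<rparr>"

lemma cls_eq_iff: "nzi I \<Longrightarrow> nzi J \<Longrightarrow> cls I = cls J \<longleftrightarrow> eqv I J"
  unfolding cls_def eqv_def using eq_equiv_class_iff[OF equiv_ideal_equiv] by simp

lemma cls_carrier: "nzi I \<Longrightarrow> cls I \<in> carrier ClG"
  by (simp add: ClG_def cls_def quotientI)

lemma cls_exhaust: "X \<in> carrier ClG \<Longrightarrow> \<exists>I. nzi I \<and> X = cls I"
  by (auto simp: ClG_def cls_def elim: quotientE)

lemma cmul_cls: "nzi I \<Longrightarrow> nzi J \<Longrightarrow> cmul (cls I) (cls J) = cls (I \<star> J)"
proof -
  assume IJ: "nzi I" "nzi J"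
  have "(SOME A. A \<in> cls K) \<in> cls K" if "nzi K" for K
    using someI[of "\<lambda>A. A \<in> cls K" K] eqv_refl[OF that] by (auto simp: cls_def eqv_def)
  then have s: "eqv K (SOME A. A \<in> cls K)" if "nzi K" for K
    using that by (auto simp: cls_def eqv_def)
  show ?thesis unfolding cmul_def
    using eqv_sym[OF eqv_imul[OF s[OF IJ(1)] s[OF IJ(2)]]] cls_eq_iff eqv_nzi by metis
qed

lemma group_ClG: "group ClG"
proof (rule groupI)
  have m: "x \<otimes>\<^bsub>ClG\<^esub> y = cmul x y" for x y by (simp add: ClG_def)
  have o: "\<one>\<^bsub>ClG\<^esub> = cls R" by (simp add: ClG_def)
  show "x \<otimes>\<^bsub>ClG\<^esub> y \<in> carrier ClG" if "x \<in> carrier ClG" "y \<in> carrier ClG" for x y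
    using cls_exhaust[OF that(1)] cls_exhaust[OF that(2)] by (auto simp: m cmul_cls cls_carrier nzi_imul)
  show "\<one>\<^bsub>ClG\<^esub> \<in> carrier ClG" using cls_carrier nzi_R by (simp add: o)
  show "x \<otimes>\<^bsub>ClG\<^esub> y \<otimes>\<^bsub>ClG\<^esub> z = x \<otimes>\<^bsub>ClG\<^esub> (y \<otimes>\<^bsub>ClG\<^esub> z)"
    if "x \<in> carrier ClG" "y \<in> carrier ClG" "z \<in> carrier ClG" for x y z
    using cls_exhaust[OF that(1)] cls_exhaust[OF that(2)] cls_exhaust[OF that(3)]
    by (auto simp: m cmul_cls nzi_imul imul_assoc nzi_idl)
  show "\<one>\<^bsub>ClG\<^esub> \<otimes>\<^bsub>ClG\<^esub> x = x" if "x \<in> carrier ClG" for x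
    using cls_exhaust[OF that] by (auto simp: m o cmul_cls nzi_R R_imul nzi_idl)
  show "\<exists>y\<in>carrier ClG. y \<otimes>\<^bsub>ClG\<^esub> x = \<one>\<^bsub>ClG\<^esub>" if x: "x \<in> carrier ClG" for x
  proof -
    obtain I where I: "nzi I" "x = cls I" using cls_exhaust[OF x] by blast
    obtain J where J: "nzi J" "eqv (I \<star> J) R" using inverse_ex[OF I(1)] by blast
    have "cmul (cls J) x = cls R"
      using I J by (simp add: cmul_cls cls_eq_iff nzi_imul nzi_R imul_comm)
    then show ?thesis using cls_carrier[OF J(1)] by (auto simp: m o)
  qed
qed

lemma class_number_eq: "class_number R = card (carrier ClG)"
  by (simp add: class_number_def ClG_def nzi_def)

lemma ClG_pow: "nzi I \<Longrightarrow> cls I [^]\<^bsub>ClG\<^esub> (n::nat) = cls (ipow I n)"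
proof (induction n)
  case 0
  then show ?case by (simp add: ClG_def nat_pow_def)
next
  case (Suc n)
  have "cls I [^]\<^bsub>ClG\<^esub> Suc n = cmul (cls (ipow I n)) (cls I)"
    using Suc group.is_monoid[OF group_ClG] by (simp add: monoid.nat_pow_Suc) (simp add: ClG_def)
  then show ?case using Suc.prems by (simp add: cmul_cls nzi_ipow imul_comm)
qed

lemma eqv_ipow_class_number: "nzi I \<Longrightarrow> eqv (ipow I (class_number R)) R"
proof -
  assume I: "nzi I"
  have "cls I [^]\<^bsub>ClG\<^esub> order ClG = \<one>\<^bsub>ClG\<^esub>"
    using group.pow_order_eq_1[OF group_ClG] cls_carrier[OF I] by blast
  then have "cls (ipow I (class_number R)) = cls R"
    using ClG_pow[OF I] by (simp add: order_def class_number_eq) (simp add: ClG_def)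
  then show ?thesis using cls_eq_iff nzi_ipow[OF I] nzi_R by blast
qed

text \<open>If only the trivial class squares to the trivial class, inversion has no fixed point
  among the nontrivial classes, so these are even in number.\<close>

lemma odd_class_number:
  assumes "\<And>I. nzi I \<Longrightarrow> eqv (I \<star> I) R \<Longrightarrow> eqv I R"
  shows "odd (class_number R)"
proof -
  interpret G: group ClG by (rule group_ClG)
  let ?A = "carrier ClG - {\<one>\<^bsub>ClG\<^esub>}"
  have fin: "finite (carrier ClG)" using finite_classes by (simp add: ClG_def)
  have "even (card ?A)"
  proof (rule even_card_involution[where f = "\<lambda>x. inv\<^bsub>ClG\<^esub> x"])
    fix x assume x: "x \<in> ?A"
    then show "inv\<^bsub>ClG\<^esub> x \<in> ?A" by auto
    show "inv\<^bsub>ClG\<^esub> (inv\<^bsub>ClG\<^esub> x) = x" using x by simp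
    show "inv\<^bsub>ClG\<^esub> x \<noteq> x"
    proof
      assume "inv\<^bsub>ClG\<^esub> x = x"
      then have xx: "x \<otimes>\<^bsub>ClG\<^esub> x = \<one>\<^bsub>ClG\<^esub>" using x by (metis DiffD1 G.r_inv)
      obtain I where I: "nzi I" "x = cls I" using cls_exhaust[of x] x by blast
      have "cls (I \<star> I) = cls R" using xx I cmul_cls by (simp add: ClG_def)
      then have "eqv I R" using assms I cls_eq_iff nzi_imul nzi_R by blast
      then have "x = \<one>\<^bsub>ClG\<^esub>" using I cls_eq_iff nzi_R by (simp add: ClG_def)
      then show False using x by blast
    qed
  qed (use fin in auto)
  moreover have "card (carrier ClG) = Suc (card ?A)"
    using fin G.one_closed by (metis card.remove)
  ultimately show ?thesis unfolding class_number_eq by (metis even_Suc)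
qed

end

section \<open>Rings of integers of real quadratic fields\<close>

text \<open>If \<open>v\<close> is the denominator of \<open>\<nu>\<close>, then \<open>v^k\<close>
  divides the fixed nonzero \<open>M\<close> for every \<open>k\<close>, which forces
  \<open>v = 1\<close>.\<close>

lemma bounded_denominators_imp_int:
  fixes \<nu> :: real and M :: int
  assumes "\<nu> \<in> \<rat>" "M \<noteq> 0" and int: "\<And>k::nat. of_int M * \<nu> ^ k \<in> \<int>"
  shows "\<nu> \<in> \<int>"
proof -
  obtain u v :: int where uv: "\<nu> = of_int u / of_int v" "v > 0" "coprime u v"
    using assms(1) by (metis Rats_cases')
  have dvd: "v ^ k dvd M" for k
  proof -
    obtain z where "of_int M * \<nu> ^ k = of_int z" using int[of k] Ints_cases by blast
    then have "of_int (M * u ^ k) = (of_int (z * v ^ k) :: real)"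
      using uv(2) by (simp add: uv(1) field_simps)
    then have "M * u ^ k = z * v ^ k" by (simp only: of_int_eq_iff)
    then have "v ^ k dvd M * u ^ k" by simp
    moreover have "coprime (v ^ k) (u ^ k)" using uv(3) by (simp add: coprime_commute)
    ultimately show ?thesis using coprime_dvd_mult_left_iff by blast
  qed
  have "v = 1"
  proof (rule ccontr)
    assume "v \<noteq> 1"
    then have "2 \<le> v" using uv(2) by linarith
    \<comment> \<open>With this exponent \<open>|M| = k < 2^k <= v^k\<close>, which contradicts the
      divisibility.\<close>
    define k where "k = nat \<bar>M\<bar>"
    have "(2::int) ^ k \<le> v ^ k" using \<open>2 \<le> v\<close> by (intro power_mono) auto
    also have "v ^ k \<le> \<bar>M\<bar>" using dvd[of k] assms(2) dvd_imp_le_int[of M "v ^ k"] by linarith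
    also have "\<bar>M\<bar> = int k" by (simp add: k_def)
    also have "int k < 2 ^ k" by (metis of_nat_less_two_power)
    finally show False by simp
  qed
  then show ?thesis using uv(1) by simp
qed

locale real_quad =
  fixes d :: int
  assumes d_gt_1: "d > 1" and d_mod_8: "d mod 8 = 1" and d_squarefree: "squarefree d"
begin

abbreviation s :: real where "s \<equiv> sqrt (of_int d)"
abbreviation R :: "real set" where "R \<equiv> OK d"
abbreviation cnj :: "real \<Rightarrow> real" where "cnj \<equiv> qconj d"

text \<open>Doubled coordinates keep everything in terms of integers; integrality of the number
  becomes the parity condition \<open>even (u - v)\<close>.\<close>

definition el :: "int \<Rightarrow> int \<Rightarrow> real" where "el u v = (of_int u + of_int v * s) / 2"

lemma odd_d: "odd d" using d_mod_8 by presburger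

lemma s_sq: "s * s = of_int d" using d_gt_1 by simp

lemma square_dvd_d: "x ^ 2 dvd d \<Longrightarrow> \<bar>x\<bar> = 1"
  using d_squarefree by (auto simp: squarefree_def)

lemma d_not_square: "x ^ 2 \<noteq> d"
  using square_dvd_d[of x] d_gt_1 by (metis dvd_refl less_irrefl power2_abs one_power2)

text \<open>After division by the gcd, \<open>y'^2\<close> divides the coprime \<open>x'^2\<close>,
  so it is 1 and \<open>d\<close> would be a square.\<close>

lemma d_mult_square_eq:
  assumes "x ^ 2 = d * y ^ 2" shows "x = 0 \<and> y = 0"
proof (cases "y = 0")
  case False
  define g where "g = gcd x y"
  have g: "g \<noteq> 0" using False by (simp add: g_def)
  obtain x' y' where xy: "x = x' * g" "y = y' * g" "coprime x' y'"
    using gcd_coprime_exists[of x y] g unfolding g_def by blast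
  have "(x' * g) ^ 2 = d * (y' * g) ^ 2" using assms unfolding xy(1)[symmetric] xy(2)[symmetric] .
  then have "x' ^ 2 * g ^ 2 = (d * y' ^ 2) * g ^ 2" by (simp only: power_mult_distrib mult_ac)
  then have "x' ^ 2 = d * y' ^ 2" using g by (simp only: mult_cancel_right power_eq_0_iff) simp
  then have "y' ^ 2 dvd x' ^ 2" by (metis dvd_triv_right)
  moreover have "coprime (y' ^ 2) (x' ^ 2)" using xy(3) by (simp add: coprime_commute)
  ultimately have "is_unit (y' ^ 2)" using coprime_absorb_left by blast
  then have "\<bar>y' ^ 2\<bar> = 1" by (simp only: zdvd1_eq)
  then have "x' ^ 2 = d" using \<open>x' ^ 2 = d * y' ^ 2\<close> by simp
  then show ?thesis using d_not_square by blast
qed (use assms in auto)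

lemma irrational: "a \<in> \<rat> \<Longrightarrow> b \<in> \<rat> \<Longrightarrow> a + b * s = 0 \<Longrightarrow> a = 0 \<and> b = 0"
proof -
  assume a: "a \<in> \<rat>" and b: "b \<in> \<rat>" and ab: "a + b * s = 0"
  obtain a1 a2 :: int where a12: "a = of_int a1 / of_int a2" "a2 > 0" using a by (metis Rats_cases')
  obtain b1 b2 :: int where b12: "b = of_int b1 / of_int b2" "b2 > 0" using b by (metis Rats_cases')
  have "of_int (a1 * b2) = - (of_int (b1 * a2) * s)"
    using ab a12(2) b12(2) by (simp add: a12(1) b12(1) field_simps)
  then have "(of_int (a1 * b2))\<^sup>2 = (of_int (b1 * a2))\<^sup>2 * (s * s)"
    by (simp add: power2_eq_square)
  then have "of_int ((a1 * b2)\<^sup>2) = (of_int (d * (b1 * a2)\<^sup>2) :: real)" using s_sq by simp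
  then have "(a1 * b2)\<^sup>2 = d * (b1 * a2)\<^sup>2" by (simp only: of_int_eq_iff)
  then have "a1 * b2 = 0 \<and> b1 * a2 = 0" by (rule d_mult_square_eq)
  then show ?thesis using a12 b12 by auto
qed

lemma irrational_eq:
  assumes "a \<in> \<rat>" "b \<in> \<rat>" "a' \<in> \<rat>" "b' \<in> \<rat>" "a + b * s = a' + b' * s"
  shows "a = a' \<and> b = b'"
proof -
  have "(a - a') + (b - b') * s = 0" using assms(5) by (simp add: algebra_simps)
  then show ?thesis using irrational[of "a - a'" "b - b'"] assms by simp
qed

lemma cnj_rat: "a \<in> \<rat> \<Longrightarrow> b \<in> \<rat> \<Longrightarrow> cnj (a + b * s) = a - b * s"
proof -
  assume ab: "a \<in> \<rat>" "b \<in> \<rat>"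
  show ?thesis unfolding qconj_def
  proof (rule the_equality)
    fix y assume "\<exists>a' b'. a' \<in> \<rat> \<and> b' \<in> \<rat> \<and> a + b * s = a' + b' * s \<and> y = a' - b' * s"
    then show "y = a - b * s" using irrational_eq[OF ab] by blast
  qed (use ab in blast)
qed

lemma el_eq_iff: "el u v = el u' v' \<longleftrightarrow> u = u' \<and> v = v'"
proof
  assume "el u v = el u' v'"
  then have "of_int u + of_int v * s = of_int u' + of_int v' * s" by (simp add: el_def)
  then show "u = u' \<and> v = v'" using irrational_eq[of "of_int u" "of_int v" "of_int u'" "of_int v'"] by simp
qed simp

lemma cnj_el: "cnj (el u v) = el u (- v)"
  using cnj_rat[of "of_int u / 2" "of_int v / 2"] by (simp add: el_def add_divide_distrib diff_divide_distrib)

lemma el_add: "el u v + el u' v' = el (u + u') (v + v')"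
  by (simp add: el_def algebra_simps add_divide_distrib)

lemma el_diff: "el u v - el u' v' = el (u - u') (v - v')"
  by (simp add: el_def algebra_simps add_divide_distrib diff_divide_distrib)

lemma el_uminus: "- el u v = el (- u) (- v)"
  by (simp add: el_def algebra_simps add_divide_distrib diff_divide_distrib)

lemma el_of_int: "of_int n = el (2 * n) 0"
  by (simp add: el_def)

lemma el_scale: "of_int n * el u v = el (n * u) (n * v)"
  by (simp add: el_def algebra_simps)

lemma el_mult:
  assumes "2 * x = u * u' + d * (v * v')" "2 * y = u * v' + u' * v"
  shows "el u v * el u' v' = el x y"
proof -
  have "4 * (el u v * el u' v') = of_int u * of_int u' + of_int v * of_int v' * (s * s)
      + (of_int u * of_int v' + of_int u' * of_int v) * s"
    by (simp add: el_def algebra_simps)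
  also have "\<dots> = of_int (u * u' + d * (v * v')) + of_int (u * v' + u' * v) * s"
    unfolding s_sq by (simp add: algebra_simps)
  also have "\<dots> = 4 * el x y" unfolding assms[symmetric] by (simp add: el_def)
  finally show ?thesis by simp
qed

text \<open>\<open>alg_integer\<close> provides a monic polynomial of unknown degree
  \<open>N\<close>. Reducing high powers by it shows that \<open>n^N\<close> is a common denominator
  of all powers of \<open>x\<close>; expanding \<open>(x + 1)^k\<close> extends this to the powers
  of \<open>x + 1\<close>.\<close>

lemma ring_power_integral:
  assumes x: "x = (of_int r + of_int t * s) / of_int n" "n \<noteq> 0" and "alg_integer x"
  shows "\<exists>M::int. M \<noteq> 0 \<and> (\<forall>k j. \<exists>r' t'. of_int M * (x ^ j * (x + 1) ^ k) = of_int r' + of_int t' * s)"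
proof -
  define Zs where "Zs = {z. \<exists>r' t'. z = of_int r' + of_int t' * s}"
  have Zs_add: "y + z \<in> Zs" if yz: "y \<in> Zs" "z \<in> Zs" for y z
  proof -
    obtain a b a' b' where "y = of_int a + of_int b * s" "z = of_int a' + of_int b' * s"
      using yz unfolding Zs_def by blast
    then have "y + z = of_int (a + a') + of_int (b + b') * s" by (simp add: algebra_simps)
    then show ?thesis unfolding Zs_def by blast
  qed
  have Zs_mult: "y * z \<in> Zs" if yz: "y \<in> Zs" "z \<in> Zs" for y z
  proof -
    obtain a b a' b' where "y = of_int a + of_int b * s" "z = of_int a' + of_int b' * s"
      using yz unfolding Zs_def by blast
    then have "y * z = of_int a * of_int a' + of_int b * of_int b' * (s * s) + (of_int a * of_int b' + of_int a' * of_int b) * s"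
      by (simp add: algebra_simps)
    also have "\<dots> = of_int (a * a' + b * b' * d) + of_int (a * b' + a' * b) * s"
      unfolding s_sq by simp
    finally show ?thesis unfolding Zs_def by blast
  qed
  have Zs_int: "of_int z \<in> Zs" for z
  proof -
    have "of_int z = of_int z + of_int 0 * s" by simp
    then show ?thesis unfolding Zs_def by blast
  qed
  have Zs_pow: "y ^ k \<in> Zs" if "y \<in> Zs" for y and k :: nat
    using that Zs_mult Zs_int[of 1] by (induction k) auto
  have Zs_sum: "(\<Sum>i\<in>A. f i) \<in> Zs" if "\<And>i. i \<in> A \<Longrightarrow> f i \<in> Zs" for A and f :: "nat \<Rightarrow> real"
    using that Zs_add Zs_int[of 0] by (induction A rule: infinite_finite_induct) auto
  have nx: "of_int n * x \<in> Zs" using x by (auto simp: Zs_def)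
  obtain P :: "int poly" where P: "lead_coeff P = 1" "poly (map_poly of_int P) x = 0"
    using assms(3) by (auto simp: alg_integer_def)
  define N where "N = degree P"
  define M where "M = n ^ N"
  have "(\<Sum>i\<le>N. of_int (Polynomial.coeff P i) * x ^ i) = 0"
    using P(2) by (simp add: poly_altdef degree_map_poly coeff_map_poly N_def)
  then have xN: "x ^ N = - (\<Sum>i<N. of_int (Polynomial.coeff P i) * x ^ i)"
    using P(1) by (simp add: N_def lessThan_Suc_atMost[symmetric])
  have Mx: "of_int M * x ^ j \<in> Zs" for j
  proof (induction j rule: less_induct)
    case (less j)
    show ?case
    proof (cases "j < N")
      case True
      then have "of_int M * x ^ j = of_int (n ^ (N - j)) * (of_int n * x) ^ j"
        by (simp add: M_def power_mult_distrib power_add[symmetric])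
      then show ?thesis using Zs_mult Zs_int Zs_pow nx by simp
    next
      case False
      then have "x ^ j = x ^ (j - N) * x ^ N" by (simp add: power_add[symmetric])
      also have "\<dots> = (\<Sum>i<N. of_int (- Polynomial.coeff P i) * x ^ (j - N + i))"
        unfolding xN by (simp add: sum_distrib_left sum_negf power_add mult_ac)
      finally have "of_int M * x ^ j = (\<Sum>i<N. of_int (- Polynomial.coeff P i) * (of_int M * x ^ (j - N + i)))"
        by (simp only: sum_distrib_left mult_ac)
      moreover have "of_int M * x ^ (j - N + i) \<in> Zs" if "i < N" for i
        using False that by (intro less.IH) auto
      ultimately show ?thesis using Zs_sum Zs_mult Zs_int
        by (metis (no_types, lifting) lessThan_iff)
    qed
  qed
  have "of_int M * (x ^ j * (x + 1) ^ k) \<in> Zs" for j k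
  proof (induction k arbitrary: j)
    case (Suc k)
    have "of_int M * (x ^ j * (x + 1) ^ Suc k) =
      of_int M * (x ^ Suc j * (x + 1) ^ k) + of_int M * (x ^ j * (x + 1) ^ k)"
      by (simp add: algebra_simps)
    then show ?case using Suc Zs_add by presburger
  qed (use Mx in simp)
  then have "\<forall>k j. \<exists>r' t'. of_int M * (x ^ j * (x + 1) ^ k) = of_int r' + of_int t' * s"
    unfolding Zs_def by blast
  moreover have "M \<noteq> 0" using x(2) by (simp add: M_def)
  ultimately show ?thesis by blast
qed

lemma power_conj:
  assumes "a \<in> \<rat>" "b \<in> \<rat>"
  shows "\<exists>A B. A \<in> \<rat> \<and> B \<in> \<rat> \<and> (a + b * s) ^ k = A + B * s \<and> (a - b * s) ^ k = A - B * s"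
proof (induction k)
  case 0
  show ?case by (rule exI[of _ 1], rule exI[of _ 0]) simp
next
  case (Suc k)
  then obtain A B where AB: "A \<in> \<rat>" "B \<in> \<rat>" "(a + b * s) ^ k = A + B * s" "(a - b * s) ^ k = A - B * s"
    by blast
  have "(a + b * s) * (A + B * s) = a * A + b * B * (s * s) + (a * B + b * A) * s"
    "(a - b * s) * (A - B * s) = a * A + b * B * (s * s) - (a * B + b * A) * s"
    by (simp_all add: algebra_simps)
  then have "(a + b * s) ^ Suc k = (a * A + b * B * of_int d) + (a * B + b * A) * s"
    "(a - b * s) ^ Suc k = (a * A + b * B * of_int d) - (a * B + b * A) * s"
    using AB s_sq by (simp_all only: power_Suc)
  moreover have "a * A + b * B * of_int d \<in> \<rat>" "a * B + b * A \<in> \<rat>" using assms AB by auto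
  ultimately show ?case by blast
qed

text \<open>\<open>M^2\<close> is a common denominator of all powers of the norm, because
  \<open>M^2\<close> times the \<open>k\<close>-th power of the norm is the product of
  \<open>M (a + b s)^k\<close> with its conjugate.\<close>

lemma norm_integral:
  assumes ab: "a \<in> \<rat>" "b \<in> \<rat>" and "M \<noteq> 0"
    and M: "\<And>k. \<exists>r' t'. of_int M * (a + b * s) ^ k = of_int r' + of_int t' * s"
  shows "a\<^sup>2 - of_int d * b\<^sup>2 \<in> \<int>"
proof (rule bounded_denominators_imp_int)
  show "a\<^sup>2 - of_int d * b\<^sup>2 \<in> \<rat>" using ab by auto
  show "M ^ 2 \<noteq> 0" using assms(3) by simp
  fix k :: nat
  obtain r' t' where rt: "of_int M * (a + b * s) ^ k = of_int r' + of_int t' * s" using M by blast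
  obtain A B where AB: "A \<in> \<rat>" "B \<in> \<rat>" "(a + b * s) ^ k = A + B * s" "(a - b * s) ^ k = A - B * s"
    using power_conj[OF ab] by blast
  have "of_int M * A + of_int M * B * s = of_int r' + of_int t' * s"
    using rt AB(3) by (simp add: algebra_simps)
  then have MAB: "of_int M * A = of_int r'" "of_int M * B = of_int t'"
    using irrational_eq[of "of_int M * A" "of_int M * B" "of_int r'" "of_int t'"] AB by auto
  have "(a + b * s) * (a - b * s) = a\<^sup>2 - (s * s) * b\<^sup>2"
    by (simp add: algebra_simps power2_eq_square)
  then have "a\<^sup>2 - of_int d * b\<^sup>2 = (a + b * s) * (a - b * s)" unfolding s_sq by simp
  then have "of_int (M\<^sup>2) * (a\<^sup>2 - of_int d * b\<^sup>2) ^ k = (of_int M * (a + b * s) ^ k) * (of_int M * (a - b * s) ^ k)"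
    by (simp add: power_mult_distrib power2_eq_square mult_ac)
  also have "\<dots> = (of_int M * A + of_int M * B * s) * (of_int M * A - of_int M * B * s)"
    unfolding AB(3,4) by (simp add: algebra_simps)
  also have "\<dots> = of_int r' * of_int r' - of_int t' * of_int t' * (s * s)"
    unfolding MAB by (simp add: algebra_simps)
  also have "\<dots> = of_int (r' * r' - t' * t' * d)" unfolding s_sq by simp
  finally show "of_int (M\<^sup>2) * (a\<^sup>2 - of_int d * b\<^sup>2) ^ k \<in> \<int>" by (metis Ints_of_int)
qed

text \<open>The norms of \<open>x\<close> and \<open>x + 1\<close> are integers by boundedness of
  denominators, and they differ by \<open>2 a + 1\<close>, so the trace \<open>2 a\<close> is an
  integer. Then \<open>d (2 b)^2\<close> is an integer too, and squarefreeness of \<open>d\<close>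
  leaves no denominator in \<open>2 b\<close>.\<close>

lemma OK_imp_el:
  assumes "x \<in> R" shows "\<exists>u v. even (u - v) \<and> x = el u v"
proof -
  obtain a b where ab: "a \<in> \<rat>" "b \<in> \<rat>" "x = a + b * s" and alg: "alg_integer x"
    using assms by (auto simp: OK_def quad_field_def)
  obtain a1 a2 :: int where a12: "a = of_int a1 / of_int a2" "a2 > 0" using ab(1) by (metis Rats_cases')
  obtain b1 b2 :: int where b12: "b = of_int b1 / of_int b2" "b2 > 0" using ab(2) by (metis Rats_cases')
  have x: "x = (of_int (a1 * b2) + of_int (b1 * a2) * s) / of_int (a2 * b2)"
    using a12(2) b12(2) by (simp add: ab(3) a12(1) b12(1) field_simps)
  obtain M :: int where M: "M \<noteq> 0"
    "\<And>k j. \<exists>r' t'. of_int M * (x ^ j * (x + 1) ^ k) = of_int r' + of_int t' * s"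
    using ring_power_integral[OF x] a12(2) b12(2) alg by auto
  have "a\<^sup>2 - of_int d * b\<^sup>2 \<in> \<int>"
    using norm_integral[OF ab(1,2) M(1)] M(2)[of _ 0] by (simp add: ab(3))
  moreover have "(a + 1)\<^sup>2 - of_int d * b\<^sup>2 \<in> \<int>"
    using norm_integral[of "a + 1" b, OF _ ab(2) M(1)] ab(1) M(2)[of 0] by (simp add: ab(3) add_ac)
  ultimately have "((a + 1)\<^sup>2 - of_int d * b\<^sup>2) - (a\<^sup>2 - of_int d * b\<^sup>2) - 1 \<in> \<int>"
    using Ints_diff[OF Ints_diff Ints_1] by blast
  then have "2 * a \<in> \<int>" by (simp add: power2_eq_square algebra_simps)
  then obtain u where u: "2 * a = of_int u" using Ints_cases by blast
  obtain \<nu> where \<nu>: "a\<^sup>2 - of_int d * b\<^sup>2 = of_int \<nu>" using \<open>a\<^sup>2 - of_int d * b\<^sup>2 \<in> \<int>\<close> Ints_cases by blast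
  obtain v w :: int where vw: "2 * b = of_int v / of_int w" "w > 0" "coprime v w"
    using ab(2) Rats_cases'[of "2 * b"] by (metis Rats_mult Rats_number_of)
  have "of_int d * (2 * b)\<^sup>2 = (2 * a)\<^sup>2 - 4 * of_int \<nu>"
    unfolding \<nu>[symmetric] by (simp add: power2_eq_square algebra_simps)
  then have "(of_int d * (of_int v / of_int w)\<^sup>2 :: real) = of_int (u\<^sup>2 - 4 * \<nu>)" by (simp add: u vw(1))
  then have "of_int (d * v\<^sup>2) = (of_int ((u\<^sup>2 - 4 * \<nu>) * w\<^sup>2) :: real)"
    using vw(2) by (simp add: field_simps)
  then have dv: "d * v\<^sup>2 = (u\<^sup>2 - 4 * \<nu>) * w\<^sup>2" by (simp only: of_int_eq_iff)
  then have "w\<^sup>2 dvd d * v\<^sup>2" by simp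
  moreover have "coprime (w\<^sup>2) (v\<^sup>2)" using vw(3) by (simp add: coprime_commute)
  ultimately have "w\<^sup>2 dvd d" using coprime_dvd_mult_left_iff by blast
  then have w: "w = 1" using square_dvd_d vw(2) by fastforce
  have "u\<^sup>2 - d * v\<^sup>2 = 4 * \<nu>" using dv w by simp
  then have "even (u\<^sup>2 - d * v\<^sup>2)" by simp
  then have "even (u - v)" using odd_d by simp
  moreover have "x = el u v"
  proof -
    have a: "a = of_int u / 2" using u by linarith
    have b: "b = of_int v / 2" using vw(1) w by simp
    show ?thesis unfolding ab(3) el_def a b by (simp add: add_divide_distrib)
  qed
  ultimately show ?thesis by blast
qed

lemma quarter_norm_int:
  assumes "even (u - v)" obtains c where "u\<^sup>2 - d * v\<^sup>2 = 4 * c"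
proof -
  obtain t where t: "u = v + 2 * t" using assms by (metis dvdE diff_add_cancel add.commute)
  have "d = 1 + 4 * (2 * (d div 8))" using d_mod_8 by presburger
  then obtain e where e: "d = 1 + 4 * e" by blast
  have "u\<^sup>2 - d * v\<^sup>2 = 4 * (v * t + t\<^sup>2 - e * v\<^sup>2)"
    unfolding t e by (simp add: power2_eq_square algebra_simps)
  then show ?thesis using that by blast
qed

lemma el_in_OK:
  assumes "even (u - v)" shows "el u v \<in> R"
proof -
  obtain c where c: "u\<^sup>2 - d * v\<^sup>2 = 4 * c" using quarter_norm_int[OF assms] .
  have "el u v = of_int u / 2 + of_int v / 2 * s" by (simp add: el_def add_divide_distrib)
  then have "el u v \<in> quad_field d" unfolding quad_field_def
    by (intro CollectI exI[of _ "of_int u / 2"] exI[of _ "of_int v / 2"]) auto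
  moreover have "alg_integer (el u v)" unfolding alg_integer_def
  proof (rule exI[of _ "[:c, - u, 1:]"], intro conjI)
    have "4 * (el u v * el u v - of_int u * el u v) = of_int v * of_int v * (s * s) - of_int u * of_int u"
      by (simp add: el_def algebra_simps add_divide_distrib diff_divide_distrib)
    also have "\<dots> = - of_int (u\<^sup>2 - d * v\<^sup>2)" unfolding s_sq by (simp add: power2_eq_square)
    also have "\<dots> = - 4 * of_int c" unfolding c by simp
    finally have "el u v * el u v - of_int u * el u v + of_int c = 0" by simp
    then show "poly (map_poly of_int [:c, - u, 1:]) (el u v) = 0"
      by (simp add: map_poly_pCons algebra_simps)
  qed simp
  ultimately show ?thesis by (simp add: OK_def)
qed

lemma OK_iff: "x \<in> R \<longleftrightarrow> (\<exists>u v. even (u - v) \<and> x = el u v)"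
  using OK_imp_el el_in_OK by blast

lemma el_in_OK_iff: "el u v \<in> R \<longleftrightarrow> even (u - v)"
  by (auto simp: OK_iff el_eq_iff)

lemma el_mult_ex:
  assumes "even (u - v)" "even (u' - v')"
  obtains x y where "2 * x = u * u' + d * (v * v')" "2 * y = u * v' + u' * v" "even (x - y)"
proof -
  obtain t where t: "u = v + 2 * t" using assms(1) by (metis dvdE diff_add_cancel add.commute)
  obtain t' where t': "u' = v' + 2 * t'" using assms(2) by (metis dvdE diff_add_cancel add.commute)
  have "d = 1 + 4 * (2 * (d div 8))" using d_mod_8 by presburger
  then obtain e where e: "d = 1 + 4 * e" by blast
  show ?thesis
  proof (rule that[of "v * v' + v * t' + v' * t + 2 * t * t' + 2 * e * v * v'" "v * v' + t * v' + t' * v"])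
    show "2 * (v * v' + v * t' + v' * t + 2 * t * t' + 2 * e * v * v') = u * u' + d * (v * v')"
      unfolding t t' e by (simp add: algebra_simps)
    show "2 * (v * v' + t * v' + t' * v) = u * v' + u' * v"
      unfolding t t' by (simp add: algebra_simps)
  qed simp
qed

sublocale real_subring R
proof
  have "1 = el 2 0" by (simp add: el_def)
  then show "1 \<in> R" using el_in_OK_iff[of 2 0] by simp
  fix x y assume "x \<in> R" "y \<in> R"
  then obtain u v u' v' where uv: "even (u - v)" "x = el u v" "even (u' - v')" "y = el u' v'"
    by (auto simp: OK_iff)
  have "even ((u - u') - (v - v'))" using uv(1,3) by simp
  then show "x - y \<in> R" by (simp add: uv el_diff el_in_OK_iff)
  obtain z w where "2 * z = u * u' + d * (v * v')" "2 * w = u * v' + u' * v" "even (z - w)"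
    using el_mult_ex[OF uv(1,3)] .
  then show "x * y \<in> R" using el_mult by (simp add: uv el_in_OK_iff)
qed

lemma cnj_R: "x \<in> R \<Longrightarrow> cnj x \<in> R"
proof -
  assume "x \<in> R"
  then obtain u v where "even (u - v)" "x = el u v" by (auto simp: OK_iff)
  then show ?thesis by (simp add: cnj_el el_in_OK_iff)
qed

lemma cnj_cnj: "x \<in> R \<Longrightarrow> cnj (cnj x) = x"
  by (auto simp: OK_iff cnj_el)

lemma cnj_add: "x \<in> R \<Longrightarrow> y \<in> R \<Longrightarrow> cnj (x + y) = cnj x + cnj y"
  by (auto simp: OK_iff cnj_el el_add)

lemma cnj_mult: 
  assumes "x \<in> R" "y \<in> R" shows "cnj (x * y) = cnj x * cnj y"
proof -
  obtain u v u' v' where uv: "even (u - v)" "x = el u v" "even (u' - v')" "y = el u' v'"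
    using assms by (auto simp: OK_iff)
  obtain z w where zw: "2 * z = u * u' + d * (v * v')" "2 * w = u * v' + u' * v" "even (z - w)"
    using el_mult_ex[OF uv(1,3)] .
  have "x * y = el z w" using el_mult zw uv by simp
  moreover have "el u (- v) * el u' (- v') = el z (- w)" using zw by (intro el_mult) auto
  ultimately show ?thesis by (simp add: uv cnj_el)
qed

lemma cnj_of_int: "cnj (of_int n) = of_int n"
  unfolding el_of_int cnj_el by simp

lemma cnj_uminus: "x \<in> R \<Longrightarrow> cnj (- x) = - cnj x"
  by (auto simp: OK_iff cnj_el el_uminus)

lemma el_norm: "el u v * el u (- v) = of_int (u\<^sup>2 - d * v\<^sup>2) / 4"
proof -
  have "(U + V * S) / 2 * ((U + - V * S) / 2) = (U * U - S * S * (V * V)) / 4" for U V S :: real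
    by (simp add: field_simps)
  from this[of "of_int u" "of_int v" s] show ?thesis
    unfolding s_sq by (simp add: el_def power2_eq_square)
qed

text \<open>The norm as an element of \<open>int\<close>; the floor is exact on \<open>R\<close>
  because norms of algebraic integers are integers.\<close>

definition nrm :: "real \<Rightarrow> int" where "nrm x = \<lfloor>x * cnj x\<rfloor>"

lemma nrm_el: "u\<^sup>2 - d * v\<^sup>2 = 4 * c \<Longrightarrow> nrm (el u v) = c"
  by (simp add: nrm_def cnj_el el_norm)

lemma nrm_eq: "x \<in> R \<Longrightarrow> of_int (nrm x) = x * cnj x"
proof -
  assume "x \<in> R"
  then obtain u v where uv: "even (u - v)" "x = el u v" by (auto simp: OK_iff)
  obtain c where "u\<^sup>2 - d * v\<^sup>2 = 4 * c" using quarter_norm_int[OF uv(1)] .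
  then show ?thesis using nrm_el uv by (simp add: cnj_el el_norm)
qed

lemma nrm_mult: "x \<in> R \<Longrightarrow> y \<in> R \<Longrightarrow> nrm (x * y) = nrm x * nrm y"
proof -
  assume xy: "x \<in> R" "y \<in> R"
  have "of_int (nrm (x * y)) = (of_int (nrm x * nrm y) :: real)"
    using xy by (simp add: nrm_eq mult_R cnj_mult mult_ac)
  then show ?thesis by (simp only: of_int_eq_iff)
qed

lemma nrm_of_int: "nrm (of_int n) = n\<^sup>2"
  unfolding el_of_int by (rule nrm_el) (simp add: power2_eq_square)

lemma nrm_cnj: "x \<in> R \<Longrightarrow> nrm (cnj x) = nrm x"
  by (simp add: nrm_def cnj_cnj mult.commute)

lemma cnj_eq_0: "x \<in> R \<Longrightarrow> cnj x = 0 \<longleftrightarrow> x = 0"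
  using cnj_cnj cnj_of_int[of 0] by (metis of_int_0)

lemma nrm_eq_0: "x \<in> R \<Longrightarrow> nrm x = 0 \<longleftrightarrow> x = 0"
  using nrm_eq[of x] cnj_eq_0[of x] by (metis mult_eq_0_iff of_int_0_eq_iff)

lemma nrm_el_eq: "even (u - v) \<Longrightarrow> 4 * nrm (el u v) = u\<^sup>2 - d * v\<^sup>2"
  using quarter_norm_int nrm_el by metis

lemma el_mem_pr_int:
  assumes "el u v \<in> pr (of_int t)" shows "t dvd u" "t dvd v"
proof -
  obtain u' v' where "el u v = el u' v' * of_int t" using assms by (metis pr_iff OK_imp_el)
  then have "el u v = el (t * u') (t * v')" using el_scale[of t u' v'] by (simp add: mult.commute)
  then show "t dvd u" "t dvd v" by (auto simp: el_eq_iff)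
qed

lemma of_int_mem_pr: "of_int m \<in> pr (of_int n) \<Longrightarrow> n dvd m"
proof -
  assume "of_int m \<in> pr (of_int n)"
  then obtain u' v' where uv: "even (u' - v')" "el (2 * m) 0 = el u' v' * of_int n"
    using el_of_int[of m] by (metis pr_iff OK_imp_el)
  then have e: "el (2 * m) 0 = el (n * u') (n * v')" using el_scale[of n u' v'] by (simp add: mult.commute)
  show "n dvd m"
  proof (cases "n = 0")
    case False
    then have "v' = 0" "2 * m = n * u'" using e by (auto simp: el_eq_iff)
    then show ?thesis using uv(1) by auto
  qed (use e in \<open>auto simp: el_eq_iff\<close>)
qed

abbreviation quad_imul :: "real set \<Rightarrow> real set \<Rightarrow> real set" (infixl "\<star>" 70)
  where "I \<star> J \<equiv> ideal_mult R I J"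

section \<open>Conjugate ideals and lattice bases\<close>

definition cI :: "real set \<Rightarrow> real set" where "cI I = cnj ` I"

lemma idl_cI:
  assumes "idl I" shows "idl (cI I)"
  unfolding is_ideal_def
proof (intro conjI ballI)
  note IR = idl_in_R[OF assms]
  show "cI I \<subseteq> R" using IR cnj_R by (auto simp: cI_def)
  show "0 \<in> cI I" using idlD(2)[OF assms] cnj_of_int[of 0] unfolding cI_def by (metis image_eqI of_int_0)
  show "x + y \<in> cI I" if xy: "x \<in> cI I" "y \<in> cI I" for x y
  proof -
    obtain a b where ab: "a \<in> I" "b \<in> I" "x = cnj a" "y = cnj b" using xy by (auto simp: cI_def)
    then have "x + y = cnj (a + b)" using IR by (simp add: cnj_add)
    then show ?thesis using ab idlD(3)[OF assms] by (auto simp: cI_def)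
  qed
  show "r * x \<in> cI I" if rx: "r \<in> R" "x \<in> cI I" for r x
  proof -
    obtain a where a: "a \<in> I" "x = cnj a" using rx by (auto simp: cI_def)
    then have "r * x = cnj (cnj r * a)" using IR rx cnj_R by (simp add: cnj_mult cnj_cnj)
    then show ?thesis using a idlD(4)[OF assms] rx(1) cnj_R by (auto simp: cI_def)
  qed
qed

lemma mem_cI_iff: "idl I \<Longrightarrow> x \<in> cI I \<longleftrightarrow> x \<in> R \<and> cnj x \<in> I"
  unfolding cI_def using cnj_cnj cnj_R idl_in_R by (metis (no_types, lifting) image_iff)

lemma cI_cI: "idl I \<Longrightarrow> cI (cI I) = I"
  using cnj_cnj idl_in_R by (force simp: cI_def image_image)

lemma cI_mono: "I \<subseteq> J \<Longrightarrow> cI I \<subseteq> cI J"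
  by (auto simp: cI_def)

lemma cI_R: "cI R = R"
  using cI_cI[OF idl_R] idlD(1)[OF idl_cI[OF idl_R]] cI_mono by blast

lemma cI_pr: "a \<in> R \<Longrightarrow> cI (pr a) = pr (cnj a)"
proof -
  assume a: "a \<in> R"
  have "cI (pr a) = (\<lambda>r. cnj r * cnj a) ` R"
    using a by (auto simp: cI_def principal_ideal_def cnj_mult image_image)
  also have "\<dots> = (\<lambda>r. r * cnj a) ` (cI R)" by (simp add: cI_def image_image)
  finally show ?thesis by (simp add: cI_R principal_ideal_def)
qed

lemma nzi_cI: "nzi I \<Longrightarrow> nzi (cI I)"
proof -
  assume I: "nzi I"
  obtain x where x: "x \<in> I" "x \<noteq> 0" using nzi_obtain[OF I] .
  then have "cnj x \<in> cI I" "cnj x \<noteq> 0" using cnj_eq_0 idl_in_R[OF nzi_idl[OF I]] by (auto simp: cI_def)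
  then show ?thesis using idl_cI[OF nzi_idl[OF I]] by (auto simp: nzi_def)
qed

lemma cI_imul_subset: "idl I \<Longrightarrow> idl J \<Longrightarrow> cI I \<star> cI J \<subseteq> cI (I \<star> J)"
proof (rule imul_least)
  assume IJ: "idl I" "idl J"
  then show "idl (cI (I \<star> J))" by (simp add: idl_cI idl_imul)
  fix x y assume "x \<in> cI I" "y \<in> cI J"
  then obtain a b where ab: "a \<in> I" "b \<in> J" "x = cnj a" "y = cnj b" by (auto simp: cI_def)
  then have "x * y = cnj (a * b)" using IJ idl_in_R by (simp add: cnj_mult)
  then show "x * y \<in> cI (I \<star> J)" using imul_mem[OF ab(1,2)] by (auto simp: cI_def)
qed

lemma cI_imul: "idl I \<Longrightarrow> idl J \<Longrightarrow> cI (I \<star> J) = cI I \<star> cI J"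
proof
  assume IJ: "idl I" "idl J"
  show "cI I \<star> cI J \<subseteq> cI (I \<star> J)" using cI_imul_subset IJ .
  have "cI (cI I) \<star> cI (cI J) \<subseteq> cI (cI I \<star> cI J)" using cI_imul_subset IJ idl_cI by blast
  then have "cI (I \<star> J) \<subseteq> cI (cI (cI I \<star> cI J))" using IJ by (simp add: cI_cI cI_mono)
  then show "cI (I \<star> J) \<subseteq> cI I \<star> cI J" using IJ by (simp add: cI_cI idl_cI idl_imul)
qed

text \<open>The lattice \<open>k (\<int> a + \<int> (b + \<surd>d) / 2)\<close>, an ideal if \<open>4 a\<close> divides \<open>b\<^sup>2 - d\<close>.\<close>

definition bas :: "int \<Rightarrow> int \<Rightarrow> int \<Rightarrow> real set" where
  "bas k a b = {el (k * (2 * a * u + b * v)) (k * v) |u v. True}"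

lemma bas_mem: "el (k * (2 * a * u + b * v)) (k * v) \<in> bas k a b"
  by (auto simp: bas_def)

lemma bas_coeffs_odd: "4 * a dvd b\<^sup>2 - d \<Longrightarrow> odd b"
proof
  assume a: "4 * a dvd b\<^sup>2 - d" "even b"
  have "2 dvd 4 * a" by simp
  then have "2 dvd b\<^sup>2 - d" using a(1) by (rule dvd_trans)
  then show False using a(2) odd_d by simp
qed

lemma idl_bas:
  assumes "4 * a dvd b\<^sup>2 - d"
  shows "idl (bas k a b)"
  unfolding is_ideal_def
proof (intro conjI ballI)
  have b: "odd b" using bas_coeffs_odd[OF assms] .
  obtain c where c: "b\<^sup>2 - d = 4 * a * c" using assms by (auto simp: dvd_def)
  then have d: "d = b * b - 4 * a * c" by (simp add: power2_eq_square)
  show "bas k a b \<subseteq> R" using b by (auto simp: bas_def el_in_OK_iff)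
  have "0 = el 0 0" by (simp add: el_def)
  then show "0 \<in> bas k a b" using bas_mem[of k a 0 b 0] by simp
  show "x + y \<in> bas k a b" if xy: "x \<in> bas k a b" "y \<in> bas k a b" for x y
  proof -
    obtain u v u' v' where "x = el (k * (2 * a * u + b * v)) (k * v)" "y = el (k * (2 * a * u' + b * v')) (k * v')"
      using xy unfolding bas_def by blast
    then have "x + y = el (k * (2 * a * (u + u') + b * (v + v'))) (k * (v + v'))"
      by (simp add: el_add algebra_simps)
    then show ?thesis using bas_mem by simp
  qed
  show "r * x \<in> bas k a b" if rx: "r \<in> R" "x \<in> bas k a b" for r x
  proof -
    obtain u v where x: "x = el (k * (2 * a * u + b * v)) (k * v)" using rx(2) by (auto simp: bas_def)
    obtain m n where mn: "even (m - n)" "r = el m n" using OK_imp_el[OF rx(1)] by blast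
    have "even (m - b * n)" "even (m + b * n)" using mn(1) b by auto
    then obtain e f where ef: "m - b * n = 2 * e" "m + b * n = 2 * f" by (meson evenE)
    \<comment> \<open>With \<open>w = (b + s) / 2\<close> one has \<open>r = e + n w\<close> and
      \<open>w^2 = b w - a c\<close>; \<open>u'\<close> and \<open>v'\<close> are the coordinates of
      the product with respect to \<open>a\<close> and \<open>w\<close>.\<close>
    define u' where "u' = u * e - c * n * v"
    define v' where "v' = v * f + a * u * n"
    have m: "m = 2 * e + b * n" "2 * f = 2 * e + 2 * (b * n)" using ef by auto
    have f: "f = e + b * n" using m by simp
    have "r * x = el (k * (2 * a * u' + b * v')) (k * v')"
      unfolding x mn(2)
      by (rule el_mult; simp only: u'_def v'_def d m(1) f; simp add: algebra_simps)
    then show ?thesis using bas_mem by simp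
  qed
qed

lemma int_subgroup_generator:
  fixes Y :: "int set"
  assumes "\<And>x y. x \<in> Y \<Longrightarrow> y \<in> Y \<Longrightarrow> x - y \<in> Y" and "y0 \<in> Y" "y0 \<noteq> 0"
  obtains g where "g > 0" "g \<in> Y" "\<And>y. y \<in> Y \<Longrightarrow> g dvd y"
proof -
  have zero: "0 \<in> Y" using assms(1)[OF assms(2) assms(2)] by simp
  have neg: "- x \<in> Y" if "x \<in> Y" for x using assms(1)[OF zero that] by simp
  have add: "x + y \<in> Y" if "x \<in> Y" "y \<in> Y" for x y using assms(1)[OF that(1) neg[OF that(2)]] by simp
  have multn: "int n * x \<in> Y" if "x \<in> Y" for n x
    using that by (induction n) (auto simp: zero add distrib_right)
  have mult: "n * x \<in> Y" if "x \<in> Y" for n x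
    using multn[OF that] neg[OF multn[OF that]] by (cases n rule: int_cases2) auto
  define g where "g = int (LEAST n. n > 0 \<and> int n \<in> Y)"
  have "nat \<bar>y0\<bar> > 0 \<and> int (nat \<bar>y0\<bar>) \<in> Y" using assms(2,3) neg by (auto simp: abs_if)
  then have gg: "nat g > 0 \<and> int (nat g) \<in> Y"
    unfolding g_def nat_int by (rule LeastI)
  then have g: "g > 0" "g \<in> Y" by auto
  show ?thesis
  proof (rule that[OF g])
    fix y assume y: "y \<in> Y"
    have "y mod g \<in> Y" using assms(1)[OF y mult[OF g(2), of "y div g"]] by (simp add: minus_div_mult_eq_mod)
    moreover have "0 \<le> y mod g" "y mod g < g" using g by auto
    moreover have "\<not> (n > 0 \<and> int n \<in> Y)" if "int n < g" for n
      using that not_less_Least[of n "\<lambda>n. n > 0 \<and> int n \<in> Y"] by (simp add: g_def)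
    ultimately have "y mod g = 0"
      by (metis int_nat_eq less_le nat_0_iff zero_less_nat_eq)
    then show "g dvd y" by auto
  qed
qed

text \<open>Hermite normal form of the lattice \<open>I\<close>: \<open>m\<close> generates its
  rational integers and \<open>k\<close> its second coordinates. Multiplication by
  \<open>(1 + s) / 2\<close> stays in \<open>I\<close>, which makes \<open>k\<close> divide
  \<open>m\<close> and also the first coordinate \<open>w\<close> of an element with second
  coordinate \<open>k\<close>.\<close>

lemma basis_exists:
  assumes "nzi I"
  obtains k a b where "k > 0" "a > 0" "4 * a dvd b\<^sup>2 - d" "I = bas k a b"
proof -
  have I: "idl I" using assms nzi_idl by blast
  obtain x0 where x0: "x0 \<in> I" "x0 \<noteq> 0" using nzi_obtain[OF assms] .
  define Z where "Z = {n. of_int n \<in> I}"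
  have "of_int (nrm x0) \<in> I" using nrm_eq[of x0] idlD(5)[OF I cnj_R x0(1)] idl_in_R[OF I x0(1)] by simp
  then have Z0: "nrm x0 \<in> Z" "nrm x0 \<noteq> 0" using nrm_eq_0 x0 idl_in_R[OF I] by (auto simp: Z_def)
  have Zd: "x - y \<in> Z" if "x \<in> Z" "y \<in> Z" for x y
    using idl_diff[OF I, of "of_int x" "of_int y"] that by (simp add: Z_def)
  obtain m where m: "m > 0" "m \<in> Z" "\<And>y. y \<in> Z \<Longrightarrow> m dvd y"
    using int_subgroup_generator[OF Zd Z0] by blast
  define Y where "Y = {v. \<exists>u. el u v \<in> I}"
  have Yd: "x - y \<in> Y" if "x \<in> Y" "y \<in> Y" for x y
    using that idl_diff[OF I] unfolding Y_def by (auto simp: el_diff) (metis el_diff)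
  have om: "el 1 1 \<in> R" by (simp add: el_in_OK_iff)
  have "el 1 1 * of_int m \<in> I" using idlD(4)[OF I om] m(2) by (simp add: Z_def)
  then have mI: "el m m \<in> I" using el_scale[of m 1 1] by (simp add: mult.commute)
  then have Y0: "m \<in> Y" "m \<noteq> 0" using m by (auto simp: Y_def)
  obtain k where k: "k > 0" "k \<in> Y" "\<And>y. y \<in> Y \<Longrightarrow> k dvd y"
    using int_subgroup_generator[OF Yd Y0] by blast
  obtain a where a: "m = k * a" using k(3)[OF Y0(1)] by (auto simp: dvd_def)
  obtain w where w: "el w k \<in> I" using k(2) by (auto simp: Y_def)
  have wk: "even (w - k)" using idl_in_R[OF I w] by (simp add: el_in_OK_iff)
  obtain p q where pq: "2 * p = 1 * w + d * (1 * k)" "2 * q = 1 * k + w * 1" "even (p - q)"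
    using el_mult_ex[of 1 1 w k] wk by auto
  have "el p q \<in> I" using idlD(4)[OF I om w] el_mult[OF pq(1,2)] by simp
  then have "k dvd q" using k(3) by (auto simp: Y_def)
  then obtain z where "q = k * z" by (auto simp: dvd_def)
  then have "w = k * (2 * z - 1)" using pq(2) by (simp add: algebra_simps)
  moreover define b where "b = 2 * z - 1"
  ultimately have b: "w = k * b" "odd b" by auto
  have bR: "el b (-1) \<in> R" using b(2) by (simp add: el_in_OK_iff)
  have wI: "el (k * b) k \<in> I" using w b by simp
  have "even (b - 1)" using b(2) by simp
  then obtain c where c: "b\<^sup>2 - d * 1\<^sup>2 = 4 * c" by (rule quarter_norm_int)
  have "el b (-1) * el (k * b) k = of_int k * (el b 1 * el b (-1))"
    using el_scale[of k b 1] by (simp add: mult_ac)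
  also have "\<dots> = of_int (k * c)" using c el_norm[of b 1] by simp
  \<comment> \<open>The rational integers in \<open>I\<close> are the multiples of
    \<open>m = k a\<close>, so this element yields that \<open>a\<close> divides \<open>c\<close>,
    which is the divisibility demanded of \<open>b\<close>.\<close>
  finally have "k * c \<in> Z" using idlD(4)[OF I bR wI] by (simp add: Z_def)
  then have "k * a dvd k * c" using m(3) unfolding a by blast
  then have "a dvd c" using k(1) by simp
  then have abd: "4 * a dvd b\<^sup>2 - d" using c by simp
  have apos: "a > 0" using m(1) k(1) a by (simp add: zero_less_mult_iff)
  have "I = bas k a b"
  proof
    show "bas k a b \<subseteq> I"
    proof
      fix x assume "x \<in> bas k a b"
      then obtain u v where x: "x = el (k * (2 * a * u + b * v)) (k * v)" by (auto simp: bas_def)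
      have "x = of_int u * of_int m + of_int v * el (k * b) k"
        unfolding a el_of_int[of "k * a"] el_scale el_add x by (simp add: algebra_simps)
      then show "x \<in> I" using idlD(3,4)[OF I] wI m(2) of_int_R by (simp add: Z_def)
    qed
    show "I \<subseteq> bas k a b"
    proof
      fix x assume x: "x \<in> I"
      then obtain u v where uv: "even (u - v)" "x = el u v" using OK_imp_el idl_in_R[OF I] by blast
      then have "k dvd v" using k(3) x by (auto simp: Y_def)
      then obtain v' where v': "v = k * v'" by (auto simp: dvd_def)
      have "x - of_int v' * el (k * b) k \<in> I" using idl_diff[OF I x] idlD(4)[OF I of_int_R wI] by blast
      then have 1: "el (u - v' * (k * b)) 0 \<in> I" by (simp add: uv(2) el_scale el_diff v' mult.commute)
      then have "even (u - v' * (k * b))" using idl_in_R[OF I 1] by (simp add: el_in_OK_iff)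
      then obtain t where t: "u - v' * (k * b) = 2 * t" by blast
      then have "t \<in> Z" using 1 el_of_int by (simp add: Z_def)
      then obtain u' where "t = m * u'" using m(3) by (auto simp: dvd_def)
      then have "u = k * (2 * a * u' + b * v')" using t a by (simp add: algebra_simps)
      then show "x \<in> bas k a b" using uv(2) v' bas_mem by simp
    qed
  qed
  then show ?thesis using that k(1) apos abd by blast
qed

text \<open>The product contains \<open>k^2 a\<close> times each of \<open>a\<close>,
  \<open>b\<close>, \<open>c\<close>, where \<open>b^2 - d = 4 a c\<close>. The square of a common
  divisor of the three divides \<open>d\<close>, so squarefreeness makes them coprime and Bezout
  coefficients give \<open>k^2 a\<close> itself. Thus every nonzero ideal is invertible.\<close>

lemma bas_imul_cI:
  assumes "k > 0" "a > 0" "4 * a dvd b\<^sup>2 - d"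
  shows "bas k a b \<star> cI (bas k a b) = pr (of_int (k\<^sup>2 * a))"
proof
  let ?I = "bas k a b"
  have I: "idl ?I" using idl_bas assms by blast
  have P: "idl (?I \<star> cI ?I)" using I idl_imul idl_cI by blast
  have b: "odd b" using bas_coeffs_odd[OF assms(3)] .
  obtain c where "b\<^sup>2 - d = 4 * a * c" using assms(3) by (auto simp: dvd_def)
  then have d: "d = b * b - 4 * a * c" by (simp add: power2_eq_square)
  show "?I \<star> cI ?I \<subseteq> pr (of_int (k\<^sup>2 * a))"
  proof (rule imul_least)
    show "idl (pr (of_int (k\<^sup>2 * a)))" using idl_pr of_int_R by blast
    fix x y assume "x \<in> ?I" "y \<in> cI ?I"
    then obtain u v u' v' where x: "x = el (k * (2 * a * u + b * v)) (k * v)"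
      and "y = cnj (el (k * (2 * a * u' + b * v')) (k * v'))" by (auto simp: bas_def cI_def)
    then have y: "y = el (k * (2 * a * u' + b * v')) (- (k * v'))" by (simp add: cnj_el)
    define p where "p = 2 * a * u * u' + b * (u * v' + u' * v) + 2 * c * v * v'"
    define q where "q = v * u' - u * v'"
    have "x * y = el (k\<^sup>2 * a * p) (k\<^sup>2 * a * q)"
      unfolding x y by (rule el_mult; simp only: p_def q_def d power2_eq_square; simp add: algebra_simps)
    also have "\<dots> = el p q * of_int (k\<^sup>2 * a)" using el_scale by (metis mult.commute)
    finally have "x * y = el p q * of_int (k\<^sup>2 * a)" .
    moreover have "el p q \<in> R" using b by (auto simp: el_in_OK_iff p_def q_def)
    ultimately show "x * y \<in> pr (of_int (k\<^sup>2 * a))" by (auto simp: pr_iff)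
  qed
  have e1: "of_int (k * a) \<in> ?I" using bas_mem[of k a 1 b 0] by (simp add: el_of_int mult_ac)
  have e2: "el (k * b) k \<in> ?I" using bas_mem[of k a 0 b 1] by simp
  have e1': "of_int (k * a) \<in> cI ?I" using e1 cnj_of_int by (metis cI_def image_eqI)
  have e2': "el (k * b) (- k) \<in> cI ?I" using e2 cnj_el by (metis cI_def image_eqI)
  have "of_int (k * a) * of_int (k * a) \<in> ?I \<star> cI ?I" using imul_mem[OF e1 e1'] .
  then have p1: "of_int (k\<^sup>2 * a * a) \<in> ?I \<star> cI ?I" by (simp add: power2_eq_square mult_ac)
  have "el (k * b) k * of_int (k * a) + of_int (k * a) * el (k * b) (- k) \<in> ?I \<star> cI ?I"
    using idlD(3)[OF P] imul_mem[OF e2 e1'] imul_mem[OF e1 e2'] by blast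
  also have "el (k * b) k * of_int (k * a) + of_int (k * a) * el (k * b) (- k) = of_int (k * a) * el (k * b) k + of_int (k * a) * el (k * b) (- k)"
    by (simp only: mult.commute)
  also have "\<dots> = of_int (k\<^sup>2 * a * b)"
    unfolding el_scale el_add el_of_int[of "k\<^sup>2 * a * b"] by (simp add: power2_eq_square mult_ac)
  finally have p2: "of_int (k\<^sup>2 * a * b) \<in> ?I \<star> cI ?I" .
  have "el (k * b) k * el (k * b) (- k) = of_int ((k * b)\<^sup>2 - d * k\<^sup>2) / 4" by (rule el_norm)
  also have "(k * b)\<^sup>2 - d * k\<^sup>2 = 4 * (k\<^sup>2 * a * c)" unfolding d by (simp add: power2_eq_square algebra_simps)
  finally have p3: "of_int (k\<^sup>2 * a * c) \<in> ?I \<star> cI ?I" using imul_mem[OF e2 e2'] by simp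
  define g where "g = gcd a (gcd b c)"
  have gd: "g dvd a" "g dvd b" "g dvd c" unfolding g_def by (meson gcd_dvd1 gcd_dvd2 dvd_trans)+
  have "g * g dvd b * b" "g * g dvd 4 * a * c" using gd by (auto intro: mult_dvd_mono)
  then have "g\<^sup>2 dvd d" unfolding d power2_eq_square by (rule dvd_diff)
  then have g1: "g = 1" using square_dvd_d[of g] by (simp add: g_def)
  obtain x y where xy: "x * b + y * c = gcd b c" using bezout_int by blast
  obtain z w where zw: "z * a + w * gcd b c = 1" using bezout_int[of a "gcd b c"] g1 g_def by metis
  have one: "z * a + w * x * b + w * y * c = 1" using xy zw by (metis distrib_left mult.assoc add.assoc)
  have "of_int (k\<^sup>2 * a) = of_int z * of_int (k\<^sup>2 * a * a) + of_int (w * x) * of_int (k\<^sup>2 * a * b)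
      + (of_int (w * y) * of_int (k\<^sup>2 * a * c) :: real)"
  proof -
    have "k\<^sup>2 * a = k\<^sup>2 * a * (z * a + w * x * b + w * y * c)" unfolding one by simp
    also have "\<dots> = z * (k\<^sup>2 * a * a) + (w * x) * (k\<^sup>2 * a * b) + (w * y) * (k\<^sup>2 * a * c)"
      by (simp add: algebra_simps)
    finally show ?thesis by (metis of_int_add of_int_mult)
  qed
  then have "of_int (k\<^sup>2 * a) \<in> ?I \<star> cI ?I"
    using idlD(3,4)[OF P] p1 p2 p3 of_int_R by metis
  then show "pr (of_int (k\<^sup>2 * a)) \<subseteq> ?I \<star> cI ?I" using pr_subset[OF P] by blast
qed

section \<open>Norms of ideals, cancellation and divisibility\<close>

lemma pr_of_int_eq_iff:
  assumes "m > 0" "n > 0" shows "pr (of_int m) = pr (of_int n) \<longleftrightarrow> m = n"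
proof
  assume "pr (of_int m) = pr (of_int n)"
  then have "m dvd n" "n dvd m" using pr_self of_int_mem_pr by metis+
  then show "m = n" using assms zdvd_antisym_nonneg by (meson less_imp_le)
qed simp

text \<open>The norm is the positive generator of the product with the conjugate ideal instead of a
  number of cosets, so that multiplicativity is immediate.\<close>

definition idn :: "real set \<Rightarrow> int" where
  "idn I = (THE n. n > 0 \<and> I \<star> cI I = pr (of_int n))"

lemma idn_eqI: "n > 0 \<Longrightarrow> I \<star> cI I = pr (of_int n) \<Longrightarrow> idn I = n"
  unfolding idn_def by (rule the_equality) (auto simp: pr_of_int_eq_iff)

lemma idn_bas: "k > 0 \<Longrightarrow> a > 0 \<Longrightarrow> 4 * a dvd b\<^sup>2 - d \<Longrightarrow> idn (bas k a b) = k\<^sup>2 * a"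
  by (rule idn_eqI) (auto simp: bas_imul_cI)

lemma idn_props:
  assumes "nzi I"
  shows "idn I > 0" "I \<star> cI I = pr (of_int (idn I))"
proof -
  obtain k a b where *: "k > 0" "a > 0" "4 * a dvd b\<^sup>2 - d" "I = bas k a b" by (rule basis_exists[OF assms])
  show "idn I > 0" "I \<star> cI I = pr (of_int (idn I))"
    using *(1,2) idn_bas[OF *(1-3)] bas_imul_cI[OF *(1-3)] by (simp_all only: *(4)) simp_all
qed

lemma idn_imul: "nzi I \<Longrightarrow> nzi J \<Longrightarrow> idn (I \<star> J) = idn I * idn J"
proof (rule idn_eqI)
  assume IJ: "nzi I" "nzi J"
  show "idn I * idn J > 0" using idn_props(1) IJ by simp
  have "I \<star> J \<star> cI (I \<star> J) = (I \<star> cI I) \<star> (J \<star> cI J)"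
    using IJ by (simp add: cI_imul nzi_idl imul_swap idl_cI)
  also have "\<dots> = pr (of_int (idn I * idn J))"
    using idn_props(2) IJ by (simp add: pr_imul_pr of_int_R)
  finally show "I \<star> J \<star> cI (I \<star> J) = pr (of_int (idn I * idn J))" .
qed

lemma pr_uminus: "a \<in> R \<Longrightarrow> pr (- a) = pr a"
proof -
  have sub: "pr (- b) \<subseteq> pr b" if "b \<in> R" for b
    using pr_subset[OF idl_pr[OF that] idl_uminus[OF idl_pr[OF that] pr_self]] .
  then show "a \<in> R \<Longrightarrow> pr (- a) = pr a" using uminus_R by (metis minus_minus subset_antisym)
qed

lemma pr_abs_int: "pr (of_int \<bar>n\<bar>) = pr (of_int n)"
  using pr_uminus[OF of_int_R[of n]] by (cases "n \<ge> 0") auto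

lemma idn_pr: "a \<in> R \<Longrightarrow> a \<noteq> 0 \<Longrightarrow> idn (pr a) = \<bar>nrm a\<bar>"
proof (rule idn_eqI)
  assume a: "a \<in> R" "a \<noteq> 0"
  show "\<bar>nrm a\<bar> > 0" using nrm_eq_0[OF a(1)] a(2) by simp
  show "pr a \<star> cI (pr a) = pr (of_int \<bar>nrm a\<bar>)"
    unfolding pr_abs_int nrm_eq[OF a(1)] using a(1) by (simp add: cI_pr pr_imul_pr cnj_R)
qed

lemma idn_of_int: "n > 0 \<Longrightarrow> idn (pr (of_int n)) = n\<^sup>2"
  using idn_pr[of "of_int n"] of_int_R[of n] nrm_of_int[of n] by simp

lemma idn_R: "idn R = 1"
  using idn_of_int[of 1] pr_1 by simp

lemma idn_cI: "nzi I \<Longrightarrow> idn (cI I) = idn I"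
  using idn_props by (intro idn_eqI) (auto simp: cI_cI nzi_idl imul_comm)

lemma idn_ipow: "nzi I \<Longrightarrow> idn (ipow I n) = idn I ^ n"
  by (induction n) (auto simp: idn_R idn_imul nzi_ipow)

text \<open>Multiplying by the conjugate of \<open>I\<close> turns the factor \<open>I\<close> into
  the integer \<open>idn I\<close>, and scaling by a nonzero number is injective.\<close>

lemma imul_cancel_subset:
  assumes "nzi I" "idl J" "idl K" "I \<star> J \<subseteq> I \<star> K"
  shows "J \<subseteq> K"
proof -
  have I: "idl I" "idl (cI I)" using assms(1) nzi_idl idl_cI by blast+
  have pos: "idn I > 0" using idn_props assms(1) by blast
  have "cI I \<star> (I \<star> J) \<subseteq> cI I \<star> (I \<star> K)" using assms I by (intro imul_mono[OF I(2) _ subset_refl assms(4)]) (auto simp: idl_imul)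
  moreover have eq: "cI I \<star> (I \<star> L) = (\<lambda>x. of_int (idn I) * x) ` L" if "idl L" for L
  proof -
    have "cI I \<star> (I \<star> L) = (cI I \<star> I) \<star> L" using that I by (simp add: imul_assoc)
    also have "\<dots> = (I \<star> cI I) \<star> L" by (simp only: imul_comm)
    finally have "cI I \<star> (I \<star> L) = (I \<star> cI I) \<star> L" .
    then show ?thesis using idn_props(2)[OF assms(1)] pr_imul[OF that of_int_R] by simp
  qed
  ultimately have sub: "(\<lambda>x. of_int (idn I) * x) ` J \<subseteq> (\<lambda>x. of_int (idn I) * x) ` K" using eq[OF assms(2)] eq[OF assms(3)] by simp
  have "inj (\<lambda>x::real. of_int (idn I) * x)" using pos by (auto simp: inj_on_def)
  then show ?thesis using sub by (simp add: inj_image_subset_iff)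
qed

lemma imul_cancel: "nzi I \<Longrightarrow> idl J \<Longrightarrow> idl K \<Longrightarrow> I \<star> J = I \<star> K \<Longrightarrow> J = K"
  using imul_cancel_subset by (metis subset_antisym subset_refl)

lemma idn_1: "nzi I \<Longrightarrow> idn I = 1 \<Longrightarrow> I = R"
proof -
  assume I: "nzi I" "idn I = 1"
  have "I \<star> cI I = R" using idn_props(2)[OF I(1)] I(2) pr_1 by simp
  then have "R \<subseteq> I" using imul_subset_left[of I "cI I"] idl_cI nzi_idl[OF I(1)] by simp
  then show ?thesis using idlD(1)[OF nzi_idl[OF I(1)]] by blast
qed

text \<open>To contain is to divide: the cofactor is the product of \<open>I\<close> with the
  conjugate of \<open>J\<close>, divided by the norm of \<open>J\<close>. The division stays in
  \<open>R\<close> because that product lies in \<open>cI J \<star> J\<close>.\<close>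

lemma contains_imp_factor:
  assumes "nzi I" "nzi J" "I \<subseteq> J"
  obtains K where "nzi K" "I = J \<star> K"
proof -
  note id = nzi_idl[OF assms(1)] nzi_idl[OF assms(2)]
  define n where "n = (of_int (idn J) :: real)"
  have n: "n > 0" "n \<in> R" using idn_props(1)[OF assms(2)] of_int_R by (auto simp: n_def)
  have L: "idl (cI J \<star> I)" "cI J \<star> I \<subseteq> pr n"
  proof -
    show "idl (cI J \<star> I)" using id idl_cI idl_imul by blast
    have "cI J \<star> I \<subseteq> cI J \<star> J" using id assms(3) idl_cI by (intro imul_mono) auto
    then show "cI J \<star> I \<subseteq> pr n" using idn_props(2)[OF assms(2)] imul_comm n_def by metis
  qed
  define K where "K = {x \<in> R. n * x \<in> cI J \<star> I}"
  have K: "idl K" unfolding is_ideal_def K_def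
    using idlD[OF L(1)] zero_R add_R mult_R by (auto simp: distrib_left mult.left_commute)
  have "(\<lambda>x. n * x) ` K = cI J \<star> I"
  proof
    show "cI J \<star> I \<subseteq> (\<lambda>x. n * x) ` K"
    proof
      fix y assume y: "y \<in> cI J \<star> I"
      then obtain r where "r \<in> R" "y = r * n" using L(2) by (metis pr_iff subsetD)
      then show "y \<in> (\<lambda>x. n * x) ` K" using y by (auto simp: K_def mult.commute)
    qed
  qed (auto simp: K_def)
  then have pK: "pr n \<star> K = cI J \<star> I" using pr_imul[OF K n(2)] by simp
  have "pr n \<star> (J \<star> K) = J \<star> (cI J \<star> I)"
    using pK id K n idl_pr by (simp add: imul_left_comm)
  also have "\<dots> = (J \<star> cI J) \<star> I" using id idl_cI by (simp add: imul_assoc)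
  also have "\<dots> = pr n \<star> I" using idn_props(2)[OF assms(2)] by (simp add: n_def)
  finally have "I = J \<star> K" using pr_cancel[of n "J \<star> K" I] n id K idl_imul by auto
  moreover have "nzi K"
  proof -
    have "K \<noteq> {0}"
    proof
      assume "K = {0}"
      then have "J \<star> K \<subseteq> {0}" using id imul_least[of "{0}" J K] zero_R by (auto simp: is_ideal_def)
      then show False using assms(1) \<open>I = J \<star> K\<close> idlD(2)[OF id(1)] by (auto simp: nzi_def)
    qed
    then show ?thesis using K by (simp add: nzi_def)
  qed
  ultimately show ?thesis using that by blast
qed

lemma subset_idn_eq: "nzi I \<Longrightarrow> nzi J \<Longrightarrow> I \<subseteq> J \<Longrightarrow> idn I = idn J \<Longrightarrow> I = J"
proof -
  assume *: "nzi I" "nzi J" "I \<subseteq> J" "idn I = idn J"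
  obtain K where K: "nzi K" "I = J \<star> K" using contains_imp_factor[OF *(1-3)] .
  then have "idn K = 1" using idn_imul[OF *(2) K(1)] *(4) idn_props(1)[OF *(2)] by simp
  then have "K = R" using idn_1[OF K(1)] by simp
  then show "I = J" using K(2) imul_R nzi_idl[OF *(2)] by simp
qed

lemma idn_dvd_nrm:
  assumes "nzi I" "x \<in> I"
  obtains v where "nrm x = v * idn I"
proof (cases "x = 0")
  case True
  then show ?thesis using that[of 0] nrm_of_int[of 0] by simp
next
  case False
  have xR: "x \<in> R" using assms idl_in_R nzi_idl by blast
  obtain K where K: "nzi K" "pr x = I \<star> K"
    using contains_imp_factor[OF nzi_pr[OF xR False] assms(1) pr_subset[OF nzi_idl[OF assms(1)] assms(2)]] .
  then have "\<bar>nrm x\<bar> = idn K * idn I" using idn_imul[OF assms(1) K(1)] idn_pr[OF xR False] by (metis mult.commute)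
  then have "nrm x = idn K * idn I \<or> nrm x = (- idn K) * idn I" by auto
  then show ?thesis using that by blast
qed

section \<open>Reduction of bases and finiteness of the class group\<close>

lemma eqv_imul_cI: "nzi I \<Longrightarrow> eqv (I \<star> cI I) R"
  using idn_props[of I] eqv_pr_R[OF of_int_R] by simp

lemma bas_shift: "bas k a (b + 2 * a * t) = bas k a b"
proof -
  have sub: "bas k a (b + 2 * a * t) \<subseteq> bas k a b" for b t
  proof -
    have "el (k * (2 * a * u + (b + 2 * a * t) * v)) (k * v) = el (k * (2 * a * (u + t * v) + b * v)) (k * v)" for u v
      by (simp add: algebra_simps)
    then show ?thesis using bas_mem by (auto simp: bas_def[of k a "b + 2 * a * t"])
  qed
  from this[of b t] sub[of "b + 2 * a * t" "- t"] show ?thesis by simp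
qed

lemma bas_scale: "4 * a dvd b\<^sup>2 - d \<Longrightarrow> bas k a b = pr (of_int k) \<star> bas 1 a b"
proof -
  assume a: "4 * a dvd b\<^sup>2 - d"
  have "bas k a b = (\<lambda>x. of_int k * x) ` bas 1 a b"
    unfolding bas_def by (auto simp: el_scale image_iff) (metis el_scale)+
  then show ?thesis using pr_imul[OF idl_bas[OF a] of_int_R] by simp
qed

text \<open>The step from the form \<open>(a, b, c)\<close> to \<open>(c, - b, a)\<close> in Gauss
  reduction. It is multiplication by \<open>(b - s) / 2\<close>, whose product with the basis
  element \<open>(b + s) / 2\<close> is \<open>a c\<close>.\<close>

lemma bas_swap:
  assumes "4 * a * c = b\<^sup>2 - d"
  shows "pr (el b (-1)) \<star> bas 1 a b = pr (of_int a) \<star> bas 1 c (- b)"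
proof -
  have dv: "4 * a dvd b\<^sup>2 - d" "4 * c dvd (- b)\<^sup>2 - d" using assms by (auto simp: dvd_def) (metis mult.assoc mult.commute)+
  have b: "odd b" using bas_coeffs_odd dv(1) .
  have d: "d = b * b - 4 * a * c" using assms by (simp add: power2_eq_square)
  have bR: "el b (-1) \<in> R" using b by (simp add: el_in_OK_iff)
  have el: "el b (-1) * el (2 * a * u + b * v) v = of_int a * el (2 * c * v + (- b) * (- u)) (- u)" for u v
    unfolding el_scale by (rule el_mult) (simp_all add: d algebra_simps)
  have "(\<lambda>x. el b (-1) * x) ` bas 1 a b = (\<lambda>x. of_int a * x) ` bas 1 c (- b)"
  proof (intro equalityI subsetI)
    fix y assume "y \<in> (\<lambda>x. el b (-1) * x) ` bas 1 a b"
    then obtain u v where "y = el b (-1) * el (2 * a * u + b * v) v" by (auto simp: bas_def)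
    then show "y \<in> (\<lambda>x. of_int a * x) ` bas 1 c (- b)"
      using el[of u v] bas_mem[of 1 c v "- b" "- u"] by auto
  next
    fix y assume "y \<in> (\<lambda>x. of_int a * x) ` bas 1 c (- b)"
    then obtain v' u where "y = of_int a * el (2 * c * v' + (- b) * u) u" by (auto simp: bas_def)
    then have "y = of_int a * el (2 * c * v' + (- b) * - (- u)) (- (- u))" by simp
    then show "y \<in> (\<lambda>x. el b (-1) * x) ` bas 1 a b"
      using el[of "- u" v'] bas_mem[of 1 a "- u" b v'] by (intro image_eqI[of _ _ "el (2 * a * (- u) + b * v') v'"]) simp_all
  qed
  then show ?thesis using pr_imul idl_bas dv bR of_int_R by simp
qed

lemma bas_uminus: "bas k (- a) b = bas k a b"
proof -
  have sub: "bas k (- a) b \<subseteq> bas k a b" for a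
  proof
    fix x assume "x \<in> bas k (- a) b"
    then obtain u v where "x = el (k * (2 * - a * u + b * v)) (k * v)" by (auto simp: bas_def)
    then have "x = el (k * (2 * a * (- u) + b * v)) (k * v)" by simp
    then show "x \<in> bas k a b" using bas_mem by blast
  qed
  from this[of a] sub[of "- a"] show ?thesis by simp
qed

lemma nzi_bas: "k > 0 \<Longrightarrow> 4 * a dvd b\<^sup>2 - d \<Longrightarrow> nzi (bas k a b)"
proof -
  assume *: "k > 0" "4 * a dvd b\<^sup>2 - d"
  have "0 = el 0 0" by (simp add: el_def)
  then have "el (k * b) k \<noteq> 0" using *(1) el_eq_iff[of "k * b" k 0 0] by (metis less_irrefl)
  then show ?thesis using idl_bas[OF *(2)] bas_mem[of k a 0 b 1] by (auto simp: nzi_def)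
qed

text \<open>Gauss reduction in one stroke: \<open>a\<close> is chosen minimal among the positive
  leading coefficients of lattices equivalent to \<open>I\<close>. A translation gives
  \<open>|b| <= a\<close>, and minimality against the swapped lattice gives
  \<open>a <= |c|\<close>.\<close>

lemma reduced_representative:
  assumes "nzi I"
  obtains a b where "0 < a" "a \<le> d" "\<bar>b\<bar> \<le> d" "nzi (bas 1 a b)" "eqv I (bas 1 a b)"
proof -
  define Q where "Q = (\<lambda>n::nat. \<exists>b. n > 0 \<and> 4 * int n dvd b\<^sup>2 - d \<and> eqv I (bas 1 (int n) b))"
  obtain k a0 b0 where 0: "k > 0" "a0 > 0" "4 * a0 dvd b0\<^sup>2 - d" "I = bas k a0 b0" by (rule basis_exists[OF assms])
  have "eqv I (bas 1 a0 b0)" unfolding 0(4) bas_scale[OF 0(3), of k]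
    using 0 nzi_bas of_int_R by (intro eqv_mult_pr) auto
  then have "Q (nat a0)" using 0 by (auto simp: Q_def)
  then have Q: "Q (LEAST n. Q n)" by (rule LeastI)
  define a where "a = int (LEAST n. Q n)"
  obtain b1 where b1: "a > 0" "4 * a dvd b1\<^sup>2 - d" "eqv I (bas 1 a b1)" using Q by (auto simp: Q_def a_def)
  define t where "t = (b1 + a) div (2 * a)"
  define b where "b = b1 - 2 * a * t"
  have bb: "bas 1 a b = bas 1 a b1" using bas_shift[of 1 a b1 "- t"] by (simp add: b_def)
  have "b + a = (b1 + a) mod (2 * a)" by (simp add: b_def t_def minus_mult_div_eq_mod[symmetric])
  then have "0 \<le> b + a" "b + a < 2 * a" using b1(1) by simp_all
  then have ba: "\<bar>b\<bar> \<le> a" by linarith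
  have "b\<^sup>2 - d = (b1\<^sup>2 - d) + 4 * a * (a * t * t - b1 * t)"
    by (simp add: b_def power2_eq_square algebra_simps)
  then have "4 * a dvd b\<^sup>2 - d" using b1(2) by (metis dvd_add dvd_triv_left)
  then obtain c where c: "4 * a * c = b\<^sup>2 - d" by (metis dvdE)
  have c0: "c \<noteq> 0" using c d_not_square[of b] by auto
  have nb: "nzi (bas 1 a b)" using bb b1(3) eqv_nzi by simp
  have dvc: "4 * c dvd (- b)\<^sup>2 - d" using c by (metis dvd_triv_right mult.assoc mult.commute power2_minus)
  have nc: "nzi (bas 1 c (- b))" using nzi_bas dvc by simp
  have el0: "el b (-1) \<noteq> 0" using el_eq_iff[of b "-1" 0 0] by (simp add: el_def)
  have elR: "el b (-1) \<in> R" 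
  proof -
    have "odd b" using bas_coeffs_odd[of a b] c by (metis dvd_triv_left)
    then show ?thesis by (simp add: el_in_OK_iff)
  qed
  have "eqv (bas 1 a b) (bas 1 c (- b))"
    using eqvI[OF nb nc elR of_int_R[of a] el0 _ bas_swap[OF c]] b1(1) by simp
  then have "eqv I (bas 1 c (- b))" using b1(3) bb eqv_trans by metis
  moreover have "bas 1 c (- b) = bas 1 \<bar>c\<bar> (- b)" using bas_uminus[of 1 c "- b"] by (cases "c \<ge> 0") auto
  moreover have "4 * \<bar>c\<bar> dvd (- b)\<^sup>2 - d" using dvc by (cases "c \<ge> 0") auto
  ultimately have "Q (nat \<bar>c\<bar>)" using c0 unfolding Q_def by (intro exI[of _ "- b"]) simp
  then have "(LEAST n. Q n) \<le> nat \<bar>c\<bar>" by (rule Least_le)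
  then have ac: "a \<le> \<bar>c\<bar>" by (simp add: a_def)
  have b2: "b\<^sup>2 \<le> a\<^sup>2" using ba b1(1) by (simp add: abs_le_square_iff[symmetric])
  have "4 * a\<^sup>2 \<le> 4 * a * \<bar>c\<bar>" using ac b1(1) by (simp add: power2_eq_square)
  also have "\<dots> = \<bar>b\<^sup>2 - d\<bar>" unfolding c[symmetric] using b1(1) by (simp add: abs_mult)
  finally have "4 * a\<^sup>2 \<le> \<bar>b\<^sup>2 - d\<bar>" .
  moreover have "0 < a\<^sup>2" "0 \<le> b\<^sup>2" using b1(1) by auto
  \<comment> \<open>If \<open>b^2 - d\<close> were nonnegative, then
    \<open>4 a^2 <= b^2 - d < a^2\<close>, which is absurd; hence
    \<open>4 a^2 <= d - b^2\<close>.\<close>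
  ultimately have "a\<^sup>2 \<le> d" using b2 d_gt_1 by linarith
  moreover have "a \<le> a\<^sup>2" using b1(1) by (simp add: power2_eq_square)
  ultimately have "a \<le> d" by linarith
  then show ?thesis using that[of a b] b1 ba nb bb by simp
qed

sublocale real_subring_class_group R
proof
  fix I assume I: "nzi I"
  show "\<exists>J. nzi J \<and> eqv (I \<star> J) R" using eqv_imul_cI[OF I] nzi_cI[OF I] by blast
next
  let ?f = "\<lambda>(a, b). ideal_equiv R `` {bas 1 a b}"
  have "{I. nzi I} // ideal_equiv R \<subseteq> ?f ` ({1..d} \<times> {-d..d})"
  proof
    fix X assume "X \<in> {I. nzi I} // ideal_equiv R"
    then obtain I where I: "nzi I" "X = ideal_equiv R `` {I}" by (auto elim: quotientE)
    obtain a b where ab: "0 < a" "a \<le> d" "\<bar>b\<bar> \<le> d" "nzi (bas 1 a b)" "eqv I (bas 1 a b)"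
      by (rule reduced_representative[OF I(1)])
    have "X = ?f (a, b)" using I(2) ab(5) equiv_class_eq[OF equiv_ideal_equiv] by (simp add: eqv_def)
    then show "X \<in> ?f ` ({1..d} \<times> {-d..d})" using ab(1-3) by (intro image_eqI[of _ _ "(a, b)"]) auto
  qed
  then show "finite ({I. nzi I} // ideal_equiv R)" by (rule finite_subset) auto
qed

end

section \<open>Pell equations and fundamental units\<close>

context real_quad
begin

lemma s_gt_1: "s > 1" using d_gt_1 by simp

text \<open>Dirichlet approximation yields points of bounded norm with \<open>|y s - x|\<close>
  arbitrarily small. Finitely many such points would have a smallest distance, which is positive
  because \<open>s\<close> is irrational.\<close>

lemma pell_approximations_infinite:
  "infinite {(x::int, y::int). y > 0 \<and> \<bar>x\<^sup>2 - d * y\<^sup>2\<bar> \<le> 2 * d + 1}" (is "infinite ?A")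
proof
  assume fin: "finite ?A"
  define f where "f = (\<lambda>(x::int, y::int). \<bar>of_int y * s - of_int x\<bar>)"
  have approx: "\<exists>a\<in>?A. f a < 1 / real N" if N: "N > 0" for N :: nat
  proof -
    obtain h k where hk: "0 < k" "k \<le> int N" "\<bar>of_int k * s - of_int h\<bar> < 1 / N"
      using Dirichlet_approx[OF N, of s] by blast
    have "\<bar>of_int k * s - of_int h\<bar> * of_int k \<le> 1 / N * real N"
      using hk by (intro mult_mono) auto
    then have 1: "\<bar>of_int k * s - of_int h\<bar> * of_int k \<le> 1" using that by simp
    have 2: "\<bar>of_int k * s - of_int h\<bar> \<le> 1"
    proof -
      have "1 / real N \<le> 1" using N by simp
      then show ?thesis using hk(3) by linarith
    qed
    have "of_int (d * k\<^sup>2 - h\<^sup>2) = (of_int k * s - of_int h) * (of_int k * s + of_int h)"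
    proof -
      have "(of_int k * s - of_int h) * (of_int k * s + of_int h) = s * s * (of_int k)\<^sup>2 - (of_int h)\<^sup>2"
        by (simp add: algebra_simps power2_eq_square)
      then show ?thesis unfolding s_sq by simp
    qed
    then have "\<bar>of_int (d * k\<^sup>2 - h\<^sup>2)\<bar> = \<bar>of_int k * s - of_int h\<bar> * \<bar>of_int k * s + of_int h\<bar>"
      by (simp only: abs_mult)
    also have "\<dots> \<le> \<bar>of_int k * s - of_int h\<bar> * (2 * of_int k * s + 1)"
    proof (rule mult_left_mono)
      have "0 \<le> of_int k * s" using hk(1) d_gt_1 by simp
      then show "\<bar>of_int k * s + of_int h\<bar> \<le> 2 * of_int k * s + 1" using 2 by linarith
    qed simp
    also have "\<dots> = 2 * s * (\<bar>of_int k * s - of_int h\<bar> * of_int k) + \<bar>of_int k * s - of_int h\<bar>"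
      by (simp add: algebra_simps)
    also have "\<dots> \<le> 2 * s * 1 + 1" using 1 2 s_gt_1 by (intro add_mono mult_left_mono) auto
    \<comment> \<open>The estimate \<open>s <= s^2 = d\<close> turns the real bound
      \<open>2 s + 1\<close> into the integer \<open>2 d + 1\<close>.\<close>
    also have "\<dots> \<le> 2 * (s * s) + 1" using mult_left_mono[of 1 s s] s_gt_1 by linarith
    also have "\<dots> = of_int (2 * d + 1)" unfolding s_sq by simp
    finally have "\<bar>of_int (d * k\<^sup>2 - h\<^sup>2)\<bar> \<le> (of_int (2 * d + 1) :: real)" .
    then have "\<bar>d * k\<^sup>2 - h\<^sup>2\<bar> \<le> 2 * d + 1" by (simp only: of_int_abs[symmetric] of_int_le_iff)
    then have "(h, k) \<in> ?A" using hk(1) by (simp add: abs_minus_commute)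
    then show ?thesis using hk(3) by (force simp: f_def)
  qed
  have ne: "?A \<noteq> {}" using approx[of 1] by auto
  have pos: "f a > 0" if aA: "a \<in> ?A" for a
  proof -
    obtain x y where a: "a = (x, y)" "y > 0" using aA by auto
    have "of_int y * s - of_int x \<noteq> 0"
      using irrational[of "- of_int x" "of_int y"] a(2) by auto
    then show ?thesis by (simp add: f_def a(1))
  qed
  define m where "m = Min (f ` ?A)"
  have "m > 0" using fin ne pos by (simp add: m_def)
  then obtain N :: nat where N: "N > 0" "1 / real N < m"
    by (metis nat_approx_posE zero_less_Suc)
  then obtain a where "a \<in> ?A" "f a < m" using approx[OF N(1)] by force
  moreover have "m \<le> f a" unfolding m_def using fin \<open>a \<in> ?A\<close> by (intro Min_le finite_imageI imageI)
  ultimately show False by simp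
qed

text \<open>Two of the points of bounded norm share their norm \<open>n\<close> and their residues
  modulo \<open>n\<close>. The congruences make the quotient of the two numbers
  \<open>x + y s\<close> integral; it has norm 1, and \<open>Y = 0\<close> would make the points
  equal.\<close>

lemma pell_solution_exists: "\<exists>x y. y \<noteq> 0 \<and> x\<^sup>2 - d * y\<^sup>2 = 1"
proof -
  define A where "A = {(x::int, y::int). y > 0 \<and> \<bar>x\<^sup>2 - d * y\<^sup>2\<bar> \<le> 2 * d + 1}"
  define f where "f = (\<lambda>(x::int, y::int). (x\<^sup>2 - d * y\<^sup>2, x mod (x\<^sup>2 - d * y\<^sup>2), y mod (x\<^sup>2 - d * y\<^sup>2)))"
  define B where "B = 2 * d + 1"
  have n0: "x\<^sup>2 - d * y\<^sup>2 \<noteq> 0" if "y \<noteq> 0" for x y using d_mult_square_eq[of x y] that by auto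
  have mod_le: "\<bar>x mod n\<bar> \<le> \<bar>n\<bar>" if "n \<noteq> 0" for x n :: int
    using that abs_mod_less[of n x] by linarith
  have "f ` A \<subseteq> {-B..B} \<times> {-B..B} \<times> {-B..B}"
  proof
    fix z assume "z \<in> f ` A"
    then obtain x y where xy: "y > 0" "\<bar>x\<^sup>2 - d * y\<^sup>2\<bar> \<le> B" "z = f (x, y)" by (auto simp: A_def B_def)
    have n: "x\<^sup>2 - d * y\<^sup>2 \<noteq> 0" using n0 xy by simp
    show "z \<in> {-B..B} \<times> {-B..B} \<times> {-B..B}"
      using xy mod_le[OF n, of x] mod_le[OF n, of y] by (auto simp: f_def)
  qed
  then have "finite (f ` A)" by (rule finite_subset) auto
  then obtain a0 where a0: "a0 \<in> A" "infinite {a \<in> A. f a = f a0}"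
    using pigeonhole_infinite[of A f] pell_approximations_infinite unfolding A_def by blast
  have "infinite ({a \<in> A. f a = f a0} - {a0})" using a0(2) by simp
  then have "{a \<in> A. f a = f a0} - {a0} \<noteq> {}" by (metis finite.emptyI)
  then obtain a1 where a1: "a1 \<in> A" "f a1 = f a0" "a1 \<noteq> a0" by blast
  obtain x y where xy: "a0 = (x, y)" "y > 0" using a0(1) by (auto simp: A_def)
  obtain x' y' where xy': "a1 = (x', y')" "y' > 0" using a1(1) by (auto simp: A_def)
  define n where "n = x\<^sup>2 - d * y\<^sup>2"
  have n: "n \<noteq> 0" using n0 xy(2) by (simp add: n_def)
  have n': "x'\<^sup>2 - d * y'\<^sup>2 = n" using a1(2) by (simp add: f_def xy(1) xy'(1) n_def)
  have cx: "x' mod n = x mod n" "y' mod n = y mod n" using a1(2) n' by (simp_all add: f_def xy(1) xy'(1) n_def)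
  have dx: "n dvd x' - x" "n dvd y' - y" using cx by (simp_all add: mod_eq_dvd_iff)
  have "x * x' - d * (y * y') = n + x * (x' - x) - d * (y * (y' - y))"
    by (simp add: n_def power2_eq_square algebra_simps)
  then have "n dvd x * x' - d * (y * y')" using dx by (metis dvd_add dvd_diff dvd_mult dvd_refl)
  then obtain X where X: "x * x' - d * (y * y') = n * X" by (auto simp: dvd_def)
  have "x * y' - x' * y = x * (y' - y) - y * (x' - x)" by (simp add: algebra_simps)
  then have "n dvd x * y' - x' * y" using dx by (metis dvd_diff dvd_mult)
  then obtain Y where Y: "x * y' - x' * y = n * Y" by (auto simp: dvd_def)
  have "(n * X)\<^sup>2 - d * (n * Y)\<^sup>2 = (x\<^sup>2 - d * y\<^sup>2) * (x'\<^sup>2 - d * y'\<^sup>2)"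
    unfolding X[symmetric] Y[symmetric] by (simp add: power2_eq_square algebra_simps)
  then have "(n * X)\<^sup>2 - d * (n * Y)\<^sup>2 = n * n" unfolding n' n_def[symmetric] .
  then have "n\<^sup>2 * (X\<^sup>2 - d * Y\<^sup>2) = n\<^sup>2 * 1"
  proof -
    have "(n * X)\<^sup>2 - d * (n * Y)\<^sup>2 = n\<^sup>2 * (X\<^sup>2 - d * Y\<^sup>2)"
      by (simp add: power_mult_distrib algebra_simps)
    then show ?thesis using \<open>(n * X)\<^sup>2 - d * (n * Y)\<^sup>2 = n * n\<close> by (simp add: power2_eq_square)
  qed
  then have XY: "X\<^sup>2 - d * Y\<^sup>2 = 1" using n by (simp only: mult_cancel_left) simp
  moreover have "Y \<noteq> 0"
  proof
    assume "Y = 0"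
    then have e: "x * y' = x' * y" using Y by simp
    have "y'\<^sup>2 * n = (x * y')\<^sup>2 - d * y\<^sup>2 * y'\<^sup>2" by (simp add: n_def power2_eq_square algebra_simps)
    also have "\<dots> = y\<^sup>2 * n" unfolding e n'[symmetric] by (simp add: power2_eq_square algebra_simps)
    finally have "y'\<^sup>2 = y\<^sup>2" using n by simp
    then have "y' = y" using xy(2) xy'(2) by (simp add: power2_eq_iff)
    then have "x' = x" using e xy(2) by simp
    then show False using \<open>y' = y\<close> a1(3) xy(1) xy'(1) by simp
  qed
  ultimately show ?thesis by blast
qed

end

section \<open>Solvability of \<open>t^2 - p u^2 = -1\<close>\<close>

lemma coprime_mult_square:
  fixes a b z :: nat
  assumes "coprime a b" "a * b = z\<^sup>2"
  obtains u v where "a = u\<^sup>2" "b = v\<^sup>2"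
proof -
  have "is_nth_power 2 (a * b)" using assms(2) by (auto simp: is_nth_power_def)
  then have "is_nth_power 2 a" "is_nth_power 2 b"
    using is_nth_power_mult_coprime_nat_iff[OF assms(1), of 2] by auto
  then show ?thesis using that by (auto simp: is_nth_power_def)
qed

text \<open>In the solution of \<open>x^2 - p y^2 = 1\<close> with least \<open>y > 0\<close>,
  \<open>x\<close> is odd and \<open>y = 2 z\<close>, so the consecutive numbers
  \<open>w = (x - 1) / 2\<close> and \<open>w + 1\<close> have product \<open>p z^2\<close>. One of
  them is a square and the other is \<open>p\<close> times a square: one distribution is a smaller
  solution, the other solves the equation with \<open>-1\<close>.\<close>

lemma negative_pell:
  fixes p :: nat
  assumes "prime p" "p mod 4 = 1" "\<exists>x y::int. y \<noteq> 0 \<and> x\<^sup>2 - int p * y\<^sup>2 = 1"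
  shows "\<exists>t u::int. t\<^sup>2 - int p * u\<^sup>2 = -1"
proof -
  define Q where "Q = (\<lambda>y::nat. y > 0 \<and> (\<exists>x. x\<^sup>2 = 1 + p * y\<^sup>2))"
  obtain x0 y0 :: int where xy0: "y0 \<noteq> 0" "x0\<^sup>2 - int p * y0\<^sup>2 = 1" using assms(3) by blast
  have "int ((nat \<bar>x0\<bar>)\<^sup>2) = int (1 + p * (nat \<bar>y0\<bar>)\<^sup>2)" using xy0(2) by simp
  then have "Q (nat \<bar>y0\<bar>)" unfolding Q_def using xy0(1) by (metis of_nat_eq_iff zero_less_abs_iff zero_less_nat_eq)
  then have "Q (LEAST y. Q y)" by (rule LeastI)
  moreover define y where "y = (LEAST y. Q y)"
  ultimately obtain x where xy: "y > 0" "x\<^sup>2 = 1 + p * y\<^sup>2" by (auto simp: Q_def)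
  have min: "\<not> Q u" if "u < y" for u using that not_less_Least by (simp add: y_def)
  have odd_p: "odd p" using assms(2) by presburger
  have "even y"
  proof (rule ccontr)
    assume "odd y"
    then obtain b where "y = 2 * b + 1" by (elim oddE)
    then have y2: "y\<^sup>2 = 4 * (b * b + b) + 1" by (simp add: power2_eq_square)
    have pe: "p = 4 * (p div 4) + 1" using assms(2) by presburger
    have "1 + p * y\<^sup>2 = 2 + 4 * ((p div 4) * y\<^sup>2 + (b * b + b))"
      by (subst pe) (simp add: y2 distrib_right)
    then have "x\<^sup>2 = 2 + 4 * ((p div 4) * y\<^sup>2 + (b * b + b))" using xy(2) by simp
    moreover obtain c where "x\<^sup>2 = 4 * c \<or> x\<^sup>2 = 4 * c + 1"
    proof (cases "even x")
      case True
      then obtain e where "x = 2 * e" by (elim evenE)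
      then have "x\<^sup>2 = 4 * (e * e)" by (simp add: power2_eq_square)
      then show ?thesis using that by blast
    next
      case False
      then obtain e where "x = 2 * e + 1" by (elim oddE)
      then have "x\<^sup>2 = 4 * (e * e + e) + 1" by (simp add: power2_eq_square)
      then show ?thesis using that by blast
    qed
    ultimately show False by presburger
  qed
  then obtain z where z: "y = 2 * z" by blast
  have "odd (x\<^sup>2)" unfolding xy(2) using \<open>even y\<close> by simp
  then have "odd x" by simp
  then obtain w where w: "x = 2 * w + 1" by (auto elim: oddE)
  have "4 * (w * (w + 1)) = 4 * (p * z\<^sup>2)"
    using xy(2) unfolding w z by (simp add: power2_eq_square algebra_simps)
  then have ww: "w * (w + 1) = p * z\<^sup>2" by simp
  have z0: "z > 0" using xy(1) z by simp
  have p0: "p > 0" using assms(1) prime_gt_0_nat by blast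
  have w0: "w > 0" using ww z0 p0 by (cases w) auto
  have cop: "coprime w (w + 1)" by simp
  have "p dvd w * (w + 1)" using ww by simp
  then consider "p dvd w" | "p dvd w + 1" using assms(1) prime_dvd_mult_iff by blast
  then show ?thesis
  proof cases
    case 1
    then obtain w' where w': "w = p * w'" by (auto simp: dvd_def)
    have "p * (w' * (w + 1)) = p * z\<^sup>2" using ww by (subst (asm) w') (simp add: mult_ac)
    then have e: "w' * (w + 1) = z\<^sup>2" using p0 by simp
    have "coprime w' (w + 1)" using cop by (subst (asm) w') simp
    then obtain u v where uv: "w' = u\<^sup>2" "w + 1 = v\<^sup>2" using coprime_mult_square[OF _ e] by blast
    \<comment> \<open>Here \<open>v^2 - p u^2 = 1\<close> with \<open>0 < u <= z < y\<close>,
      against the minimality of \<open>y\<close>.\<close>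
    have "Q u" using uv w' w0 unfolding Q_def by (auto intro!: exI[of _ v])
    moreover have "u < y"
    proof -
      have "u\<^sup>2 \<le> z\<^sup>2" using e uv(1) by (metis le_add2 mult.right_neutral mult_le_mono2)
      then have "u \<le> z" by (simp add: power_mono_iff)
      then show ?thesis using z z0 by simp
    qed
    ultimately show ?thesis using min by blast
  next
    case 2
    then obtain w' where w': "w + 1 = p * w'" by (auto simp: dvd_def)
    have "p * (w * w') = p * z\<^sup>2" using ww unfolding w' by (simp add: mult_ac)
    then have e: "w * w' = z\<^sup>2" using p0 by simp
    have "coprime w w'" using cop unfolding w' by simp
    then obtain u v where uv: "w = u\<^sup>2" "w' = v\<^sup>2" using coprime_mult_square[OF _ e] by blast
    have "int (u\<^sup>2 + 1) = int (p * v\<^sup>2)" using w' uv by simp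
    then have "(int u)\<^sup>2 - int p * (int v)\<^sup>2 = -1" by simp
    then show ?thesis by blast
  qed
qed

section \<open>Units and the norm of the fundamental unit\<close>

context real_quad
begin

lemma units_iff: "x \<in> units_of_ring R \<longleftrightarrow> x \<in> R \<and> \<bar>nrm x\<bar> = 1"
proof
  assume "x \<in> units_of_ring R"
  then obtain y where y: "x \<in> R" "y \<in> R" "x * y = 1" by (auto simp: units_of_ring_def)
  have "nrm x * nrm y = 1" using nrm_mult[OF y(1,2)] y(3) nrm_of_int[of 1] by simp
  then show "x \<in> R \<and> \<bar>nrm x\<bar> = 1" using y(1) by (metis abs_zmult_eq_1 abs_1)
next
  assume x: "x \<in> R \<and> \<bar>nrm x\<bar> = 1"
  then have "x * cnj x = 1 \<or> x * (- cnj x) = 1" using nrm_eq[of x] by (auto simp: abs_if split: if_splits)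
  then show "x \<in> units_of_ring R" using x cnj_R[of x] uminus_R[of "cnj x"] unfolding units_of_ring_def by blast
qed

lemma odd_square_mod_8: "odd (x::int) \<Longrightarrow> x\<^sup>2 mod 8 = 1"
proof -
  assume "odd x"
  then obtain k where k: "x = 2 * k + 1" by (elim oddE)
  have "even (k * (k + 1))" by simp
  then obtain j where "k * (k + 1) = 2 * j" by (elim evenE)
  then have "x\<^sup>2 = 1 + 8 * j" unfolding k by (simp add: power2_eq_square algebra_simps)
  then show ?thesis by simp
qed

text \<open>As \<open>d = 1\<close> modulo 8, odd \<open>u\<close> and \<open>v\<close> make
  \<open>u^2 - d v^2\<close> divisible by 8 and hence the norm even. Elements of odd norm therefore
  have integral coefficients.\<close>

lemma even_coeffs:
  assumes "even (u - v)" "nrm (el u v) mod 2 = 1"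
  obtains U V where "u = 2 * U" "v = 2 * V" "nrm (el u v) = U\<^sup>2 - d * V\<^sup>2"
proof -
  have n: "4 * nrm (el u v) = u\<^sup>2 - d * v\<^sup>2" using nrm_el_eq[OF assms(1)] .
  have "even u"
  proof (rule ccontr)
    assume "odd u"
    then have uv: "u\<^sup>2 mod 8 = 1" "v\<^sup>2 mod 8 = 1" using assms(1) odd_square_mod_8 by auto
    obtain i where i: "u\<^sup>2 = 8 * i + 1" using uv(1) by (metis mult_div_mod_eq)
    obtain j where j: "v\<^sup>2 = 8 * j + 1" using uv(2) by (metis mult_div_mod_eq)
    obtain k where k: "d = 8 * k + 1" using d_mod_8 by (metis mult_div_mod_eq)
    have "u\<^sup>2 - d * v\<^sup>2 = 8 * (i - k * v\<^sup>2 - j)" unfolding k i j by (simp add: algebra_simps)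
    then have "nrm (el u v) = 2 * (i - k * v\<^sup>2 - j)" using n by simp
    then show False using assms(2) by simp
  qed
  then have "even v" using assms(1) by simp
  obtain U V where UV: "u = 2 * U" "v = 2 * V" using \<open>even u\<close> \<open>even v\<close> by (metis evenE)
  have "nrm (el u v) = U\<^sup>2 - d * V\<^sup>2" using n unfolding UV by (simp add: power2_eq_square algebra_simps)
  then show ?thesis using that UV by blast
qed

lemma el_double: "el (2 * U) (2 * V) = of_int U + of_int V * s"
  by (simp add: el_def)

text \<open>The conjugate of \<open>x\<close> has absolute value \<open>1 / x < 1\<close>, so both
  the sum and the difference of \<open>x\<close> and its conjugate are positive.\<close>

lemma unit_gt_1_coeffs:
  assumes "x \<in> R" "\<bar>nrm x\<bar> = 1" "x > 1"
  obtains T U where "T > 0" "U > 0" "x = el (2 * T) (2 * U)" "nrm x = T\<^sup>2 - d * U\<^sup>2"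
proof -
  obtain u v where uv: "even (u - v)" "x = el u v" using OK_imp_el[OF assms(1)] by blast
  have "nrm (el u v) mod 2 = 1" using assms(2) uv(2) by (auto simp: abs_if split: if_splits)
  then obtain T U where TU: "u = 2 * T" "v = 2 * U" "nrm (el u v) = T\<^sup>2 - d * U\<^sup>2"
    using even_coeffs[OF uv(1)] by blast
  have x: "x = of_int T + of_int U * s" "cnj x = of_int T - of_int U * s"
    using el_double[of T U] el_double[of T "- U"] uv(2) TU(1,2) cnj_el[of u v] by simp_all
  have "\<bar>x * cnj x\<bar> = 1" using nrm_eq[OF assms(1)] assms(2) by (metis of_int_1 of_int_abs)
  then have "\<bar>cnj x\<bar> = 1 / x" using assms(3) by (simp add: abs_mult field_simps)
  then have c: "\<bar>cnj x\<bar> < 1" using assms(3) by simp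
  have "2 * (of_int T :: real) = x + cnj x" using x by linarith
  then have "(of_int T :: real) > 0" using c assms(3) by linarith
  then have T: "T > 0" by simp
  have "2 * (of_int U * s) = x - cnj x" using x by linarith
  then have "of_int U * s > 0" using c assms(3) by linarith
  then have "U > 0" using s_gt_1 by (simp add: zero_less_mult_iff)
  then show ?thesis using that T uv(2) TU by simp
qed

text \<open>The least unit exists because only finitely many units lie between 1 and a given unit
  \<open>e0\<close> of norm \<open>-1\<close>. If it had norm 1, dividing \<open>e0\<close> by its
  largest power not exceeding \<open>e0\<close> would leave a smaller unit above 1.\<close>

lemma fund_unit_negative_norm:
  assumes "\<exists>t u. t\<^sup>2 - d * u\<^sup>2 = -1"
  obtains T U where "T > 0" "U > 0" "T\<^sup>2 - d * U\<^sup>2 = -1" "fund_unit d = el (2 * T) (2 * U)"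
proof -
  obtain t u where tu: "t\<^sup>2 - d * u\<^sup>2 = -1" using assms by blast
  define e0 where "e0 = el (2 * \<bar>t\<bar>) (2 * \<bar>u\<bar>)"
  have e0R: "e0 \<in> R" by (simp add: e0_def el_in_OK_iff)
  have ne0: "nrm e0 = -1" unfolding e0_def by (rule nrm_el) (use tu in \<open>simp add: power_mult_distrib algebra_simps\<close>)
  have u0: "u \<noteq> 0" using tu zero_le_power2[of t] by (intro notI) simp
  have "t \<noteq> 0"
  proof
    assume "t = 0"
    then have "d dvd 1" using tu by (metis diff_0 dvd_triv_left neg_equal_iff_equal power_zero_numeral)
    then show False using d_gt_1 by simp
  qed
  then have "1 \<le> (of_int \<bar>t\<bar> :: real)" "(of_int \<bar>u\<bar> :: real) * s > 0" using u0 s_gt_1 by auto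
  then have e01: "e0 > 1" unfolding e0_def el_double by linarith
  define Ug where "Ug = {x \<in> R. \<bar>nrm x\<bar> = 1 \<and> x > 1}"
  define N0 where "N0 = \<lfloor>e0\<rfloor>"
  define S where "S = {x \<in> Ug. x \<le> e0}"
  have "S \<subseteq> (\<lambda>(T, U). el (2 * T) (2 * U)) ` ({0..N0} \<times> {0..N0})"
  proof
    fix x assume x: "x \<in> S"
    then have xU: "x \<in> R" "\<bar>nrm x\<bar> = 1" "x > 1" by (auto simp: S_def Ug_def)
    obtain T U where TU: "T > 0" "U > 0" "x = el (2 * T) (2 * U)"
      using unit_gt_1_coeffs[OF xU] by metis
    have xx: "x = of_int T + of_int U * s" using TU(3) el_double by simp
    have "(of_int U :: real) * 1 \<le> of_int U * s" using TU(2) s_gt_1 by (intro mult_left_mono) auto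
    moreover have "x \<le> e0" using x by (simp add: S_def)
    moreover have "(of_int T :: real) > 0" "(of_int U :: real) > 0" using TU(1,2) by simp_all
    ultimately have "of_int T \<le> e0" "of_int U \<le> e0" using xx by linarith+
    then show "x \<in> (\<lambda>(T, U). el (2 * T) (2 * U)) ` ({0..N0} \<times> {0..N0})"
      using TU by (intro image_eqI[of _ _ "(T, U)"]) (auto simp: N0_def le_floor_iff)
  qed
  then have finS: "finite S" by (rule finite_subset) auto
  have "e0 \<in> S" using e0R ne0 e01 by (simp add: S_def Ug_def)
  define \<epsilon> where "\<epsilon> = Min S"
  have "\<epsilon> \<in> S" using finS \<open>e0 \<in> S\<close> Min_in unfolding \<epsilon>_def by blast
  have min: "\<epsilon> \<le> x" if "x \<in> Ug" for x
  proof (cases "x \<le> e0")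
    case True
    then show ?thesis using that finS by (simp add: \<epsilon>_def S_def)
  next
    case False
    then show ?thesis using \<open>\<epsilon> \<in> S\<close> by (simp add: S_def)
  qed
  have \<epsilon>: "\<epsilon> \<in> R" "\<bar>nrm \<epsilon>\<bar> = 1" "\<epsilon> > 1" using \<open>\<epsilon> \<in> S\<close> by (auto simp: S_def Ug_def)
  have fu: "fund_unit d = \<epsilon>" unfolding fund_unit_def
  proof (rule the_equality)
    show "\<epsilon> \<in> units_of_ring R \<and> \<epsilon> > 1 \<and> (\<forall>u\<in>units_of_ring R. u > 1 \<longrightarrow> \<epsilon> \<le> u)"
      using \<epsilon> min by (auto simp: units_iff Ug_def)
    fix e assume "e \<in> units_of_ring R \<and> e > 1 \<and> (\<forall>u\<in>units_of_ring R. u > 1 \<longrightarrow> e \<le> u)"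
    then show "e = \<epsilon>" using \<epsilon> min[of e] by (auto simp: units_iff Ug_def intro!: antisym)
  qed
  have "nrm \<epsilon> = -1"
  proof (rule ccontr)
    assume "nrm \<epsilon> \<noteq> -1"
    then have n1: "nrm \<epsilon> = 1" using \<epsilon>(2) by linarith
    have inv: "\<epsilon> * cnj \<epsilon> = 1" using nrm_eq[OF \<epsilon>(1)] n1 by simp
    \<comment> \<open>This is the first exponent past \<open>e0\<close>; its predecessor
      \<open>k\<close> is the last with \<open>\<epsilon>^k <= e0\<close>.\<close>
    define n where "n = (LEAST n. e0 < \<epsilon> ^ n)"
    have "\<exists>n. e0 < \<epsilon> ^ n" using real_arch_pow[OF \<epsilon>(3)] by blast
    then have n: "e0 < \<epsilon> ^ n" unfolding n_def by (rule LeastI_ex)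
    then have "n \<noteq> 0" using e01 by (metis less_asym power_0)
    then obtain k where k: "n = Suc k" using not0_implies_Suc by blast
    have ek: "\<epsilon> ^ k \<le> e0" using not_less_Least[of k "\<lambda>n. e0 < \<epsilon> ^ n"] k by (simp add: n_def)
    \<comment> \<open>Under the assumption that \<open>\<epsilon>\<close> has norm 1, its conjugate
      is its inverse, so this is \<open>e0 / \<epsilon>^k\<close>, a unit of norm \<open>-1\<close>
      in the interval from 1 to \<open>\<epsilon>\<close>.\<close>
    define \<eta> where "\<eta> = e0 * (cnj \<epsilon>) ^ k"
    have invk: "\<epsilon> ^ k * (cnj \<epsilon>) ^ k = 1" using inv by (metis power_mult_distrib power_one)
    have ck: "(cnj \<epsilon>) ^ k > 0" using inv \<epsilon>(3) by (metis mult_zero_left zero_less_mult_pos zero_less_one zero_less_power order_less_trans)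
    have \<eta>R: "\<eta> \<in> R" using e0R \<epsilon>(1) by (simp add: \<eta>_def mult_R power_R cnj_R)
    have nk: "nrm (x ^ k) = nrm x ^ k" if "x \<in> R" for x
      using that nrm_of_int[of 1] by (induction k) (auto simp: nrm_mult power_R)
    have n\<eta>: "nrm \<eta> = -1"
      using e0R \<epsilon>(1) by (simp add: \<eta>_def nrm_mult power_R cnj_R nk nrm_cnj n1 ne0)
    have "\<epsilon> ^ k * (cnj \<epsilon>) ^ k \<le> \<eta>" unfolding \<eta>_def using ek ck by (intro mult_right_mono) auto
    then have "1 \<le> \<eta>" using invk by simp
    moreover have "\<eta> < \<epsilon> ^ n * (cnj \<epsilon>) ^ k" unfolding \<eta>_def using n ck by simp
    then have "\<eta> < \<epsilon>" using invk k by (simp add: mult.assoc)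
    moreover have "\<eta> \<noteq> 1" using n\<eta> nrm_of_int[of 1] by auto
    ultimately show False using min[of \<eta>] \<eta>R n\<eta> by (simp add: Ug_def)
  qed
  then show ?thesis using unit_gt_1_coeffs[OF \<epsilon>] that fu by metis
qed

end

section \<open>Ambiguous ideals and genus characters\<close>

context real_quad
begin

text \<open>The conjugate of \<open>k (b + s) / 2\<close> has second coordinate \<open>- k\<close>;
  being in the lattice, it differs from the negative of that element by a multiple of
  \<open>k a\<close>, so \<open>a\<close> divides \<open>b\<close> and then
  \<open>d\<close>.\<close>

lemma ambiguous_basis:
  assumes "nzi I" "cI I = I"
  obtains k a b where "k > 0" "a > 0" "4 * a dvd b\<^sup>2 - d" "I = bas k a b" "a dvd b" "a dvd d"
proof -
  obtain k a b where kab: "k > 0" "a > 0" "4 * a dvd b\<^sup>2 - d" "I = bas k a b" by (rule basis_exists[OF assms(1)])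
  have "el (k * b) k \<in> I" using bas_mem[of k a 0 b 1] kab(4) by simp
  then have "el (k * b) (- k) \<in> I" using assms(2) cnj_el[of "k * b" k] by (metis cI_def image_eqI)
  then obtain u v where "el (k * b) (- k) = el (k * (2 * a * u + b * v)) (k * v)" using kab(4) by (auto simp: bas_def)
  then have uv: "b = 2 * a * u + b * v" "- k = k * v" using kab(1) by (auto simp: el_eq_iff)
  have "k * (v + 1) = 0" using uv(2) by (simp add: distrib_left)
  then have "v = -1" using kab(1) by simp
  then have "b = a * u" using uv(1) by simp
  then have ab: "a dvd b" by simp
  have "a dvd b\<^sup>2 - d" using kab(3) by (metis dvd_mult_right)
  moreover have "a dvd b\<^sup>2" using ab by (simp add: power2_eq_square)
  ultimately have "a dvd d" by (metis dvd_diff_right_iff)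
  then show ?thesis using that kab ab by blast
qed

text \<open>If \<open>k^2 a\<close> is a square, so is \<open>a\<close>; as a divisor of the
  squarefree \<open>d\<close> it equals 1.\<close>

lemma ambiguous_square_norm:
  assumes "nzi I" "cI I = I" "idn I = n\<^sup>2"
  obtains t where "t > 0" "I = pr (of_int t)"
proof -
  obtain k a b where kab: "k > 0" "a > 0" "4 * a dvd b\<^sup>2 - d" "I = bas k a b" "a dvd b" "a dvd d"
    by (rule ambiguous_basis[OF assms(1,2)])
  have ka: "k\<^sup>2 * a = n\<^sup>2" using idn_bas[OF kab(1-3)] kab(4) assms(3) by simp
  then have "k\<^sup>2 dvd n\<^sup>2" by (metis dvd_triv_left)
  then have "k dvd n" by simp
  then obtain m where "n = k * m" by (auto simp: dvd_def)
  then have "a = m\<^sup>2" using ka kab(1) by (simp add: power_mult_distrib)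
  then have "a = 1" using square_dvd_d kab(6) by (metis one_power2 power2_abs)
  then have b: "4 * 1 dvd b\<^sup>2 - d" "I = bas k 1 b" using kab by simp_all
  have "bas 1 1 b = R" using idn_1[OF nzi_bas[OF _ b(1), of 1]] idn_bas[OF _ _ b(1), of 1] by simp
  then have "I = pr (of_int k)" using bas_scale[OF b(1), of k] b(2) imul_R idl_pr of_int_R by simp
  then show ?thesis using that kab(1) by blast
qed

definition isum :: "real set \<Rightarrow> real set \<Rightarrow> real set" where
  "isum I J = {x + y |x y. x \<in> I \<and> y \<in> J}"

lemma idl_isum:
  assumes "idl I" "idl J" shows "idl (isum I J)"
  unfolding is_ideal_def
proof (intro conjI ballI)
  show "isum I J \<subseteq> R" using assms idl_in_R add_R by (auto simp: isum_def)
  show "0 \<in> isum I J" using idlD(2)[OF assms(1)] idlD(2)[OF assms(2)] by (force simp: isum_def)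
  show "x + y \<in> isum I J" if xy: "x \<in> isum I J" "y \<in> isum I J" for x y
  proof -
    obtain a b a' b' where *: "a \<in> I" "b \<in> J" "x = a + b" "a' \<in> I" "b' \<in> J" "y = a' + b'"
      using xy by (auto simp: isum_def)
    then have "x + y = (a + a') + (b + b')" by simp
    then show ?thesis using * idlD(3)[OF assms(1)] idlD(3)[OF assms(2)] unfolding isum_def by blast
  qed
  show "r * x \<in> isum I J" if rx: "r \<in> R" "x \<in> isum I J" for r x
  proof -
    obtain a b where *: "a \<in> I" "b \<in> J" "x = a + b" using rx by (auto simp: isum_def)
    then have "r * x = r * a + r * b" by (simp add: distrib_left)
    then show ?thesis using * rx(1) idlD(4)[OF assms(1)] idlD(4)[OF assms(2)] unfolding isum_def by blast
  qed
qed

lemma isum_memI: "x \<in> I \<Longrightarrow> y \<in> J \<Longrightarrow> x + y \<in> isum I J"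
  by (auto simp: isum_def)

lemma isum_superset: "idl I \<Longrightarrow> idl J \<Longrightarrow> I \<subseteq> isum I J" "idl I \<Longrightarrow> idl J \<Longrightarrow> J \<subseteq> isum I J"
  using isum_memI[of _ I 0 J] isum_memI[of 0 I _ J] idlD(2) by auto

lemma cI_isum: "idl I \<Longrightarrow> idl J \<Longrightarrow> cI (isum I J) = isum (cI I) (cI J)"
proof -
  assume IJ: "idl I" "idl J"
  have e: "cnj (x + y) = cnj x + cnj y" if "x \<in> I" "y \<in> J" for x y
    using that IJ[THEN idl_in_R] cnj_add by blast
  show ?thesis
  proof (intro equalityI subsetI)
    fix z assume "z \<in> cI (isum I J)"
    then obtain x y where "x \<in> I" "y \<in> J" "z = cnj (x + y)" by (auto simp: cI_def isum_def)
    then show "z \<in> isum (cI I) (cI J)" using e isum_memI[of "cnj x" "cI I" "cnj y" "cI J"] by (simp add: cI_def)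
  next
    fix z assume "z \<in> isum (cI I) (cI J)"
    then obtain x y where xy: "x \<in> I" "y \<in> J" "z = cnj x + cnj y" by (auto simp: cI_def isum_def)
    then have "z = cnj (x + y)" using e by simp
    then show "z \<in> cI (isum I J)" using isum_memI[OF xy(1,2)] by (simp add: cI_def)
  qed
qed

lemma isum_comm: "isum I J = isum J I"
  by (auto simp: isum_def) (metis add.commute)+

text \<open>For coprime \<open>K\<close> and its conjugate, \<open>M\<close> is a square root of \<open>K\<close>; in general the defect
  \<open>K + K' + (k)\<close> is an ambiguous ideal of square norm, hence generated by an integer.\<close>

lemma square_norm_imp_square:
  assumes "nzi K" "k > 0" "idn K = k\<^sup>2"
  obtains M t where "nzi M" "t > 0" "K \<star> pr (of_int t) = M \<star> M" "idn M = k * t"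
    "of_int k \<in> M" "K \<subseteq> pr (of_int t)"
proof -
  define \<kappa> where "\<kappa> = (of_int k :: real)"
  have \<kappa>: "\<kappa> \<in> R" "cnj \<kappa> = \<kappa>" "\<kappa> \<noteq> 0" using of_int_R cnj_of_int assms(2) by (auto simp: \<kappa>_def)
  have K: "idl K" "idl (cI K)" using assms(1) nzi_idl idl_cI by blast+
  have P: "idl (pr \<kappa>)" using idl_pr \<kappa> by blast
  define M where "M = isum K (pr \<kappa>)"
  define A where "A = isum (isum K (cI K)) (pr \<kappa>)"
  have M: "idl M" unfolding M_def using idl_isum K P by blast
  have S: "idl (isum K (cI K))" using idl_isum K by blast
  have A: "idl A" unfolding A_def using idl_isum S P by blast
  have KM: "K \<subseteq> M" "pr \<kappa> \<subseteq> M" unfolding M_def using isum_superset K P by blast+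
  have KA: "K \<subseteq> A" "cI K \<subseteq> A" "pr \<kappa> \<subseteq> A"
    unfolding A_def using isum_superset[OF S P] isum_superset[OF K] by blast+
  have kM: "\<kappa> \<in> M" using KM pr_self by blast
  have nM: "nzi M" using M kM \<kappa> by (auto simp: nzi_def)
  have nA: "nzi A" using A KA(3) pr_self[of \<kappa>] \<kappa>(3) by (auto simp: nzi_def)
  have kk: "K \<star> cI K = pr (\<kappa> * \<kappa>)" using idn_props(2)[OF assms(1)] assms(3) by (simp add: \<kappa>_def power2_eq_square)
  have KKA: "idl (K \<star> A)" "idl (M \<star> M)" using idl_imul K A M by blast+
  \<comment> \<open>Expanding gives \<open>M^2 = K^2 + k K + (k^2)\<close>, and \<open>(k^2)\<close>
    is the product of \<open>K\<close> with its conjugate. Thus \<open>K\<close> factors out and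
    leaves \<open>A\<close>.\<close>
  have "K \<star> A = M \<star> M"
  proof
    show "M \<star> M \<subseteq> K \<star> A"
    proof (rule imul_least[OF KKA(1)])
      fix x y assume "x \<in> M" "y \<in> M"
      then obtain a r b q where ab: "a \<in> K" "r \<in> R" "x = a + r * \<kappa>" "b \<in> K" "q \<in> R" "y = b + q * \<kappa>"
        unfolding M_def isum_def pr_iff by blast
      have "a * b \<in> K \<star> A" using imul_mem ab KA by blast
      moreover have "(a * q + b * r) * \<kappa> \<in> K \<star> A"
        using imul_mem[of "a * q + b * r" K \<kappa> A] ab KA(3) pr_self idlD(3,5)[OF K(1)] by blast
      moreover have "K \<star> cI K \<subseteq> K \<star> A" using imul_mono K A KA by blast
      then have "(r * q) * (\<kappa> * \<kappa>) \<in> K \<star> A" using kk ab mult_R pr_iff by blast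
      ultimately have "a * b + (a * q + b * r) * \<kappa> + (r * q) * (\<kappa> * \<kappa>) \<in> K \<star> A"
        using idlD(3)[OF KKA(1)] by blast
      also have "a * b + (a * q + b * r) * \<kappa> + (r * q) * (\<kappa> * \<kappa>) = x * y"
        unfolding ab(3,6) by (simp add: algebra_simps)
      finally show "x * y \<in> K \<star> A" .
    qed
    show "K \<star> A \<subseteq> M \<star> M"
    proof (rule imul_least[OF KKA(2)])
      fix x y assume x: "x \<in> K" and "y \<in> A"
      then obtain a b r where ab: "a \<in> K" "b \<in> cI K" "r \<in> R" "y = a + b + r * \<kappa>"
        unfolding A_def isum_def pr_iff by blast
      have "x * a \<in> M \<star> M" "(x * r) * \<kappa> \<in> M \<star> M"
        using imul_mem[of _ M _ M] KM x ab idlD(5)[OF K(1)] kM by blast+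
      moreover have "x * b \<in> pr (\<kappa> * \<kappa>)" using imul_mem[OF x ab(2)] kk by simp
      then have "x * b \<in> M \<star> M" using pr_subset[OF KKA(2) imul_mem[OF kM kM]] by blast
      ultimately have "x * a + x * b + (x * r) * \<kappa> \<in> M \<star> M" using idlD(3)[OF KKA(2)] by blast
      then show "x * y \<in> M \<star> M" unfolding ab(4) by (simp add: distrib_left mult.assoc)
    qed
  qed
  have cA: "cI A = A" unfolding A_def using K P \<kappa> by (simp add: cI_isum idl_isum cI_cI cI_pr isum_comm[of K "cI K"])
  have id: "idn M * idn M = k\<^sup>2 * idn A"
    using \<open>K \<star> A = M \<star> M\<close> idn_imul[OF nM nM] idn_imul[OF assms(1) nA] assms(3) by simp
  then have "k\<^sup>2 dvd (idn M)\<^sup>2" by (simp add: power2_eq_square)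
  then have "k dvd idn M" by simp
  then obtain m where m: "idn M = k * m" by (auto simp: dvd_def)
  have "idn A = m\<^sup>2" using id assms(2) unfolding m by (simp add: power2_eq_square)
  then obtain t where t: "t > 0" "A = pr (of_int t)" using ambiguous_square_norm[OF nA cA] by blast
  have "m\<^sup>2 = t\<^sup>2" using idn_of_int[OF t(1)] t(2) \<open>idn A = m\<^sup>2\<close> by simp
  moreover have "m > 0" using m assms(2) idn_props(1)[OF nM] by (simp add: zero_less_mult_iff)
  ultimately have "m = t" using t(1) by (simp add: power2_eq_iff)
  then show ?thesis using that[OF nM t(1)] \<open>K \<star> A = M \<star> M\<close> t(2) m kM KA(1) by (simp add: \<kappa>_def)
qed

text \<open>Hilbert 90: \<open>\<gamma> / n\<close> has norm \<open>1\<close>, and \<open>\<gamma> / n = (\<gamma> + n) / (\<gamma> + n)'\<close>.\<close>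

lemma square_principal_imp_ambiguous:
  assumes "nzi C" "\<gamma> \<in> R" "C \<star> C = pr \<gamma>" "nrm \<gamma> > 0"
  obtains \<delta> where "\<delta> \<in> R" "\<delta> \<noteq> 0" "cI (pr \<delta> \<star> C) = pr \<delta> \<star> C"
proof -
  have C: "idl C" "idl (cI C)" using assms(1) nzi_idl idl_cI by blast+
  define n where "n = (of_int (idn C) :: real)"
  have n: "n \<in> R" "n > 0" "cnj n = n" using of_int_R idn_props(1)[OF assms(1)] cnj_of_int by (auto simp: n_def)
  have "\<gamma> \<noteq> 0" using assms(4) nrm_of_int[of 0] by auto
  then have "nrm \<gamma> = (idn C)\<^sup>2"
    using idn_imul[OF assms(1,1)] idn_pr[OF assms(2)] assms(3,4) by (simp add: power2_eq_square)
  then have \<gamma>: "\<gamma> * cnj \<gamma> = n * n" using nrm_eq[OF assms(2)] by (simp add: n_def power2_eq_square)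
  have CC: "C \<star> cI C = pr n" using idn_props(2)[OF assms(1)] by (simp add: n_def)
  define \<delta>0 where "\<delta>0 = \<gamma> + n"
  have \<delta>0R: "\<delta>0 \<in> R" "cnj \<delta>0 \<in> R" using assms(2) n add_R cnj_R by (auto simp: \<delta>0_def)
  show ?thesis
  proof (cases "\<delta>0 = 0")
    \<comment> \<open>For \<open>\<gamma> = - n\<close> the multiplier vanishes; but then
      \<open>C^2\<close> is the product of \<open>C\<close> with its conjugate, so \<open>C\<close>
      is already ambiguous.\<close>
    case True
    then have "\<gamma> = - n" by (simp add: \<delta>0_def)
    then have "C \<star> C = C \<star> cI C" using assms(3) CC pr_uminus[OF n(1)] by simp
    then have "C = cI C" using imul_cancel[OF assms(1)] C by blast
    then show ?thesis using that[of 1] one_R C pr_1 R_imul by simp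
  next
    case False
    have c: "cnj \<delta>0 * \<gamma> = \<delta>0 * n"
      using \<gamma> assms(2) n by (simp add: \<delta>0_def cnj_add algebra_simps)
    have "C \<star> (pr (cnj \<delta>0) \<star> C) = pr (cnj \<delta>0) \<star> (C \<star> C)"
      using C \<delta>0R by (simp add: imul_left_comm idl_pr)
    also have "\<dots> = pr \<delta>0 \<star> (C \<star> cI C)"
      unfolding assms(3) CC using \<delta>0R assms(2) n c by (simp add: pr_imul_pr)
    also have "\<dots> = C \<star> (pr \<delta>0 \<star> cI C)" using C \<delta>0R by (simp add: imul_left_comm idl_pr)
    finally have "pr (cnj \<delta>0) \<star> C = pr \<delta>0 \<star> cI C"
      using imul_cancel[OF assms(1)] C \<delta>0R idl_imul idl_pr by blast
    moreover have "cI (pr (cnj \<delta>0) \<star> C) = pr \<delta>0 \<star> cI C"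
      using C \<delta>0R by (simp add: cI_imul idl_pr cI_pr cnj_cnj)
    ultimately have "cI (pr (cnj \<delta>0) \<star> C) = pr (cnj \<delta>0) \<star> C" by simp
    then show ?thesis using that[of "cnj \<delta>0"] \<delta>0R False cnj_eq_0 by simp
  qed
qed

lemma sqrt_mem_ambiguous: "a dvd b \<Longrightarrow> el 0 2 \<in> bas 1 a b"
proof -
  assume "a dvd b"
  then obtain c where "b = a * c" by (auto simp: dvd_def)
  then show ?thesis using bas_mem[of 1 a "- c" b 2] by (simp add: algebra_simps)
qed

lemma nrm_sqrt: "nrm (el 0 2) = - d"
  by (rule nrm_el) simp

text \<open>A unit of norm \<open>-1\<close> makes the generator of the square of norm positive, so
  Hilbert 90 applies. In the resulting ambiguous lattice \<open>a\<close> divides the prime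
  \<open>d\<close>: for \<open>a = 1\<close> the lattice is a multiple of \<open>R\<close>, for
  \<open>a = d\<close> a multiple of \<open>(s)\<close>, and both are principal.\<close>

lemma odd_class_number_if_prime:
  assumes "prime d" "\<exists>t u. t\<^sup>2 - d * u\<^sup>2 = -1"
  shows "odd (class_number R)"
proof (rule odd_class_number)
  fix I assume I: "nzi I" "eqv (I \<star> I) R"
  obtain \<gamma>0 where g0: "\<gamma>0 \<in> R" "\<gamma>0 \<noteq> 0" "I \<star> I = pr \<gamma>0" using eqv_R_imp_pr[OF I(2)] .
  obtain t u where tu: "t\<^sup>2 - d * u\<^sup>2 = -1" using assms(2) by blast
  define \<epsilon> where "\<epsilon> = el (2 * t) (2 * u)"
  have \<epsilon>: "\<epsilon> \<in> R" "nrm \<epsilon> = -1"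
    unfolding \<epsilon>_def by (simp add: el_in_OK_iff) (rule nrm_el, use tu in \<open>simp add: power_mult_distrib algebra_simps\<close>)
  have "pr \<epsilon> = R" using \<epsilon> idn_1[OF nzi_pr[OF \<epsilon>(1)]] idn_pr[OF \<epsilon>(1)] nrm_of_int[of 0] by fastforce
  then have "pr (\<epsilon> * \<gamma>0) = pr \<gamma>0" using pr_imul_pr[OF \<epsilon>(1) g0(1)] R_imul idl_pr g0(1) by simp
  moreover have "nrm (\<epsilon> * \<gamma>0) = - nrm \<gamma>0" using nrm_mult \<epsilon> g0 by simp
  moreover have "nrm \<gamma>0 \<noteq> 0" using nrm_eq_0 g0 by simp
  ultimately obtain \<gamma> where g: "\<gamma> \<in> R" "I \<star> I = pr \<gamma>" "nrm \<gamma> > 0"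
    using g0 \<epsilon>(1) mult_R by (metis linorder_neqE_linordered_idom neg_0_less_iff_less)
  obtain \<delta> where \<delta>: "\<delta> \<in> R" "\<delta> \<noteq> 0" "cI (pr \<delta> \<star> I) = pr \<delta> \<star> I"
    by (rule square_principal_imp_ambiguous[OF I(1) g])
  have nd: "nzi (pr \<delta> \<star> I)" using nzi_imul nzi_pr \<delta> I by blast
  obtain k a b where kab: "k > 0" "a > 0" "4 * a dvd b\<^sup>2 - d" "pr \<delta> \<star> I = bas k a b" "a dvd b" "a dvd d"
    by (rule ambiguous_basis[OF nd \<delta>(3)])
  have nb: "nzi (bas 1 a b)" using nzi_bas kab(3) by simp
  have "a = 1 \<or> a = d" using kab(2,6) assms(1) by (metis prime_int_iff less_imp_le)
  then have "eqv (bas 1 a b) R"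
  proof
    assume "a = 1"
    then have "bas 1 a b = R" using idn_1[OF nb] idn_bas[OF _ kab(2,3), of 1] by simp
    then show ?thesis using eqv_refl nzi_R by simp
  next
    assume a: "a = d"
    have sR: "el 0 2 \<in> R" "el 0 2 \<noteq> 0" by (simp add: el_in_OK_iff) (use el_eq_iff[of 0 2 0 0] in \<open>simp add: el_def\<close>)
    have "pr (el 0 2) = bas 1 a b"
    proof (rule subset_idn_eq[OF nzi_pr[OF sR] nb])
      show "pr (el 0 2) \<subseteq> bas 1 a b" using pr_subset sqrt_mem_ambiguous[OF kab(5)] nb nzi_idl by blast
      show "idn (pr (el 0 2)) = idn (bas 1 a b)"
        using idn_pr[OF sR] idn_bas[OF _ kab(2,3), of 1] a d_gt_1 by (simp add: nrm_sqrt)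
    qed
    then show ?thesis using eqv_pr_R[OF sR] by simp
  qed
  moreover have "eqv (pr \<delta> \<star> I) (bas 1 a b)"
    unfolding kab(4) bas_scale[OF kab(3), of k] using nb of_int_R kab(1) by (intro eqv_mult_pr) auto
  moreover have "eqv (pr \<delta> \<star> I) I" using eqv_mult_pr \<delta> I by blast
  ultimately show "eqv I R" using eqv_sym eqv_trans by blast
qed

text \<open>The numbers \<open>nrm x / idn I\<close> are the values of the binary quadratic form
  attached to \<open>I\<close>; the division is cleared.\<close>

definition val :: "real set \<Rightarrow> int \<Rightarrow> bool" where
  "val I v \<longleftrightarrow> (\<exists>x\<in>I. nrm x = v * idn I)"

lemma val_mult: "nzi I \<Longrightarrow> nzi J \<Longrightarrow> val I v \<Longrightarrow> val J w \<Longrightarrow> val (I \<star> J) (v * w)"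
proof -
  assume *: "nzi I" "nzi J" "val I v" "val J w"
  obtain x y where xy: "x \<in> I" "nrm x = v * idn I" "y \<in> J" "nrm y = w * idn J" using *(3,4) by (auto simp: val_def)
  have "x \<in> R" "y \<in> R" using xy(1,3) *(1,2) idl_in_R nzi_idl by blast+
  then have "nrm (x * y) = v * w * idn (I \<star> J)"
    using xy(2,4) idn_imul[OF *(1,2)] by (simp add: nrm_mult)
  then show ?thesis using imul_mem[OF xy(1,3)] by (auto simp: val_def)
qed

text \<open>The factor relating equivalent ideals may have negative norm, since equivalence is meant
  in the wide sense. Hence values are preserved only up to a common sign.\<close>

lemma val_eqv:
  assumes "eqv I J" "val I v"
  shows "val J v \<or> val J (- v)"
proof -
  obtain a b where ab: "a \<in> R" "b \<in> R" "a \<noteq> 0" "b \<noteq> 0" "pr a \<star> I = pr b \<star> J"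
    using assms(1) by (auto simp: eqv_iff)
  have n: "nzi I" "nzi J" using assms(1) eqv_nzi by blast+
  obtain x where x: "x \<in> I" "nrm x = v * idn I" using assms(2) by (auto simp: val_def)
  have "a * x \<in> pr b \<star> J" using imul_mem[OF pr_self x(1), of a] ab(5) by simp
  then obtain y where y: "y \<in> J" "a * x = b * y" using pr_imul[OF nzi_idl[OF n(2)] ab(2)] by auto
  have R: "x \<in> R" "y \<in> R" using x y n nzi_idl idl_in_R by blast+
  have na: "nrm a \<noteq> 0" "nrm b \<noteq> 0" using nrm_eq_0 ab by auto
  have 1: "nrm a * nrm x = nrm b * nrm y" using nrm_mult ab R y(2) by metis
  have 2: "\<bar>nrm a\<bar> * idn I = \<bar>nrm b\<bar> * idn J"
    using idn_imul[OF nzi_pr n(1), of a] idn_imul[OF nzi_pr n(2), of b] idn_pr ab by simp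
  have "nrm b * nrm y = v * (nrm a * idn I)" using 1 x(2) by (simp add: mult_ac)
  moreover have "nrm a * idn I = nrm b * idn J \<or> nrm a * idn I = - (nrm b * idn J)"
    using 2 by (auto simp: abs_if split: if_splits)
  ultimately have "nrm b * nrm y = nrm b * (v * idn J) \<or> nrm b * nrm y = nrm b * (- v * idn J)"
    by (auto simp: mult_ac)
  then have "nrm y = v * idn J \<or> nrm y = - v * idn J" using na(2) by (metis mult_cancel_left)
  then show ?thesis using y(1) by (auto simp: val_def)
qed

text \<open>For \<open>x\<close>, \<open>y\<close> in \<open>I\<close>, the number
  \<open>x * cnj y\<close> is \<open>idn I\<close> times an integer \<open>\<eta>\<close> of norm
  \<open>v * w\<close>. As \<open>q\<close> divides \<open>d\<close>, four times this norm is a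
  square modulo \<open>q\<close>.\<close>

lemma val_Legendre_unique:
  assumes "nzi I" "val I v" "val I w" "prime q" "2 < q" "int q dvd d" "\<not> int q dvd v" "\<not> int q dvd w"
  shows "Legendre v (int q) = Legendre w (int q)"
proof -
  obtain x y where xy: "x \<in> I" "nrm x = v * idn I" "y \<in> I" "nrm y = w * idn I" using assms(2,3) by (auto simp: val_def)
  have R: "x \<in> R" "y \<in> R" using xy assms(1) nzi_idl idl_in_R by blast+
  have "x * cnj y \<in> I \<star> cI I" using xy by (intro imul_mem) (auto simp: cI_def)
  then obtain \<eta> where \<eta>: "\<eta> \<in> R" "x * cnj y = \<eta> * of_int (idn I)" using idn_props(2)[OF assms(1)] pr_iff by metis
  have "nrm x * nrm y = nrm \<eta> * (idn I)\<^sup>2"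
    using nrm_mult[OF R(1) cnj_R[OF R(2)]] nrm_mult[OF \<eta>(1) of_int_R] \<eta>(2) nrm_cnj[OF R(2)] nrm_of_int by simp
  then have "(v * w) * (idn I)\<^sup>2 = nrm \<eta> * (idn I)\<^sup>2" by (simp add: xy power2_eq_square mult_ac)
  then have vw: "v * w = nrm \<eta>" using idn_props(1)[OF assms(1)] by simp
  obtain e f where ef: "even (e - f)" "\<eta> = el e f" using OK_imp_el[OF \<eta>(1)] by blast
  have "4 * (v * w) = e\<^sup>2 - d * f\<^sup>2" using nrm_el_eq[OF ef(1)] vw ef(2) by simp
  then have "(2\<^sup>2 * v) * w - e\<^sup>2 = - (d * f\<^sup>2)" by simp
  then have "int q dvd (2\<^sup>2 * v) * w - e\<^sup>2" using assms(6) by simp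
  then have cong: "[(2\<^sup>2 * v) * w = e\<^sup>2] (mod int q)" by (simp add: cong_iff_dvd_diff)
  have q2: "\<not> int q dvd 2" using assms(5) zdvd_not_zless by auto
  have pq: "prime (int q)" using assms(4) by simp
  have "\<not> int q dvd (2\<^sup>2 * v) * w"
    using q2 assms(7,8) pq by (simp only: prime_dvd_mult_iff prime_dvd_power_iff pos2 de_Morgan_disj) simp
  then have "Legendre (2\<^sup>2 * v) (int q) = Legendre w (int q)"
    using Legendre_eq_if_mult_square[OF assms(4,5) cong] by blast
  moreover have "Legendre (2\<^sup>2 * v) (int q) = Legendre v (int q)"
    using Legendre_mult[OF assms(4,5)] Legendre_square[OF q2 assms(4)] by simp
  ultimately show ?thesis by simp
qed

text \<open>The attached form has coefficients \<open>a\<close>, \<open>b\<close>, \<open>c\<close>;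
  its values at \<open>(1,0)\<close>, \<open>(0,1)\<close> and \<open>(1,1)\<close> are enough to
  find one prime to \<open>p q\<close> later.\<close>

lemma primitive_values:
  assumes "nzi I"
  obtains a b c where "a > 0" "b\<^sup>2 - d = 4 * a * c" "val I a" "val I c" "val I (a + b + c)"
proof -
  obtain k a b where kab: "k > 0" "a > 0" "4 * a dvd b\<^sup>2 - d" "I = bas k a b" by (rule basis_exists[OF assms])
  obtain c where c: "b\<^sup>2 - d = 4 * a * c" using kab(3) by (auto simp: dvd_def)
  have id: "idn I = k\<^sup>2 * a" using idn_bas[OF kab(1-3)] kab(4) by simp
  have d: "d = b\<^sup>2 - 4 * a * c" using c by simp
  have "nrm (el (k * (2 * a * u + b * v)) (k * v)) = (a * u\<^sup>2 + b * u * v + c * v\<^sup>2) * idn I" for u v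
    unfolding id by (rule nrm_el) (simp add: d power2_eq_square algebra_simps)
  then have v: "val I (a * u\<^sup>2 + b * u * v + c * v\<^sup>2)" for u v
    using bas_mem kab(4) unfolding val_def by blast
  show ?thesis using that[OF kab(2) c] v[of 1 0] v[of 0 1] v[of 1 1] by (simp add: add_ac)
qed

end

section \<open>Pigeonhole arguments\<close>

lemma int_sqrt_exists:
  assumes "n \<ge> (0::int)"
  obtains r where "r \<ge> 0" "r\<^sup>2 \<le> n" "n < (r + 1)\<^sup>2"
proof -
  have "\<exists>r\<ge>0. r\<^sup>2 \<le> n \<and> n < (r + 1)\<^sup>2"
    using assms
  proof (induction n rule: int_ge_induct)
    case base
    show ?case by (rule exI[of _ 0]) simp
  next
    case (step n)
    then obtain r where r: "r \<ge> 0" "r\<^sup>2 \<le> n" "n < (r + 1)\<^sup>2" by blast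
    show ?case
    proof (cases "n + 1 < (r + 1)\<^sup>2")
      case True
      then show ?thesis using r by (intro exI[of _ r]) auto
    next
      case False
      then have "n + 1 = (r + 1)\<^sup>2" using r by simp
      moreover have "(r + 1)\<^sup>2 < (r + 1 + 1)\<^sup>2" using r(1) by (intro power_strict_mono) auto
      ultimately show ?thesis using r(1) by (intro exI[of _ "r + 1"]) auto
    qed
  qed
  then show ?thesis using that by blast
qed

lemma square_le_if_abs_le: "\<bar>x\<bar> \<le> (r::int) \<Longrightarrow> x\<^sup>2 \<le> r\<^sup>2"
  by (metis abs_ge_zero power2_abs power_mono)

lemma thue:
  fixes n r :: int
  assumes "n > 0"
  obtains x y where "n dvd x - r * y" "(x, y) \<noteq> (0, 0)" "x\<^sup>2 \<le> n" "y\<^sup>2 \<le> n"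
proof -
  obtain k where k: "k \<ge> 0" "k\<^sup>2 \<le> n" "n < (k + 1)\<^sup>2" using int_sqrt_exists[of n] assms by auto
  define A where "A = {0..k} \<times> {0..k}"
  define f where "f = (\<lambda>(x, y). (x - r * y) mod n)"
  have "card A = nat ((k + 1)\<^sup>2)" using k(1) by (simp add: A_def card_cartesian_product power2_eq_square nat_mult_distrib)
  moreover have "f ` A \<subseteq> {0..<n}" using assms by (auto simp: f_def)
  then have "card (f ` A) \<le> nat n" using card_mono[of "{0..<n}" "f ` A"] by simp
  moreover have "nat n < nat ((k + 1)\<^sup>2)" using k(1,3) assms by (subst nat_less_eq_zless) auto
  ultimately have "\<not> inj_on f A" using pigeonhole[of f A] by linarith
  then obtain a b where ab: "a \<in> A" "b \<in> A" "a \<noteq> b" "f a = f b" unfolding inj_on_def by blast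
  obtain x1 y1 x2 y2 where xy: "a = (x1, y1)" "b = (x2, y2)" by (metis surj_pair)
  have "n dvd (x1 - r * y1) - (x2 - r * y2)" using ab(4) by (simp add: f_def xy mod_eq_dvd_iff)
  then have "n dvd (x1 - x2) - r * (y1 - y2)" by (simp add: algebra_simps)
  moreover have "(x1 - x2, y1 - y2) \<noteq> (0, 0)" using ab(3) xy by auto
  moreover have "\<bar>x1 - x2\<bar> \<le> k" "\<bar>y1 - y2\<bar> \<le> k" using ab(1,2) by (auto simp: A_def xy)
  then have "(x1 - x2)\<^sup>2 \<le> n" "(y1 - y2)\<^sup>2 \<le> n" using square_le_if_abs_le k(2) by (meson order_trans)+
  ultimately show ?thesis using that by blast
qed

lemma prime_int_not_square: "prime (q::nat) \<Longrightarrow> x\<^sup>2 \<noteq> int q"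
proof
  assume q: "prime q" "x\<^sup>2 = int q"
  then have "int ((nat \<bar>x\<bar>)\<^sup>2) = int q" by simp
  then have "q = (nat \<bar>x\<bar>)\<^sup>2" by (simp only: of_nat_eq_iff)
  then show False using q(1) prime_power_iff[of "nat \<bar>x\<bar>" 2] by simp
qed

lemma thue_prime:
  fixes q :: nat and r :: int
  assumes "prime q"
  obtains x y where "int q dvd x - r * y" "x \<noteq> 0 \<or> y \<noteq> 0" "x\<^sup>2 < int q" "y\<^sup>2 < int q"
proof -
  have "int q > 0" using assms prime_gt_0_nat by simp
  then obtain x y where "int q dvd x - r * y" "(x, y) \<noteq> (0, 0)" "x\<^sup>2 \<le> int q" "y\<^sup>2 \<le> int q"
    using thue by blast
  then show ?thesis using that prime_int_not_square[OF assms] by (metis order_less_le)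
qed

text \<open>Thue's lemma with a square root of \<open>-1\<close> makes \<open>x^2 + y^2\<close> a
  multiple of \<open>q\<close> strictly between 0 and \<open>2 q\<close>.\<close>

lemma sum_two_squares:
  fixes q :: nat
  assumes "prime q" "q mod 8 = 1"
  obtains f k where "f\<^sup>2 + k\<^sup>2 = int q"
proof -
  obtain r where r: "[r\<^sup>2 = -1] (mod int q)"
    using Legendre_eq_1_imp_square[OF Legendre_minus1_eq_1[OF assms]] .
  obtain x y where xy: "int q dvd x - r * y" "x \<noteq> 0 \<or> y \<noteq> 0" "x\<^sup>2 < int q" "y\<^sup>2 < int q"
    using thue_prime[OF assms(1)] .
  have "int q dvd r\<^sup>2 - (-1)" using r by (simp only: cong_iff_dvd_diff)
  moreover have "x\<^sup>2 + y\<^sup>2 = (x - r * y) * (x + r * y) + (r\<^sup>2 - (-1)) * y\<^sup>2"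
    by (simp add: power2_eq_square algebra_simps)
  ultimately have "int q dvd x\<^sup>2 + y\<^sup>2" using xy(1) by (metis dvd_add dvd_mult2)
  then obtain c where c: "x\<^sup>2 + y\<^sup>2 = int q * c" by (auto simp: dvd_def)
  have "0 < x\<^sup>2 + y\<^sup>2" using xy(2) by (simp add: sum_power2_gt_zero_iff)
  moreover have "x\<^sup>2 + y\<^sup>2 < int q * 2" using xy(3,4) by linarith
  ultimately have "0 < c" "c < 2" using c prime_gt_0_nat[OF assms(1)] by (auto simp: zero_less_mult_iff)
  then have "c = 1" by simp
  then show ?thesis using that c by simp
qed

text \<open>Thue's lemma with a square root of 2 makes \<open>x^2 - 2 y^2\<close> a multiple of
  \<open>q\<close> strictly between \<open>-2 q\<close> and \<open>q\<close>, hence 0 or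
  \<open>- q\<close>.\<close>

lemma norm_form_sqrt2:
  fixes q :: nat
  assumes "prime q" "q mod 8 = 1"
  obtains e g where "e\<^sup>2 - 2 * g\<^sup>2 = int q"
proof -
  obtain r where r: "[r\<^sup>2 = 2] (mod int q)"
    using Legendre_eq_1_imp_square[OF Legendre_2_eq_1[OF assms]] .
  obtain x y where xy: "int q dvd x - r * y" "x \<noteq> 0 \<or> y \<noteq> 0" "x\<^sup>2 < int q" "y\<^sup>2 < int q"
    using thue_prime[OF assms(1)] .
  have "int q dvd r\<^sup>2 - 2" using r by (simp only: cong_iff_dvd_diff)
  moreover have "x\<^sup>2 - 2 * y\<^sup>2 = (x - r * y) * (x + r * y) + (r\<^sup>2 - 2) * y\<^sup>2"
    by (simp add: power2_eq_square algebra_simps)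
  ultimately have "int q dvd x\<^sup>2 - 2 * y\<^sup>2" using xy(1) by (metis dvd_add dvd_mult2)
  then obtain c where c: "x\<^sup>2 - 2 * y\<^sup>2 = int q * c" by (auto simp: dvd_def)
  have q0: "int q > 0" using prime_gt_0_nat[OF assms(1)] by simp
  have "0 \<le> x\<^sup>2" "0 \<le> y\<^sup>2" by simp_all
  then have "int q * c < int q * 1" "int q * (-2) < int q * c" using c xy(3,4) by linarith+
  then have "c < 1" "-2 < c" using q0 by (simp_all only: mult_less_cancel_left_pos)
  moreover have "c \<noteq> 0"
  proof
    assume "c = 0"
    then have e: "x\<^sup>2 = 2 * y\<^sup>2" using c by simp
    then have y0: "y \<noteq> 0" using xy(2) by auto
    have x0: "x \<noteq> 0" using e y0 by auto
    \<comment> \<open>The equation \<open>x^2 = 2 y^2\<close> would give an even 2-adic valuation on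
      the left and an odd one on the right.\<close>
    have "multiplicity 2 (x\<^sup>2) = 2 * multiplicity 2 x" "multiplicity 2 (y\<^sup>2) = 2 * multiplicity 2 y"
      using x0 y0 by (simp_all add: prime_elem_multiplicity_power_distrib)
    moreover have "multiplicity 2 (2 * y\<^sup>2) = Suc (multiplicity 2 (y\<^sup>2))"
      using y0 by (simp add: multiplicity_times_same)
    ultimately have "2 * multiplicity 2 x = Suc (2 * multiplicity 2 y)" using e by simp
    then show False by presburger
  qed
  ultimately have "c = -1" by simp
  \<comment> \<open>The sign is corrected by \<open>1 + sqrt 2\<close>, of norm \<open>-1\<close>:
    its product with \<open>x + y sqrt 2\<close> is
    \<open>(x + 2 y) + (x + y) sqrt 2\<close>.\<close>
  then have "(x + 2 * y)\<^sup>2 - 2 * (x + y)\<^sup>2 = int q" using c by (simp add: power2_eq_square algebra_simps)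
  then show ?thesis using that by blast
qed

context real_quad
begin

text \<open>Legendre's theorem for \<open>X\<^sup>2 - d Y\<^sup>2 = A Z\<^sup>2\<close>: a small lattice point makes the form
  \<open>0\<close> or \<open>-d A\<close>, and the latter case is reduced to the former by an identity.\<close>

lemma legendre_conic:
  assumes "A > 0" "coprime d A" "A dvd r\<^sup>2 - d" "d dvd t\<^sup>2 - A"
  obtains X Y Z where "Z \<noteq> 0" "X\<^sup>2 - d * Y\<^sup>2 = A * Z\<^sup>2"
proof -
  have nz: "Z \<noteq> 0" if "X\<^sup>2 - d * Y\<^sup>2 = A * Z\<^sup>2" "(X, Y, Z) \<noteq> (0, 0, 0)" for X Y Z
  proof
    assume "Z = 0"
    then have "X\<^sup>2 = d * Y\<^sup>2" using that(1) by simp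
    then show False using d_mult_square_eq that(2) \<open>Z = 0\<close> by auto
  qed
  have dA: "d * A > 0" using d_gt_1 assms(1) by simp
  obtain k1 where k1: "k1 \<ge> 0" "k1\<^sup>2 \<le> d * A" "d * A < (k1 + 1)\<^sup>2" using int_sqrt_exists[of "d * A"] dA by auto
  obtain k2 where k2: "k2 \<ge> 0" "k2\<^sup>2 \<le> A" "A < (k2 + 1)\<^sup>2" using int_sqrt_exists[of A] assms(1) by auto
  obtain k3 where k3: "k3 \<ge> 0" "k3\<^sup>2 \<le> d" "d < (k3 + 1)\<^sup>2" using int_sqrt_exists[of d] d_gt_1 by auto
  \<comment> \<open>The sides are the integer square roots of \<open>d * A\<close>, \<open>A\<close>
    and \<open>d\<close>, so the box has more than \<open>d * A\<close> points, while
    \<open>f\<close> takes at most \<open>d * A\<close> values. The difference of two points with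
    equal value satisfies both linear congruences.\<close>
  define S where "S = {0..k1} \<times> {0..k2} \<times> {0..k3}"
  define f where "f = (\<lambda>(x, y, z). ((x - r * y) mod A, (x - t * z) mod d))"
  have cS: "card S = nat ((k1 + 1) * ((k2 + 1) * (k3 + 1)))"
    using k1(1) k2(1) k3(1) by (simp add: S_def card_cartesian_product nat_mult_distrib)
  have "f ` S \<subseteq> {0..<A} \<times> {0..<d}" using assms(1) d_gt_1 by (auto simp: f_def)
  then have "card (f ` S) \<le> card ({0..<A} \<times> {0..<d})" by (intro card_mono) auto
  also have "\<dots> = nat (d * A)" using assms(1) d_gt_1 by (simp add: card_cartesian_product nat_mult_distrib)
  finally have cf: "card (f ` S) \<le> nat (d * A)" .
  have "(d * A)\<^sup>2 < ((k1 + 1) * ((k2 + 1) * (k3 + 1)))\<^sup>2"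
  proof -
    have "A * d < (k2 + 1)\<^sup>2 * (k3 + 1)\<^sup>2" using k2 k3 assms(1) d_gt_1 by (intro mult_strict_mono) auto
    then have "(d * A) * (A * d) < (k1 + 1)\<^sup>2 * ((k2 + 1)\<^sup>2 * (k3 + 1)\<^sup>2)"
      by (rule mult_strict_mono[OF k1(3)]) (use k1(1) assms(1) d_gt_1 in auto)
    then show ?thesis by (simp add: power2_eq_square mult_ac)
  qed
  then have "d * A < (k1 + 1) * ((k2 + 1) * (k3 + 1))"
    using k1(1) k2(1) k3(1) by (auto intro: power2_less_imp_less)
  then have "nat (d * A) < card S" unfolding cS using dA by simp
  then have "\<not> inj_on f S" using cf pigeonhole[of f S] by linarith
  then obtain a b where ab: "a \<in> S" "b \<in> S" "a \<noteq> b" "f a = f b" unfolding inj_on_def by blast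
  obtain x1 y1 z1 where a: "a = (x1, y1, z1)" by (metis surj_pair)
  obtain x2 y2 z2 where b: "b = (x2, y2, z2)" by (metis surj_pair)
  define X where "X = x1 - x2"
  define Y where "Y = y1 - y2"
  define Z where "Z = z1 - z2"
  have n0: "(X, Y, Z) \<noteq> (0, 0, 0)" using ab(3) by (auto simp: a b X_def Y_def Z_def)
  have "A dvd (x1 - r * y1) - (x2 - r * y2)" "d dvd (x1 - t * z1) - (x2 - t * z2)"
    using ab(4) by (simp_all add: f_def a b mod_eq_dvd_iff)
  then have dv: "A dvd X - r * Y" "d dvd X - t * Z"
    by (simp_all add: X_def Y_def Z_def algebra_simps)
  have "\<bar>X\<bar> \<le> k1" "\<bar>Y\<bar> \<le> k2" "\<bar>Z\<bar> \<le> k3" using ab(1,2) by (auto simp: S_def a b X_def Y_def Z_def)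
  then have le: "X\<^sup>2 \<le> d * A" "Y\<^sup>2 \<le> A" "Z\<^sup>2 \<le> d"
    using square_le_if_abs_le k1(2) k2(2) k3(2) by (meson order_trans)+
  define V where "V = X\<^sup>2 - d * Y\<^sup>2 - A * Z\<^sup>2"
  have "V = (X - r * Y) * (X + r * Y) + (r\<^sup>2 - d) * Y\<^sup>2 - A * Z\<^sup>2"
    by (simp add: V_def power2_eq_square algebra_simps)
  then have VA: "A dvd V" using dv(1) assms(3) by (metis dvd_add dvd_diff dvd_mult2 dvd_triv_left)
  have "V = (X - t * Z) * (X + t * Z) + (t\<^sup>2 - A) * Z\<^sup>2 - d * Y\<^sup>2"
    by (simp add: V_def power2_eq_square algebra_simps)
  then have Vd: "d dvd V" using dv(2) assms(4) by (metis dvd_add dvd_diff dvd_mult2 dvd_triv_left)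
  obtain c where c: "V = d * A * c" using divides_mult[OF Vd VA assms(2)] by (auto simp: dvd_def)
  have dY: "0 \<le> d * Y\<^sup>2" "d * Y\<^sup>2 \<le> d * A" using le(2) d_gt_1 by simp_all
  \<comment> \<open>The strict inequality, due to \<open>d\<close> not being a square, is what
    excludes \<open>c = -2\<close>.\<close>
  have "Z\<^sup>2 < d" using le(3) d_not_square[of Z] by linarith
  then have AZ: "0 \<le> A * Z\<^sup>2" "A * Z\<^sup>2 < d * A" using assms(1) by (simp_all add: mult.commute)
  have "d * A * (-2) < d * A * c" using dY AZ c zero_le_power2[of X] unfolding V_def by linarith
  then have c2: "-2 < c" using dA by (simp only: mult_less_cancel_left_pos)
  have "d * A * c \<le> d * A * 1" using dY AZ c le(1) unfolding V_def by linarith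
  then have c1: "c \<le> 1" using dA by (simp only: mult_le_cancel_left_pos)
  have "c \<noteq> 1"
  proof
    assume "c = 1"
    then have "V = d * A" using c by simp
    then have "X\<^sup>2 = d * A" using le(1) dY AZ unfolding V_def by linarith
    then have "int (nat d * nat A) = int ((nat \<bar>X\<bar>)\<^sup>2)" using d_gt_1 assms(1) by simp
    then have "nat d * nat A = (nat \<bar>X\<bar>)\<^sup>2" by (simp only: of_nat_eq_iff)
    moreover have "coprime (nat d) (nat A)" using assms(1,2) d_gt_1 by (simp add: coprime_int_iff[symmetric])
    ultimately obtain u where "nat d = u\<^sup>2" using coprime_mult_square by blast
    then have "(int u)\<^sup>2 = d" using d_gt_1 by (metis int_nat_eq of_nat_power order_less_imp_le order_less_trans zero_less_one)
    then show False using d_not_square by blast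
  qed
  then consider "c = 0" | "c = -1" using c1 c2 by linarith
  then show ?thesis
  proof cases
    case 1
    then have "X\<^sup>2 - d * Y\<^sup>2 = A * Z\<^sup>2" using c by (simp add: V_def)
    then show ?thesis using that nz n0 by blast
  next
    case 2
    then have e: "X\<^sup>2 + d * A = d * Y\<^sup>2 + A * Z\<^sup>2" using c by (simp add: V_def)
    \<comment> \<open>This is multiplicativity of the norm for
      \<open>(d Y + Z \<theta>) (X - \<theta>)\<close> with \<open>\<theta>^2 = - d A\<close>,
      divided by \<open>d\<close>.\<close>
    have "d * (Y * X + A * Z)\<^sup>2 + A * (Z * X - d * Y)\<^sup>2 = (d * Y\<^sup>2 + A * Z\<^sup>2) * (X\<^sup>2 + d * A)"
      by (simp add: power2_eq_square algebra_simps)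
    then have eq: "(X\<^sup>2 + d * A)\<^sup>2 - d * (Y * X + A * Z)\<^sup>2 = A * (Z * X - d * Y)\<^sup>2"
      unfolding e[symmetric] by (simp add: power2_eq_square)
    have "X\<^sup>2 + d * A > 0" using dA zero_le_power2[of X] by linarith
    then have "(X\<^sup>2 + d * A, Y * X + A * Z, Z * X - d * Y) \<noteq> (0, 0, 0)" by simp
    then show ?thesis using that[OF nz[OF eq] eq] by blast
  qed
qed

lemma eqv_cI: "eqv I J \<Longrightarrow> eqv (cI I) (cI J)"
proof -
  assume a: "eqv I J"
  obtain a b where ab: "a \<in> R" "b \<in> R" "a \<noteq> 0" "b \<noteq> 0" "pr a \<star> I = pr b \<star> J"
    using a by (auto simp: eqv_iff)
  have n: "nzi I" "nzi J" using a eqv_nzi by blast+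
  have "pr (cnj a) \<star> cI I = pr (cnj b) \<star> cI J"
    using arg_cong[OF ab(5), of cI] n ab(1-4) by (simp add: cI_imul idl_pr nzi_idl cI_pr)
  then show ?thesis using n ab cnj_R cnj_eq_0 nzi_cI by (intro eqvI[of _ _ "cnj a" "cnj b"]) auto
qed

end

section \<open>Genus theory of \<open>Q(sqrt (p q))\<close>\<close>

locale real_quad_pq = real_quad +
  fixes p q :: nat
  assumes p: "prime p" "p mod 8 = 1" and q: "prime q" "q mod 8 = 1"
    and d_eq: "d = int p * int q" and p_neq_q: "p \<noteq> q"
    and Legendre_pq: "Legendre (int p) (int q) = 1"
begin

lemmas pgt = q_gt_2[OF p]
lemmas qgt = q_gt_2[OF q]

lemma q_dvd_d: "int q dvd d" "int p dvd d" by (simp_all add: d_eq)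

lemma prime_int_pq: "prime (int p)" "prime (int q)" using p q by simp_all

text \<open>At an odd prime \<open>l\<close> dividing \<open>A\<close>, \<open>d = p q\<close> is a
  square modulo \<open>l\<close>, so \<open>(p/l) (q/l) = 1\<close>; reciprocity turns this into
  \<open>(l/p) (l/q) = 1\<close>. For \<open>l = 2\<close> both symbols are 1.\<close>

lemma genus_product_formula:
  assumes "A > 0" "\<not> int p dvd A" "\<not> int q dvd A" "A dvd r\<^sup>2 - d"
  shows "Legendre A (int p) * Legendre A (int q) = 1"
proof -
  have "Legendre (int (nat A)) (int p) * Legendre (int (nat A)) (int q) = 1"
  proof (rule multiplicative_eqI[where f = "\<lambda>n. Legendre (int n) (int p) * Legendre (int n) (int q)" and g = "\<lambda>_. 1"])
    show "0 < nat A" using assms(1) by simp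
    show "Legendre (int 1) (int p) * Legendre (int 1) (int q) = 1" using Legendre_1 p q by simp
    show "Legendre (int (a * b)) (int p) * Legendre (int (a * b)) (int q) =
        Legendre (int a) (int p) * Legendre (int a) (int q) * (Legendre (int b) (int p) * Legendre (int b) (int q))" for a b
      using Legendre_mult[OF p(1) pgt] Legendre_mult[OF q(1) qgt] by simp
    fix l assume l: "prime l" "l dvd nat A"
    have "int l dvd int (nat A)" using l(2) by (simp only: int_dvd_int_iff)
    then have lA: "int l dvd A" using assms(1) by simp
    show "Legendre (int l) (int p) * Legendre (int l) (int q) = 1"
    proof (cases "l = 2")
      case True
      then show ?thesis using Legendre_2_eq_1[OF p] Legendre_2_eq_1[OF q] by simp
    next
      case False
      then have l2: "2 < l" using prime_ge_2_nat[OF l(1)] by linarith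
      have lp: "l \<noteq> p" "l \<noteq> q" using assms(2,3) lA by auto
      have "int l dvd r\<^sup>2 - d" using lA assms(4) by (rule dvd_trans)
      then have "[d = r\<^sup>2] (mod int l)" by (simp add: cong_iff_dvd_diff dvd_diff_commute)
      moreover have "\<not> int l dvd d"
        using lp l(1) p(1) q(1) unfolding d_eq
        by (metis int_dvd_int_iff of_nat_mult prime_dvd_mult_iff primes_dvd_imp_eq)
      ultimately have "Legendre d (int l) = 1" using Legendre_eq_1_if_square l(1) by blast
      then have "Legendre (int p) (int l) * Legendre (int q) (int l) = 1"
        unfolding d_eq using Legendre_mult[OF l(1) l2] by simp
      then show ?thesis using Legendre_reciprocity[OF p l(1) l2 lp(1)] Legendre_reciprocity[OF q l(1) l2 lp(2)] by simp
    qed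
  qed simp_all
  then show ?thesis using assms(1) by simp
qed

text \<open>The genus character at \<open>q\<close>: by \<open>val_Legendre_unique\<close>, all values of the norm form of \<open>I\<close>
  that are prime to \<open>q\<close> have the same Legendre symbol.\<close>

definition chi :: "real set \<Rightarrow> bool" where
  "chi I \<longleftrightarrow> (\<exists>v. val I v \<and> Legendre v (int q) = 1)"

lemma chi_eqv: "eqv I J \<Longrightarrow> chi I \<Longrightarrow> chi J"
  unfolding chi_def using val_eqv Legendre_minus[OF q] by metis

lemma chi_iff:
  assumes "nzi I" "val I v" "\<not> int q dvd v"
  shows "chi I \<longleftrightarrow> Legendre v (int q) = 1"
proof
  assume "chi I"
  then obtain w where w: "val I w" "Legendre w (int q) = 1" by (auto simp: chi_def)
  then have "\<not> int q dvd w" using Legendre_eq_0_iff[of w q] by simp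
  then show "Legendre v (int q) = 1"
    using val_Legendre_unique[OF assms(1,2) w(1) q(1) qgt q_dvd_d(1) assms(3)] w(2) by simp
qed (use assms in \<open>auto simp: chi_def\<close>)

text \<open>A prime divisor of \<open>d\<close> dividing two of \<open>a\<close>, \<open>c\<close>,
  \<open>a + b + c\<close> would divide \<open>a\<close>, \<open>b\<close> and \<open>c\<close>, and
  its square would divide \<open>d\<close>. So \<open>p\<close> and \<open>q\<close> each spoil at
  most one of the three values.\<close>

lemma coprime_value:
  assumes "nzi I"
  obtains v and r :: int where "val I v" "\<not> int p dvd v" "\<not> int q dvd v" "v dvd r\<^sup>2 - d"
proof -
  obtain a b c where abc: "a > 0" "b\<^sup>2 - d = 4 * a * c" "val I a" "val I c" "val I (a + b + c)"
    using primitive_values[OF assms] .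
  have two: "\<not> (int l dvd a \<and> int l dvd c)" "\<not> (int l dvd a \<and> int l dvd a + b + c)" "\<not> (int l dvd c \<and> int l dvd a + b + c)"
    if l: "prime l" "int l dvd d" for l
  proof -
    have pl: "prime (int l)" using l by simp
    have b: "int l dvd b" if "int l dvd a \<or> int l dvd c"
    proof -
      have "b\<^sup>2 = d + 4 * a * c" using abc(2) by simp
      then have "int l dvd b\<^sup>2" using that l(2) by (metis dvd_add dvd_mult dvd_mult2)
      then show ?thesis using pl prime_dvd_power_iff by (metis pos2)
    qed
    have ac: "\<not> (int l dvd a \<and> int l dvd c)"
    proof
      assume *: "int l dvd a \<and> int l dvd c"
      then have "int l * int l dvd b * b" "int l * int l dvd 4 * a * c" using b by (auto intro: mult_dvd_mono)
      moreover have "d = b * b - 4 * a * c" using abc(2) by (simp add: power2_eq_square)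
      ultimately have "(int l)\<^sup>2 dvd d" by (simp add: power2_eq_square)
      then show False using square_dvd_d[of "int l"] prime_gt_1_nat[OF l(1)] by simp
    qed
    then show "\<not> (int l dvd a \<and> int l dvd c)" .
    show "\<not> (int l dvd a \<and> int l dvd a + b + c)" using ac b by (metis dvd_add_right_iff dvd_add)
    show "\<not> (int l dvd c \<and> int l dvd a + b + c)" using ac b by (metis dvd_add_left_iff)
  qed
  have "a dvd b\<^sup>2 - d" "c dvd b\<^sup>2 - d" using abc(2) by (simp_all add: mult_ac)
  moreover have "(2 * a + b)\<^sup>2 - d = 4 * a * (a + b + c)" using abc(2) by (simp add: power2_eq_square algebra_simps)
  then have "a + b + c dvd (2 * a + b)\<^sup>2 - d" by simp
  ultimately show ?thesis
    using two[OF p(1) q_dvd_d(2)] two[OF q(1) q_dvd_d(1)] abc(3-5) that by metis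
qed

lemma chi_cancel: "nzi I \<Longrightarrow> nzi J \<Longrightarrow> chi I \<Longrightarrow> chi (I \<star> J) \<Longrightarrow> chi J"
proof -
  assume *: "nzi I" "nzi J" "chi I" "chi (I \<star> J)"
  obtain v where v: "val I v" "Legendre v (int q) = 1" using *(3) by (auto simp: chi_def)
  obtain w where w: "val J w" "\<not> int q dvd w" using coprime_value[OF *(2)] by metis
  have "\<not> int q dvd v" using v(2) Legendre_eq_0_iff[of v q] by simp
  then have "\<not> int q dvd v * w" using w(2) prime_int_pq(2) prime_dvd_mult_iff by blast
  then have "Legendre (v * w) (int q) = 1" using chi_iff[OF nzi_imul[OF *(1,2)] val_mult[OF *(1,2) v(1) w(1)]] *(4) by blast
  then show ?thesis using w(1) v(2) Legendre_mult[OF q(1) qgt, of v w] by (auto simp: chi_def)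
qed

lemma chi_cI: "nzi I \<Longrightarrow> chi I \<Longrightarrow> chi (cI I)"
proof -
  assume I: "nzi I" "chi I"
  obtain v x where v: "Legendre v (int q) = 1" "x \<in> I" "nrm x = v * idn I" using I(2) by (auto simp: chi_def val_def)
  then have "val (cI I) v" using I idl_in_R nzi_idl nrm_cnj idn_cI unfolding val_def cI_def
    by (metis (no_types, lifting) image_eqI)
  then show ?thesis using v by (auto simp: chi_def)
qed

lemma chi_square: "nzi I \<Longrightarrow> chi (I \<star> I)"
proof -
  assume I: "nzi I"
  obtain v where v: "val I v" "\<not> int q dvd v" using coprime_value[OF I] by metis
  then show ?thesis using val_mult[OF I I v(1) v(1)] Legendre_square[OF v(2) q(1)]
    by (auto simp: chi_def power2_eq_square)
qed

text \<open>Up to scaling the lattice has \<open>a\<close> dividing \<open>p q\<close>. It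
  represents \<open>a\<close>, and by \<open>sqrt d\<close> also \<open>- d / a\<close>. One of
  \<open>a\<close> and \<open>d / a\<close> is prime to \<open>q\<close>, hence divides
  \<open>p\<close>, and \<open>(p/q) = 1\<close>.\<close>

lemma chi_ambiguous:
  assumes "nzi I" "cI I = I"
  shows "chi I"
proof -
  obtain k a b where kab: "k > 0" "a > 0" "4 * a dvd b\<^sup>2 - d" "I = bas k a b" "a dvd b" "a dvd d"
    by (rule ambiguous_basis[OF assms])
  have nb: "nzi (bas 1 a b)" using nzi_bas kab(3) by simp
  have id: "idn (bas 1 a b) = a" using idn_bas[OF _ kab(2,3), of 1] by simp
  have divp: "Legendre x (int q) = 1" if "x dvd int p" "x > 0" for x
  proof -
    have "x = 1 \<or> x = int p" using that prime_int_pq(1) by (metis prime_int_iff less_imp_le)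
    then show ?thesis using Legendre_1[OF q(1)] Legendre_pq by auto
  qed
  have "chi (bas 1 a b)"
  proof (cases "int q dvd a")
    case False
    then have "coprime a (int q)" using prime_int_pq(2) prime_imp_coprime coprime_commute by blast
    then have "a dvd int p" using kab(6) d_eq coprime_dvd_mult_left_iff by metis
    then have "Legendre a (int q) = 1" using divp kab(2) by blast
    moreover have "val (bas 1 a b) a"
      unfolding val_def id using bas_mem[of 1 a 1 b 0] nrm_of_int[of a]
      by (intro bexI[of _ "of_int a"]) (simp_all add: el_of_int power2_eq_square)
    ultimately show ?thesis by (auto simp: chi_def)
  next
    case True
    then obtain a' where a': "a = int q * a'" by (auto simp: dvd_def)
    obtain w where w: "d = a * w" using kab(6) by (auto simp: dvd_def)
    have "int q * int p = int q * (a' * w)" using w d_eq a' by (simp add: mult_ac)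
    then have "int p = a' * w" using q(1) prime_gt_0_nat by simp
    then have "w dvd int p" by simp
    moreover have "w > 0" using w d_gt_1 kab(2) by (metis less_trans zero_less_one zero_less_mult_pos)
    ultimately have "Legendre w (int q) = 1" using divp by blast
    then have "Legendre (- w) (int q) = 1" using Legendre_minus[OF q] by simp
    moreover have "val (bas 1 a b) (- w)"
      unfolding val_def id using sqrt_mem_ambiguous[OF kab(5)] nrm_sqrt w by (intro bexI[of _ "el 0 2"]) auto
    ultimately show ?thesis by (auto simp: chi_def)
  qed
  moreover have "eqv (bas 1 a b) I"
    unfolding kab(4) bas_scale[OF kab(3), of k] using kab(1) by (intro eqv_sym[OF eqv_mult_pr[OF nb of_int_R]]) simp
  ultimately show ?thesis using chi_eqv by blast
qed

lemma chi_square_principal_pos: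
  assumes "nzi C" "\<gamma> \<in> R" "C \<star> C = pr \<gamma>" "nrm \<gamma> > 0"
  shows "chi C"
proof -
  obtain \<delta> where \<delta>: "\<delta> \<in> R" "\<delta> \<noteq> 0" "cI (pr \<delta> \<star> C) = pr \<delta> \<star> C"
    by (rule square_principal_imp_ambiguous[OF assms])
  have "chi (pr \<delta> \<star> C)" using chi_ambiguous nzi_imul nzi_pr \<delta> assms(1) by blast
  then show ?thesis using chi_eqv eqv_mult_pr[OF assms(1) \<delta>(1,2)] by blast
qed

text \<open>If the generator for \<open>C\<close> has negative norm, the square of
  \<open>M \<star> C\<close> has a generator of positive norm; the known character of
  \<open>M\<close> is then cancelled.\<close>

lemma chi_square_principal:
  assumes M: "nzi M" "\<mu> \<in> R" "M \<star> M = pr \<mu>" "nrm \<mu> < 0" "chi M"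
    and C: "nzi C" "eqv (C \<star> C) R"
  shows "chi C"
proof -
  obtain \<gamma> where \<gamma>: "\<gamma> \<in> R" "\<gamma> \<noteq> 0" "C \<star> C = pr \<gamma>" using eqv_R_imp_pr[OF C(2)] .
  have "nrm \<gamma> \<noteq> 0" using nrm_eq_0 \<gamma> by simp
  then consider "nrm \<gamma> > 0" | "nrm \<gamma> < 0" by linarith
  then show ?thesis
  proof cases
    case 1
    then show ?thesis using chi_square_principal_pos C(1) \<gamma> by blast
  next
    case 2
    have "(M \<star> C) \<star> (M \<star> C) = (M \<star> M) \<star> (C \<star> C)" using imul_swap nzi_idl M(1) C(1) by blast
    then have "(M \<star> C) \<star> (M \<star> C) = pr (\<mu> * \<gamma>)"
      unfolding M(3) \<gamma>(3) using pr_imul_pr[OF M(2) \<gamma>(1)] by simp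
    moreover have "nrm (\<mu> * \<gamma>) > 0" using nrm_mult[OF M(2) \<gamma>(1)] 2 M(4) by (simp add: mult_neg_neg)
    ultimately have "chi (M \<star> C)"
      using chi_square_principal_pos[of "M \<star> C" "\<mu> * \<gamma>"] nzi_imul M(1) C(1) mult_R M(2) \<gamma>(1) by blast
    then show ?thesis using chi_cancel M C by blast
  qed
qed

text \<open>The integer \<open>k\<close> in \<open>M\<close> has norm \<open>k^2\<close>, which
  gives the value \<open>k^2 / (k t) = k / t\<close>.\<close>

lemma chi_square_root:
  assumes "nzi M" "k > 0" "t > 0" "idn M = k * t" "of_int k \<in> M" "Legendre t (int q) = 1" "\<not> int q dvd k"
  shows "chi M \<longleftrightarrow> Legendre k (int q) = 1"
proof -
  obtain v where v: "nrm (of_int k) = v * idn M" using idn_dvd_nrm[OF assms(1,5)] .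
  then have "k * k = k * (v * t)" using assms(4) by (simp add: nrm_of_int power2_eq_square)
  then have k: "k = v * t" using assms(2) by simp
  have "val M v" using v assms(5) by (auto simp: val_def)
  moreover have "\<not> int q dvd v" using k assms(7) by auto
  moreover have "Legendre k (int q) = Legendre v (int q)" unfolding k using Legendre_mult[OF q(1) qgt] assms(6) by simp
  ultimately show ?thesis using chi_iff assms(1) by simp
qed

text \<open>The principal genus theorem. A value \<open>v\<close> prime to \<open>p q\<close> has
  \<open>A = |v|\<close> a square modulo \<open>p\<close> and \<open>q\<close>, so
  \<open>A Z^2\<close> is the norm of an integer. Multiplying the element with value
  \<open>v\<close> by it gives \<open>y\<close> in \<open>B\<close> of norm
  \<open>idn B * (A Z)^2\<close> up to sign. The cofactor of \<open>B\<close> in \<open>(y)\<close>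
  has square norm, hence is equivalent to a square, and \<open>B\<close> is equivalent to its
  conjugate.\<close>

lemma chi_imp_square:
  assumes "nzi B" "chi B"
  obtains M where "nzi M" "eqv B (M \<star> M)"
proof -
  obtain v r where v: "val B v" "\<not> int p dvd v" "\<not> int q dvd v" "v dvd r\<^sup>2 - d" using coprime_value[OF assms(1)] .
  define A where "A = \<bar>v\<bar>"
  have v0: "v \<noteq> 0" using v(3) by auto
  have A: "A > 0" "\<not> int p dvd A" "\<not> int q dvd A" "A dvd r\<^sup>2 - d" using v v0 by (simp_all add: A_def)
  have Lq: "Legendre A (int q) = 1" unfolding A_def using chi_iff[OF assms(1) v(1,3)] assms(2) Legendre_abs[OF q] by simp
  then have Lp: "Legendre A (int p) = 1" using genus_product_formula[OF A] by simp
  obtain tp where tp: "[tp\<^sup>2 = A] (mod int p)" using Legendre_eq_1_imp_square[OF Lp] .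
  obtain tq where tq: "[tq\<^sup>2 = A] (mod int q)" using Legendre_eq_1_imp_square[OF Lq] .
  have cpq: "coprime (int p) (int q)" using p(1) q(1) p_neq_q primes_coprime by (simp add: primes_coprime)
  obtain t where t: "[t = tp] (mod int p)" "[t = tq] (mod int q)" using binary_chinese_remainder_int[OF cpq] by blast
  have "[t\<^sup>2 = A] (mod int p)" "[t\<^sup>2 = A] (mod int q)" using t tp tq cong_pow cong_trans by blast+
  then have "[t\<^sup>2 = A] (mod d)" unfolding d_eq using coprime_cong_mult cpq by blast
  then have dt: "d dvd t\<^sup>2 - A" by (simp add: cong_iff_dvd_diff)
  have cop: "coprime d A" unfolding d_eq
    using prime_imp_coprime[OF prime_int_pq(1) A(2)] prime_imp_coprime[OF prime_int_pq(2) A(3)] by simp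
  obtain X Y Z where XYZ: "Z \<noteq> 0" "X\<^sup>2 - d * Y\<^sup>2 = A * Z\<^sup>2" using legendre_conic[OF A(1) cop A(4) dt] .
  obtain x where x: "x \<in> B" "nrm x = v * idn B" using v(1) by (auto simp: val_def)
  have xR: "x \<in> R" using x assms(1) nzi_idl idl_in_R by blast
  have \<xi>: "el (2 * X) (2 * Y) \<in> R" "nrm (el (2 * X) (2 * Y)) = A * Z\<^sup>2"
    by (simp add: el_in_OK_iff) (rule nrm_el, use XYZ(2) in \<open>simp add: power_mult_distrib algebra_simps\<close>)
  define y where "y = x * el (2 * X) (2 * Y)"
  have y: "y \<in> R" "y \<in> B" using xR \<xi> x assms(1) nzi_idl idlD(5) mult_R by (auto simp: y_def)
  have ny: "nrm y = v * idn B * (A * Z\<^sup>2)" using nrm_mult xR \<xi> x by (simp add: y_def)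
  have "nrm y \<noteq> 0" using ny v0 A(1) XYZ(1) idn_props(1)[OF assms(1)] by simp
  then have y0: "y \<noteq> 0" using nrm_eq_0 y by blast
  obtain K where K: "nzi K" "pr y = B \<star> K"
    using contains_imp_factor[OF nzi_pr[OF y(1) y0] assms(1)] pr_subset y assms(1) nzi_idl by blast
  have "idn B * idn K = \<bar>v * idn B * (A * Z\<^sup>2)\<bar>"
    using idn_imul[OF assms(1) K(1)] idn_pr[OF y(1) y0] K(2) ny by simp
  also have "\<dots> = idn B * (A * \<bar>Z\<bar>)\<^sup>2"
  proof -
    have "\<bar>v * idn B * (A * Z\<^sup>2)\<bar> = A * idn B * (A * Z\<^sup>2)"
      unfolding abs_mult A_def using idn_props(1)[OF assms(1)] by simp
    then show ?thesis by (simp add: power2_eq_square mult_ac)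
  qed
  finally have iK: "idn K = (A * \<bar>Z\<bar>)\<^sup>2" using idn_props(1)[OF assms(1)] by simp
  have "A * \<bar>Z\<bar> > 0" using A XYZ by simp
  then obtain M t' where M: "nzi M" "t' > 0" "K \<star> pr (of_int t') = M \<star> M"
    using square_norm_imp_square[OF K(1) _ iK] by metis
  have t': "of_int t' \<in> R" "(of_int t' :: real) \<noteq> 0" using M(2) of_int_R by auto
  have KM: "eqv (M \<star> M) K" using M(3) eqv_mult_pr[OF K(1) t'] imul_comm by metis
  have "eqv B (B \<star> (K \<star> cI K))"
    using eqv_imul[OF eqv_refl[OF assms(1)] eqv_sym[OF eqv_imul_cI[OF K(1)]]] imul_R nzi_idl[OF assms(1)] by simp
  moreover have "B \<star> (K \<star> cI K) = (B \<star> K) \<star> cI K"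
    using assms(1) K(1) by (simp add: imul_assoc nzi_idl idl_cI)
  moreover have "eqv ((B \<star> K) \<star> cI K) (cI K)"
    unfolding K(2)[symmetric] using eqv_mult_pr[OF nzi_cI[OF K(1)] y(1) y0] .
  moreover have "eqv (cI K) (cI M \<star> cI M)"
    using eqv_cI[OF eqv_sym[OF KM]] M(1) cI_imul nzi_idl by simp
  ultimately have "eqv B (cI M \<star> cI M)" using eqv_trans by metis
  then show ?thesis using that nzi_cI[OF M(1)] by blast
qed

lemma ipow_4: "nzi J \<Longrightarrow> ipow J 4 = (J \<star> J) \<star> (J \<star> J)"
  by (simp add: numeral_eq_Suc imul_R imul_assoc nzi_idl idl_imul)

text \<open>If \<open>L\<close> is equivalent to both \<open>M^2\<close> and \<open>N^2\<close> with
  \<open>N = J^2\<close>, then \<open>M\<close> times the conjugate of \<open>N\<close> has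
  principal square. So \<open>M\<close> has the same character as the square
  \<open>N\<close>.\<close>

lemma fourth_power_iff:
  assumes M0: "nzi M0" "\<mu> \<in> R" "M0 \<star> M0 = pr \<mu>" "nrm \<mu> < 0" "chi M0"
    and L: "eqv L (M \<star> M)" "nzi M"
  shows "class_is_fourth_power R L \<longleftrightarrow> chi M"
proof
  assume "class_is_fourth_power R L"
  then obtain J where J: "nzi J" "eqv L (ipow J 4)" by (auto simp: class_is_fourth_power_def nzi_def eqv_def)
  define N where "N = J \<star> J"
  have N: "nzi N" "chi N" "eqv L (N \<star> N)" using J nzi_imul chi_square ipow_4 by (auto simp: N_def)
  have "(M \<star> cI N) \<star> (M \<star> cI N) = (M \<star> M) \<star> cI (N \<star> N)"
    using L(2) N(1) by (simp add: imul_swap nzi_idl idl_cI cI_imul)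
  moreover have "eqv ((M \<star> M) \<star> cI (N \<star> N)) (L \<star> cI L)"
    using eqv_imul[OF eqv_sym[OF L(1)] eqv_cI[OF eqv_sym[OF N(3)]]] .
  moreover have "eqv (L \<star> cI L) R" using eqv_imul_cI eqv_nzi(1) L(1) by blast
  ultimately have "eqv ((M \<star> cI N) \<star> (M \<star> cI N)) R" using eqv_trans by simp
  then have "chi (M \<star> cI N)" using chi_square_principal[OF M0] nzi_imul nzi_cI L(2) N(1) by blast
  then show "chi M" using chi_cancel[of "cI N" M] chi_cI N nzi_cI L(2) imul_comm by metis
next
  assume "chi M"
  then obtain N where N: "nzi N" "eqv M (N \<star> N)" using chi_imp_square L(2) by blast
  then have "eqv L (ipow N 4)" using eqv_trans[OF L(1) eqv_imul[OF N(2) N(2)]] ipow_4 by simp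
  then show "class_is_fourth_power R L"
    using N(1) by (auto simp: class_is_fourth_power_def nzi_def eqv_def)
qed

end

section \<open>Symbols of explicit elements\<close>

lemma Legendre_power_odd:
  assumes "prime l" "2 < l" "odd k"
  shows "Legendre (x ^ k) (int l) = Legendre x (int l)"
proof -
  have pw: "Legendre (x ^ k) (int l) = Legendre x (int l) ^ k"
    using Legendre_1[OF assms(1)] Legendre_mult[OF assms(1,2)] by (induction k) auto
  obtain i where "k = 2 * i + 1" using assms(3) by (elim oddE)
  moreover have "Legendre x (int l) = 0 \<or> Legendre x (int l) = 1 \<or> Legendre x (int l) = -1"
    by (auto simp: Legendre_def)
  ultimately show ?thesis unfolding pw by (auto simp: power_mult)
qed

lemma prime_int_dvd_iffs:
  assumes "prime l"
  shows "int l dvd a * b \<longleftrightarrow> int l dvd a \<or> int l dvd b"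
    and "n > 0 \<Longrightarrow> int l dvd a ^ n \<longleftrightarrow> int l dvd a"
  using assms by (auto simp: prime_dvd_mult_iff prime_dvd_power_iff)

lemma prime_dvd_prime_power: "prime l \<Longrightarrow> prime r \<Longrightarrow> int l dvd int r ^ n \<Longrightarrow> l = r"
  by (metis int_dvd_int_iff of_nat_power prime_dvd_power primes_dvd_imp_eq)

lemma prime_dvd_2_power: "prime l \<Longrightarrow> 2 < l \<Longrightarrow> \<not> int l dvd 2 ^ n"
  using prime_dvd_prime_power[of l 2 n] by auto

lemma odd_prime_dvd_odd: "prime l \<Longrightarrow> int l dvd a \<Longrightarrow> odd a \<Longrightarrow> 2 < l"
  using prime_ge_2_nat[of l] by (cases "l = 2") auto

lemma Legendre_eq_if_scaled_squares:
  assumes "prime l" "2 < l" "int l dvd u\<^sup>2 * x - v\<^sup>2 * y" "\<not> int l dvd u" "\<not> int l dvd v"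
  shows "Legendre x (int l) = Legendre y (int l)"
proof -
  have "Legendre (u\<^sup>2 * x) (int l) = Legendre (v\<^sup>2 * y) (int l)"
    using assms(3) by (intro Legendre_cong) (simp add: cong_iff_dvd_diff)
  then show ?thesis
    using Legendre_mult[OF assms(1,2)] Legendre_square[OF assms(4,1)] Legendre_square[OF assms(5,1)] by simp
qed

lemma Legendre_eq_1_if_dvd_square_diff:
  assumes "prime l" "2 < l" "int l dvd x - y\<^sup>2" "\<not> int l dvd x"
  shows "Legendre x (int l) = 1"
  using assms Legendre_eq_1_if_square[of x y l] by (simp add: cong_iff_dvd_diff)

lemma Legendre_2_chi8: "prime l \<Longrightarrow> 2 < l \<Longrightarrow> Legendre 2 (int l) = chi8 l"
proof -
  assume l: "prime l" "2 < l"
  have "odd l" using l prime_odd_nat by auto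
  then have "l mod 8 = 1 \<or> l mod 8 = 3 \<or> l mod 8 = 5 \<or> l mod 8 = 7" by presburger
  then show ?thesis using Legendre_2[OF l] by (auto simp: chi8_def)
qed

lemma Legendre_minus1_chi4: "prime l \<Longrightarrow> 2 < l \<Longrightarrow> Legendre (-1) (int l) = chi4 l"
proof -
  assume l: "prime l" "2 < l"
  have "odd l" using l prime_odd_nat by auto
  then have "l mod 4 = 1 \<or> l mod 4 = 3" by presburger
  then show ?thesis using Legendre_minus1[OF l] by (auto simp: chi4_def)
qed

lemma chi8_abs_eq_1_iff: "chi8 (nat \<bar>x\<bar>) = 1 \<longleftrightarrow> x mod 8 = 1 \<or> x mod 8 = 7"
proof -
  have "int (nat \<bar>x\<bar> mod 8) = \<bar>x\<bar> mod 8" by (simp add: zmod_int)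
  then have "nat \<bar>x\<bar> mod 8 = 1 \<longleftrightarrow> \<bar>x\<bar> mod 8 = 1" "nat \<bar>x\<bar> mod 8 = 7 \<longleftrightarrow> \<bar>x\<bar> mod 8 = 7" by linarith+
  moreover have "\<bar>x\<bar> mod 8 = 1 \<or> \<bar>x\<bar> mod 8 = 7 \<longleftrightarrow> x mod 8 = 1 \<or> x mod 8 = 7"
    by (cases "x \<ge> 0") (simp_all, presburger)
  ultimately show ?thesis unfolding chi8_def by auto
qed

lemma multiplicative_eq_1I:
  fixes f :: "nat \<Rightarrow> int"
  assumes "x \<noteq> 0" "f 1 = 1" "\<And>a b. f (a * b) = f a * f b"
    and "\<And>l. prime l \<Longrightarrow> int l dvd x \<Longrightarrow> f l = 1"
  shows "f (nat \<bar>x\<bar>) = 1"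
proof (rule multiplicative_eqI[where g = "\<lambda>_. 1"])
  show "0 < nat \<bar>x\<bar>" using assms(1) by simp
  fix l assume l: "prime l" "l dvd nat \<bar>x\<bar>"
  have "int l dvd int (nat \<bar>x\<bar>)" using l(2) by (simp only: int_dvd_int_iff)
  then show "f l = 1" using assms(4) l(1) by simp
qed (use assms(2,3) in simp_all)

section \<open>Legendre symbols of resultants with a generator above \<open>q\<close>\<close>

context
  fixes p :: int and q h :: nat and C D \<sigma> :: int
  assumes q: "prime q" "q mod 8 = 1" and h: "odd h"
    and CD: "C\<^sup>2 - p * D\<^sup>2 = int q ^ h" and C: "odd C" and D: "4 dvd D" and qD: "\<not> int q dvd D"
    and \<sigma>: "int q dvd C + D * \<sigma>"
begin

text \<open>Modulo a prime dividing \<open>D\<close> the norm equation reads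
  \<open>q^h = C^2\<close>, and \<open>h\<close> is odd.\<close>

lemma Legendre_q_if_dvd_D:
  assumes "prime l" "2 < l" "int l dvd D" "l \<noteq> q"
  shows "Legendre (int q) (int l) = 1"
proof -
  have "int q ^ h - C\<^sup>2 = - (p * D * D)" using CD by (simp add: power2_eq_square)
  then have "int l dvd int q ^ h - C\<^sup>2" using assms(3) by simp
  moreover have "\<not> int l dvd int q ^ h" using prime_dvd_prime_power[OF assms(1) q(1)] assms(4) by blast
  ultimately have "Legendre (int q ^ h) (int l) = 1" using Legendre_eq_1_if_dvd_square_diff assms(1,2) by blast
  then show ?thesis using Legendre_power_odd[OF assms(1,2) h] by simp
qed

lemma Legendre_D: "Legendre D (int q) = 1"
proof (rule Legendre_eq_1_if_primes[OF q])
  show "D \<noteq> 0" using qD by auto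
  fix l assume l: "prime l" "2 < l" "int l dvd D"
  have "l \<noteq> q" using l(3) qD by auto
  then show "Legendre (int l) (int q) = 1"
    using Legendre_q_if_dvd_D l Legendre_reciprocity[OF q l(1,2)] by simp
qed

text \<open>Multiplication by \<open>D\<close> replaces \<open>D * \<sigma>\<close> by
  \<open>- C\<close> modulo \<open>q\<close>, and the factor \<open>D\<close> has symbol 1.\<close>

lemma Legendre_linear:
  assumes "int q dvd n - (u + v * \<sigma>)"
  shows "Legendre n (int q) = Legendre (u * D - v * C) (int q)" 
proof -
  have "n * D - (u * D - v * C) = (n - (u + v * \<sigma>)) * D + v * (C + D * \<sigma>)" by (simp add: algebra_simps)
  then have "int q dvd n * D - (u * D - v * C)" using assms \<sigma> by simp
  then have "Legendre (n * D) (int q) = Legendre (u * D - v * C) (int q)"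
    by (intro Legendre_cong) (simp add: cong_iff_dvd_diff)
  then show ?thesis using Legendre_D Legendre_mult[OF q(1) q_gt_2[OF q]] by simp
qed

text \<open>Quadratic reciprocity between \<open>(a + b \<surd>p) / 2\<close> and \<open>C + D \<surd>p\<close>, read off from their resultant
  \<open>a D - b C\<close>.\<close>

lemma symbol_of_prime_above_2:
  assumes ab: "a\<^sup>2 - p * b\<^sup>2 = 2 ^ (h + 2)" "odd a" "odd b"
    and n: "int q dvd 2 * n - (a + b * \<sigma>)" "\<not> int q dvd n"
  shows "Legendre n (int q) = 1 \<longleftrightarrow> (C + D) mod 8 = 1 \<or> (C + D) mod 8 = 7"
proof -
  define E where "E = a * D - b * C"
  have "even D" using D by presburger
  then have E_odd: "odd E" using ab C by (simp add: E_def)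
  have LE: "Legendre n (int q) = Legendre E (int q)"
    using Legendre_linear[OF n(1)] Legendre_mult[OF q(1) q_gt_2[OF q]] Legendre_2_eq_1[OF q] by (simp add: E_def)
  have qE: "\<not> int q dvd E" using LE n(2) Legendre_eq_0_iff by metis
  have two: "Legendre 2 (int l) = 1" if l: "prime l" "int l dvd b" for l
  proof -
    have l2: "2 < l" using odd_prime_dvd_odd l ab(3) by blast
    have "2 ^ (h + 2) - a\<^sup>2 = - (p * b * b)" using ab(1) by (simp add: power2_eq_square)
    then have "int l dvd 2 ^ (h + 2) - a\<^sup>2" using l(2) by simp
    then have "Legendre (2 ^ (h + 2)) (int l) = 1"
      using Legendre_eq_1_if_dvd_square_diff l(1) l2 prime_dvd_2_power by blast
    then show ?thesis using Legendre_power_odd[OF l(1) l2, of "h + 2" 2] h by simp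
  qed
  have b0: "b \<noteq> 0" using ab(3) by auto
  \<comment> \<open>Modulo a prime \<open>l\<close> dividing \<open>b\<close>,
    \<open>2^(h+2)\<close> is the square \<open>a^2\<close>, so \<open>(2/l) = 1\<close>. Collecting
    the primes of \<open>b\<close> gives \<open>b = 1\<close> or \<open>-1\<close> modulo 8.\<close>
  have chib: "chi8 (nat \<bar>b\<bar>) = 1"
  proof (rule multiplicative_eq_1I[where f = chi8, OF b0 _ chi8_mult])
    show "chi8 l = 1" if "prime l" "int l dvd b" for l
      using two[OF that] Legendre_2_chi8[OF that(1) odd_prime_dvd_odd[OF that ab(3)]] by simp
  qed (simp add: chi8_def)
  have "Legendre E (int q) = chi8 (nat \<bar>E\<bar>)"
  proof (rule Legendre_eq_multiplicative[OF q, where g = chi8, OF _ _ chi8_mult])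
    show "E \<noteq> 0" using E_odd by auto
    show "chi8 1 = 1" by (simp add: chi8_def)
    fix l assume l: "prime l" "int l dvd E"
    have l2: "2 < l" using odd_prime_dvd_odd l E_odd by blast
    have lq: "l \<noteq> q" using l(2) qE by auto
    have nq: "\<not> int l dvd int q" using lq l(1) q(1) primes_dvd_imp_eq by auto
    have "Legendre (int q) (int l) = Legendre 2 (int l)"
    proof (cases "int l dvd b")
      case True
      have "\<not> int l dvd a"
      proof
        assume "int l dvd a"
        then have "int l dvd a\<^sup>2 - p * b\<^sup>2" using True by (simp add: power2_eq_square)
        then show False using ab(1) prime_dvd_2_power[OF l(1) l2] by metis
      qed
      moreover have "a * D = E + b * C" by (simp add: E_def)
      then have "int l dvd a * D" using True l(2) by simp
      ultimately have "int l dvd D" using prime_int_dvd_iffs(1)[OF l(1)] by blast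
      then show ?thesis using Legendre_q_if_dvd_D[OF l(1) l2 _ lq] two[OF l(1) True] by simp
    next
      case False
      \<comment> \<open>Eliminating \<open>p\<close> from the two norm equations produces the
        resultant as a factor, so modulo \<open>l\<close> the numbers \<open>q^h\<close> and
        \<open>2^(h+2)\<close> differ by a square factor.\<close>
      have "b\<^sup>2 * int q ^ h - D\<^sup>2 * 2 ^ (h + 2) = - (E * (a * D + b * C))"
        unfolding CD[symmetric] ab(1)[symmetric] by (simp add: E_def power2_eq_square algebra_simps)
      then have dv: "int l dvd b\<^sup>2 * int q ^ h - D\<^sup>2 * 2 ^ (h + 2)" using l(2) by simp
      have nD: "\<not> int l dvd D"
      proof
        assume "int l dvd D"
        then have "int l dvd b\<^sup>2 * int q ^ h" using dv
          by (metis dvd_mult2 power2_eq_square diff_add_cancel dvd_add)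
        then show False using False prime_int_dvd_iffs[OF l(1)] nq
          by (metis pos2 prime_dvd_prime_power[OF l(1) q(1)] lq)
      qed
      show ?thesis
        using Legendre_eq_if_scaled_squares[OF l(1) l2 dv False nD] Legendre_power_odd[OF l(1) l2 h, of "int q"]
          Legendre_power_odd[OF l(1) l2, of "h + 2" 2] h by simp
    qed
    then show "Legendre (int l) (int q) = chi8 l"
      using Legendre_reciprocity[OF q l(1) l2 lq] Legendre_2_chi8[OF l(1) l2] by simp
  qed
  then have "Legendre n (int q) = 1 \<longleftrightarrow> E mod 8 = 1 \<or> E mod 8 = 7"
    using LE chi8_abs_eq_1_iff by simp
  moreover have b8: "b mod 8 = 1 \<or> b mod 8 = 7" using chib chi8_abs_eq_1_iff by simp
  moreover obtain D' where D': "D = 4 * D'" using D by (auto simp: dvd_def)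
  obtain a' where a': "a = 2 * a' + 1" using oddE[OF ab(2)] by blast
  obtain C' where C': "C = 2 * C' + 1" using oddE[OF C] by blast
  \<comment> \<open>Since \<open>4\<close> divides \<open>D\<close> and \<open>a\<close> is odd,
    \<open>a D\<close> may be replaced by \<open>D\<close> modulo 8, which removes \<open>a\<close>
    from the criterion.\<close>
  have E4: "E = 8 * (a' * D') + D - b * C" by (simp add: E_def D' a' algebra_simps)
  have "E mod 8 = 1 \<or> E mod 8 = 7 \<longleftrightarrow> (C + D) mod 8 = 1 \<or> (C + D) mod 8 = 7"
  proof -
    from b8 obtain b' where "b = 8 * b' + 1 \<or> b = 8 * b' + 7" by (metis mult_div_mod_eq)
    then show ?thesis
    proof
      assume "b = 8 * b' + 1"
      then have "E = - (C + D) + (a' * D' - b' * C + D') * 8" using E4 by (simp add: D' algebra_simps)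
      then have "E mod 8 = (- (C + D)) mod 8" by (simp only: mod_mult_self1)
      then show ?thesis using zmod_zminus1_eq_if[of "C + D" 8] by (auto split: if_splits)
    next
      assume "b = 8 * b' + 7"
      then have "E = (C + D) + (a' * D' - b' * C - C) * 8" using E4 by (simp add: algebra_simps)
      then have "E mod 8 = (C + D) mod 8" by (simp only: mod_mult_self1)
      then show ?thesis by simp
    qed
  qed
  ultimately show ?thesis by simp
qed

text \<open>The same method with \<open>-1\<close> in place of \<open>2^(h+2)\<close>: primes
  \<open>l\<close> dividing \<open>T D - U C\<close> satisfy \<open>(q/l) = (-1/l)\<close>, so the
  symbol is \<open>chi4\<close> of the absolute value of the resultant. Primes dividing
  \<open>U\<close> contribute trivially because \<open>-1\<close> is the square \<open>T^2\<close>
  modulo them; only \<open>C\<close> modulo 4 remains.\<close>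

lemma symbol_of_unit:
  assumes TU: "T\<^sup>2 - p * U\<^sup>2 = -1" "T > 0" "U > 0" "even T" "odd U" and C0: "C > 0"
    and n: "int q dvd n - (T + U * \<sigma>)" "\<not> int q dvd n"
  shows "Legendre n (int q) = 1 \<longleftrightarrow> C mod 4 = 1"
proof -
  define E where "E = T * D - U * C"
  have "even D" using D by presburger
  then have E_odd: "odd E" using TU C by (simp add: E_def)
  have LE: "Legendre n (int q) = Legendre E (int q)" using Legendre_linear[OF n(1)] by (simp add: E_def)
  have qE: "\<not> int q dvd E" using LE n(2) Legendre_eq_0_iff by metis
  have m1: "Legendre (-1) (int l) = 1" if l: "prime l" "int l dvd U" for l
  proof -
    have l2: "2 < l" using odd_prime_dvd_odd l TU(5) by blast
    have "-1 - T\<^sup>2 = - (p * U * U)" using TU(1) by (simp add: power2_eq_square)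
    then have "int l dvd -1 - T\<^sup>2" using l(2) by simp
    moreover have "\<not> int l dvd -1" using l2 by simp
    ultimately show ?thesis using Legendre_eq_1_if_dvd_square_diff l(1) l2 by blast
  qed
  have U0: "U \<noteq> 0" using TU(3) by simp
  have chiU: "chi4 (nat \<bar>U\<bar>) = 1"
  proof (rule multiplicative_eq_1I[where f = chi4, OF U0 _ chi4_mult])
    show "chi4 l = 1" if "prime l" "int l dvd U" for l
      using m1[OF that] Legendre_minus1_chi4[OF that(1) odd_prime_dvd_odd[OF that TU(5)]] by simp
  qed (simp add: chi4_def)
  have LE4: "Legendre E (int q) = chi4 (nat \<bar>E\<bar>)"
  proof (rule Legendre_eq_multiplicative[OF q, where g = chi4, OF _ _ chi4_mult])
    show "E \<noteq> 0" using E_odd by auto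
    show "chi4 1 = 1" by (simp add: chi4_def)
    fix l assume l: "prime l" "int l dvd E"
    have l2: "2 < l" using odd_prime_dvd_odd l E_odd by blast
    have lq: "l \<noteq> q" using l(2) qE by auto
    have nq: "\<not> int l dvd int q" using lq l(1) q(1) primes_dvd_imp_eq by auto
    have "Legendre (int q) (int l) = Legendre (-1) (int l)"
    proof (cases "int l dvd U")
      case True
      have "\<not> int l dvd T"
      proof
        assume "int l dvd T"
        then have "int l dvd T\<^sup>2 - p * U\<^sup>2" using True by (simp add: power2_eq_square)
        then show False using TU(1) l2 by simp
      qed
      moreover have "T * D = E + U * C" by (simp add: E_def)
      then have "int l dvd T * D" using True l(2) by simp
      ultimately have "int l dvd D" using prime_int_dvd_iffs(1)[OF l(1)] by blast
      then show ?thesis using Legendre_q_if_dvd_D[OF l(1) l2 _ lq] m1[OF l(1) True] by simp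
    next
      case False
      have "U\<^sup>2 * int q ^ h - D\<^sup>2 * (-1) = - (E * (T * D + U * C))"
        unfolding CD[symmetric] TU(1)[symmetric] by (simp add: E_def power2_eq_square algebra_simps)
      then have dv: "int l dvd U\<^sup>2 * int q ^ h - D\<^sup>2 * (-1)" using l(2) by simp
      have nD: "\<not> int l dvd D"
      proof
        assume "int l dvd D"
        then have "int l dvd U\<^sup>2 * int q ^ h" using dv
          by (metis dvd_mult2 power2_eq_square diff_add_cancel dvd_add)
        then show False using False prime_int_dvd_iffs[OF l(1)] nq
          by (metis pos2 prime_dvd_prime_power[OF l(1) q(1)] lq)
      qed
      show ?thesis
        using Legendre_eq_if_scaled_squares[OF l(1) l2 dv False nD] Legendre_power_odd[OF l(1) l2 h, of "int q"] by simp
    qed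
    then show "Legendre (int l) (int q) = chi4 l"
      using Legendre_reciprocity[OF q l(1) l2 lq] Legendre_minus1_chi4[OF l(1) l2] by simp
  qed
  \<comment> \<open>As \<open>(-1/n)\<close> is sensitive to sign, the sign of the resultant is
    determined: the norm equations give \<open>(T D)^2 < (U C)^2\<close>, and \<open>U C\<close> is
    positive.\<close>
  have absE: "\<bar>E\<bar> = U * C - T * D"
  proof -
    have "(U * C)\<^sup>2 - (T * D)\<^sup>2 = U\<^sup>2 * (C\<^sup>2 - p * D\<^sup>2) - D\<^sup>2 * (T\<^sup>2 - p * U\<^sup>2)"
      by (simp add: power2_eq_square algebra_simps)
    also have "\<dots> = U\<^sup>2 * int q ^ h + D\<^sup>2" unfolding CD TU(1) by simp
    finally have "(T * D)\<^sup>2 < (U * C)\<^sup>2"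
      using TU(3) q(1) prime_gt_0_nat zero_le_power2[of D]
      by (smt (verit) mult_pos_pos of_nat_0_less_iff zero_less_power)
    then have "\<bar>T * D\<bar> < \<bar>U * C\<bar>" using power2_less_imp_less[of "\<bar>T * D\<bar>" "\<bar>U * C\<bar>"] by simp
    moreover have "U * C > 0" using TU(3) C0 by simp
    ultimately show ?thesis unfolding E_def by linarith
  qed
  have "chi4 (nat \<bar>E\<bar>) = chi4 (nat (U * C))"
  proof -
    obtain D' where D': "D = 4 * D'" using D by (auto simp: dvd_def)
    have "\<bar>E\<bar> = U * C + (- (T * D')) * 4" unfolding absE D' by simp
    then have "\<bar>E\<bar> mod 4 = (U * C) mod 4" by (simp only: mod_mult_self1)
    moreover have "U * C > 0" using TU(3) C0 by simp
    ultimately have "nat \<bar>E\<bar> mod 4 = nat (U * C) mod 4"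
      using nat_mod_distrib[of "\<bar>E\<bar>" 4] nat_mod_distrib[of "U * C" 4] by simp
    then show ?thesis by (simp add: chi4_def)
  qed
  also have "chi4 (nat (U * C)) = chi4 (nat C)" using chiU TU(3) C0 by (simp add: nat_mult_distrib chi4_mult)
  finally have chiE: "chi4 (nat \<bar>E\<bar>) = chi4 (nat C)" .
  have "nat C mod 4 = nat (C mod 4)" using nat_mod_distrib[of C 4] C0 by simp
  then have "nat C mod 4 = 1 \<longleftrightarrow> C mod 4 = 1" by auto
  then have "chi4 (nat C) = 1 \<longleftrightarrow> C mod 4 = 1" by (auto simp: chi4_def)
  then show ?thesis using LE LE4 chiE by simp
qed

end

text \<open>Modulo an odd prime \<open>l\<close> dividing \<open>g\<close>, \<open>q\<close> is the
  square \<open>e^2\<close>, and reciprocity with \<open>q\<close> carries no sign.\<close>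

lemma Legendre_norm_coefficient:
  assumes q: "prime q" "q mod 8 = 1" and g: "g \<noteq> 0" "\<not> int q dvd g"
    and e: "int q = e\<^sup>2 + c * g\<^sup>2"
  shows "Legendre g (int q) = 1"
proof (rule Legendre_eq_1_if_primes[OF q g(1)])
  fix l assume l: "prime l" "2 < l" "int l dvd g"
  have lq: "l \<noteq> q" using l(3) g(2) by auto
  then have nq: "\<not> int l dvd int q" using l(1) q(1) primes_dvd_imp_eq by auto
  have "int q - e\<^sup>2 = c * g * g" using e by (simp add: power2_eq_square)
  then have "int l dvd int q - e\<^sup>2" using l(3) by simp
  then have "Legendre (int q) (int l) = 1" using Legendre_eq_1_if_dvd_square_diff l(1,2) nq by blast
  then show "Legendre (int l) (int q) = 1" using Legendre_reciprocity[OF q l(1,2) lq] by simp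
qed

lemma coprime_intI_prime:
  fixes x y :: int
  assumes "y \<noteq> 0" "\<And>l. prime l \<Longrightarrow> int l dvd x \<Longrightarrow> int l dvd y \<Longrightarrow> False"
  shows "coprime x y"
proof (rule ccontr)
  assume "\<not> coprime x y"
  then have "gcd x y \<noteq> 1" using coprime_iff_gcd_eq_1 by blast
  then have "nat (gcd x y) \<noteq> 1" by simp
  then obtain l where l: "prime l" "l dvd nat (gcd x y)" using prime_factor_nat by blast
  have "int l dvd int (nat (gcd x y))" using l(2) by (simp only: int_dvd_int_iff)
  then have "int l dvd gcd x y" by simp
  then show False using assms(2) l(1) by (meson dvd_trans gcd_dvd1 gcd_dvd2)
qed

text \<open>Modulo \<open>q\<close> we have \<open>(b \<sigma>)\<^sup>2 + (r e / g)\<^sup>2 = a\<^sup>2\<close>, hence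
  \<open>(a + b \<sigma> + r e / g)\<^sup>2 = 2 (a + b \<sigma>) (a + r e / g)\<close>, which compares the two symbols.\<close>

lemma Legendre_conic_parametrisation:
  assumes q: "prime q" "q mod 8 = 1" and e: "int q = e\<^sup>2 + c * g\<^sup>2" and g: "\<not> int q dvd g"
    and ab: "a\<^sup>2 + c * r\<^sup>2 = p * b\<^sup>2" and \<sigma>: "int q dvd \<sigma>\<^sup>2 - p"
    and n: "int q dvd n - (a + b * \<sigma>)" "\<not> int q dvd n" and W: "\<not> int q dvd a * g + r * e"
  shows "Legendre n (int q) = Legendre (a * g + r * e) (int q)"
proof -
  let ?A = "a + b * \<sigma>" and ?W = "a * g + r * e"
  have g0: "g \<noteq> 0" using g by auto
  have "(g * ?A + r * e)\<^sup>2 - 2 * g * ?A * ?W = g\<^sup>2 * (b\<^sup>2 * \<sigma>\<^sup>2 - a\<^sup>2) + r\<^sup>2 * e\<^sup>2"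
    by (simp add: power2_eq_square algebra_simps)
  also have "\<dots> = g\<^sup>2 * (b\<^sup>2 * (\<sigma>\<^sup>2 - p) + (p * b\<^sup>2 - a\<^sup>2)) + r\<^sup>2 * e\<^sup>2"
    by (simp add: algebra_simps)
  also have "\<dots> = g\<^sup>2 * b\<^sup>2 * (\<sigma>\<^sup>2 - p) + r\<^sup>2 * int q"
    unfolding ab[symmetric] e by (simp add: power2_eq_square algebra_simps)
  finally have "int q dvd (g * ?A + r * e)\<^sup>2 - 2 * g * ?A * ?W" using \<sigma> by simp
  moreover have "int q dvd 2 * g * ?W * (n - ?A)" using n(1) by simp
  ultimately have "int q dvd ((g * ?A + r * e)\<^sup>2 - 2 * g * ?A * ?W) - 2 * g * ?W * (n - ?A)" by (rule dvd_diff)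
  also have "((g * ?A + r * e)\<^sup>2 - 2 * g * ?A * ?W) - 2 * g * ?W * (n - ?A) = (g * ?A + r * e)\<^sup>2 - (2 * g * n) * ?W"
    by (simp only: algebra_simps)
  finally have cong: "[(2 * g * n) * ?W = (g * ?A + r * e)\<^sup>2] (mod int q)"
    by (simp add: cong_iff_dvd_diff dvd_diff_commute)
  have qgt: "2 < q" using q_gt_2[OF q] .
  have "\<not> int q dvd 2" using qgt zdvd_not_zless by auto
  then have "\<not> int q dvd (2 * g * n) * ?W" using g n(2) W prime_int_dvd_iffs(1)[OF q(1)] by blast
  then have "Legendre (2 * g * n) (int q) = Legendre ?W (int q)"
    using Legendre_eq_if_mult_square[OF q(1) qgt cong] by blast
  then show ?thesis
    using Legendre_mult[OF q(1) qgt] Legendre_2_eq_1[OF q] Legendre_norm_coefficient[OF q g0 g e] by simp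
qed

text \<open>With \<open>2^(h+2) = 2 r^2\<close>, the numbers are read off from
  \<open>x + W sqrt 2 = (a + r sqrt 2) (e + g sqrt 2)\<close>. The sign of \<open>g\<close> is free
  and is used to keep \<open>W\<close> prime to \<open>q\<close>.\<close>

lemma sqrt2_conic:
  assumes p: "prime p" "p \<noteq> q" and q: "prime q" "q mod 8 = 1" and h: "odd h"
    and ab: "a\<^sup>2 - int p * b\<^sup>2 = 2 ^ (h + 2)" "odd a" "odd b"
    and \<sigma>: "int q dvd \<sigma>\<^sup>2 - int p" and n: "int q dvd 2 * n - (a + b * \<sigma>)" "\<not> int q dvd n"
  obtains x W where "x\<^sup>2 - int p * int q * b\<^sup>2 = 2 * W\<^sup>2" "even W" "odd x" "\<not> int q dvd W" "coprime x b"
    "Legendre W (int q) = Legendre n (int q)"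
proof -
  have qgt: "2 < q" using q_gt_2[OF q] .
  have q2: "\<not> int q dvd 2" using qgt zdvd_not_zless by auto
  obtain e g0 where eg0: "e\<^sup>2 - 2 * g0\<^sup>2 = int q" using norm_form_sqrt2[OF q] .
  have qq: "\<not> int q * int q dvd int q"
  proof
    assume "int q * int q dvd int q"
    then have "int q * int q dvd int q * 1" by simp
    then have "int q dvd 1" using qgt by (subst (asm) dvd_mult_cancel_left) simp
    then show False using qgt by simp
  qed
  have qe: "\<not> (int q dvd e \<and> int q dvd g0)"
  proof
    assume "int q dvd e \<and> int q dvd g0"
    then have "int q * int q dvd e\<^sup>2 - 2 * g0\<^sup>2" unfolding power2_eq_square
      by (intro dvd_diff dvd_mult mult_dvd_mono) auto
    then show False using qq eg0 by simp
  qed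
  have qg: "\<not> int q dvd g0"
  proof
    assume *: "int q dvd g0"
    have "e\<^sup>2 = int q + 2 * g0 * g0" using eg0 by (simp add: power2_eq_square)
    then have "int q dvd e\<^sup>2" using * by simp
    then show False using qe * prime_int_dvd_iffs(2)[OF q(1)] by (metis pos2)
  qed
  have qe': "\<not> int q dvd e"
  proof
    assume *: "int q dvd e"
    have "2 * g0\<^sup>2 = e * e - int q" using eg0 by (simp add: power2_eq_square)
    then have "int q dvd 2 * g0\<^sup>2" using * by simp
    then show False using qg q2 prime_int_dvd_iffs[OF q(1)] by (metis pos2)
  qed
  define j where "j = (h + 1) div 2"
  have j: "j > 0" "h + 2 = 2 * j + 1" using h by (auto simp: j_def elim!: oddE)
  define r :: int where "r = 2 ^ j"
  have r: "2 ^ (h + 2) = 2 * r\<^sup>2" unfolding j(2) r_def by (simp add: power_mult[symmetric] mult.commute)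
  have "\<not> int q dvd r" unfolding r_def using prime_dvd_2_power[OF q(1) qgt] .
  then have q2r: "\<not> int q dvd 2 * r * e"
    using q2 qe' by (simp only: prime_int_dvd_iffs(1)[OF q(1)]) simp
  \<comment> \<open>Divisibility for both signs of \<open>g0\<close> would make \<open>q\<close>
    divide the sum \<open>2 r e\<close>.\<close>
  have "\<not> (int q dvd a * g0 + r * e \<and> int q dvd a * (- g0) + r * e)"
  proof
    assume "int q dvd a * g0 + r * e \<and> int q dvd a * (- g0) + r * e"
    then have "int q dvd (a * g0 + r * e) + (a * (- g0) + r * e)" by (blast intro: dvd_add)
    then have "int q dvd 2 * r * e" by (simp add: mult_ac)
    then show False using q2r by blast
  qed
  then obtain g where g: "g = g0 \<or> g = - g0" "\<not> int q dvd a * g + r * e" by blast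
  have eg: "e\<^sup>2 - 2 * g\<^sup>2 = int q" "\<not> int q dvd g" using g(1) eg0 qg by auto
  define W where "W = a * g + r * e"
  define x where "x = a * e + 2 * r * g"
  have "x\<^sup>2 - 2 * W\<^sup>2 = (a\<^sup>2 - 2 * r\<^sup>2) * (e\<^sup>2 - 2 * g\<^sup>2)"
    by (simp add: x_def W_def power2_eq_square algebra_simps)
  also have "a\<^sup>2 - 2 * r\<^sup>2 = int p * b\<^sup>2" using ab(1) r by simp
  finally have xW: "x\<^sup>2 - int p * int q * b\<^sup>2 = 2 * W\<^sup>2" using eg by (simp add: mult_ac)
  have "odd (e\<^sup>2 - 2 * g\<^sup>2)" unfolding eg(1) using q(2) by simp presburger
  then have oe: "odd e" by simp
  have ox: "odd x" using oe ab(2) by (simp add: x_def)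
  \<comment> \<open>For odd \<open>g\<close> the number \<open>e^2 - 2 g^2\<close> would be 3 modulo
    4, while \<open>q\<close> is 1 modulo 4. Evenness of \<open>g\<close> and of \<open>r\<close>
    makes \<open>W\<close> even.\<close>
  have eg2: "even g"
  proof (rule ccontr)
    assume "odd g"
    obtain e' where "e = 2 * e' + 1" using oe by (elim oddE)
    then have 1: "e\<^sup>2 = 4 * (e' * e' + e') + 1" by (simp add: power2_eq_square algebra_simps)
    obtain g' where "g = 2 * g' + 1" using \<open>odd g\<close> by (elim oddE)
    then have 2: "g\<^sup>2 = 4 * (g' * g' + g') + 1" by (simp add: power2_eq_square algebra_simps)
    have "int q = 8 * int (q div 8) + 1" using q(2) by presburger
    then show False using eg(1) 1 2 by presburger
  qed
  have "even r" using j(1) by (simp add: r_def)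
  then have eW: "even W" using eg2 by (simp add: W_def)
  have b0: "b \<noteq> 0" using ab(3) by auto
  have cop: "coprime x b"
  proof (rule coprime_intI_prime[OF b0])
    fix l assume l: "prime l" "int l dvd x" "int l dvd b"
    have l2: "2 < l" using odd_prime_dvd_odd[OF l(1,3) ab(3)] .
    have n2: "\<not> int l dvd 2" using l2 zdvd_not_zless by auto
    have "2 * W\<^sup>2 = x * x - int p * int q * b * b" using xW by (simp add: power2_eq_square)
    then have "int l dvd 2 * W\<^sup>2" using l by simp
    then have lW: "int l dvd W" using n2 prime_int_dvd_iffs[OF l(1)] by (metis pos2)
    \<comment> \<open>Undoing the multiplication by \<open>e + g sqrt 2\<close> shows that a common
      prime of \<open>x\<close> and \<open>W\<close> divides \<open>r q\<close>; as an odd prime it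
      equals \<open>q\<close>, which does not divide \<open>W\<close>.\<close>
    have "r * int q = W * e - g * x"
      unfolding eg(1)[symmetric] by (simp add: W_def x_def power2_eq_square algebra_simps)
    then have "int l dvd r * int q" using l(2) lW by simp
    then have "int l dvd int q" using prime_int_dvd_iffs(1)[OF l(1)] prime_dvd_2_power[OF l(1) l2] unfolding r_def by blast
    then have "l = q" using l(1) q(1) primes_dvd_imp_eq by auto
    then show False using lW g(2) by (simp add: W_def)
  qed
  have "Legendre (2 * n) (int q) = Legendre W (int q)"
    unfolding W_def
  proof (rule Legendre_conic_parametrisation[OF q _ eg(2) _ \<sigma> n(1) _ g(2)])
    show "int q = e\<^sup>2 + (-2) * g\<^sup>2" using eg(1) by simp
    show "a\<^sup>2 + (-2) * r\<^sup>2 = int p * b\<^sup>2" using ab(1) r by simp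
    show "\<not> int q dvd 2 * n" using q2 n(2) prime_int_dvd_iffs(1)[OF q(1)] by blast
  qed
  then have "Legendre W (int q) = Legendre n (int q)"
    using Legendre_mult[OF q(1) qgt] Legendre_2_eq_1[OF q] by simp
  then show ?thesis using that[OF xW eW ox _ cop] g(2) by (simp add: W_def)
qed

text \<open>Here \<open>x + c i = (T + i) (e + g i)\<close>, again with the sign of \<open>g\<close>
  chosen to keep \<open>c\<close> prime to \<open>q\<close>.\<close>

lemma gaussian_conic:
  assumes q: "prime q" "q mod 8 = 1" and TU: "T\<^sup>2 - int p * U\<^sup>2 = -1" "odd U"
    and \<sigma>: "int q dvd \<sigma>\<^sup>2 - int p" and n: "int q dvd n - (T + U * \<sigma>)" "\<not> int q dvd n"
  obtains x c where "x\<^sup>2 - int p * int q * U\<^sup>2 = - (c\<^sup>2)" "\<not> int q dvd c" "coprime x U"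
    "Legendre c (int q) = Legendre n (int q)"
proof -
  have qgt: "2 < q" using q_gt_2[OF q] .
  have q2: "\<not> int q dvd 2" using qgt zdvd_not_zless by auto
  obtain e g0 where eg0: "e\<^sup>2 + g0\<^sup>2 = int q" using sum_two_squares[OF q] .
  have "0 < e\<^sup>2" "0 < g0\<^sup>2"
    using eg0 prime_int_not_square[OF q(1)] by (auto simp: zero_less_power2)
  then have less: "e\<^sup>2 < int q" "g0\<^sup>2 < int q" using eg0 by linarith+
  have small: "\<not> int q dvd z" if z: "0 < z\<^sup>2" "z\<^sup>2 < int q" for z :: int
  proof
    assume "int q dvd z"
    then have "int q dvd z\<^sup>2" by (simp add: power2_eq_square)
    then show False using z zdvd_not_zless by blast
  qed
  have qe: "\<not> int q dvd e" "\<not> int q dvd g0" using small less \<open>0 < e\<^sup>2\<close> \<open>0 < g0\<^sup>2\<close> by blast+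
  have "\<not> (int q dvd T * g0 + 1 * e \<and> int q dvd T * (- g0) + 1 * e)"
  proof
    assume "int q dvd T * g0 + 1 * e \<and> int q dvd T * (- g0) + 1 * e"
    then have "int q dvd (T * g0 + 1 * e) + (T * (- g0) + 1 * e)" by (blast intro: dvd_add)
    then have "int q dvd 2 * e" by simp
    then show False using q2 qe(1) prime_int_dvd_iffs(1)[OF q(1)] by blast
  qed
  then obtain g where g: "g = g0 \<or> g = - g0" "\<not> int q dvd T * g + 1 * e" by blast
  have eg: "e\<^sup>2 + g\<^sup>2 = int q" "\<not> int q dvd g" using g(1) eg0 qe by auto
  define c where "c = T * g + e"
  define x where "x = T * e - g"
  have "x\<^sup>2 + c\<^sup>2 = (T\<^sup>2 + 1) * (e\<^sup>2 + g\<^sup>2)" by (simp add: x_def c_def power2_eq_square algebra_simps)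
  also have "T\<^sup>2 + 1 = int p * U\<^sup>2" using TU(1) by simp
  finally have xc: "x\<^sup>2 - int p * int q * U\<^sup>2 = - (c\<^sup>2)" using eg by (simp add: mult_ac)
  have U0: "U \<noteq> 0" using TU(2) by auto
  have cop: "coprime x U"
  proof (rule coprime_intI_prime[OF U0])
    fix l assume l: "prime l" "int l dvd x" "int l dvd U"
    have "c\<^sup>2 = int p * int q * U * U - x * x" using xc by (simp add: power2_eq_square)
    then have "int l dvd c\<^sup>2" using l by simp
    then have lc: "int l dvd c" using prime_int_dvd_iffs[OF l(1)] by (metis pos2)
    have "int q = c * e - x * g"
      unfolding eg(1)[symmetric] by (simp add: c_def x_def power2_eq_square algebra_simps)
    then have "int l dvd int q" using l(2) lc by simp
    then have "l = q" using l(1) q(1) primes_dvd_imp_eq by auto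
    then show False using lc g(2) by (simp add: c_def)
  qed
  have "Legendre n (int q) = Legendre (T * g + 1 * e) (int q)"
  proof (rule Legendre_conic_parametrisation[OF q _ eg(2) _ \<sigma> n g(2)])
    show "int q = e\<^sup>2 + 1 * g\<^sup>2" using eg(1) by simp
    show "T\<^sup>2 + 1 * 1\<^sup>2 = int p * U\<^sup>2" using TU(1) by simp
  qed
  then show ?thesis using that[OF xc _ cop] g(2) by (simp add: c_def)
qed

section \<open>Prime ideals and residue symbols\<close>

context real_quad
begin

lemma prime_ideal_nzi: "prime_ideal R Q \<Longrightarrow> nzi Q"
  by (simp add: prime_ideal_def nzi_def)

lemma prime_ideal_power:
  assumes "prime_ideal R Q" "x \<in> R" "x ^ n \<in> Q"
  shows "x \<in> Q"
proof -
  have "1 \<notin> Q" using assms(1) idl_eq_R[of Q] by (auto simp: prime_ideal_def)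
  then show ?thesis using assms(3)
  proof (induction n)
    case (Suc n)
    then have "x \<in> Q \<or> x ^ n \<in> Q" using assms(1,2) power_R by (auto simp: prime_ideal_def)
    then show ?case using Suc by blast
  qed simp
qed

lemma power_mem_ipow: "x \<in> I \<Longrightarrow> x ^ n \<in> ipow I n"
  by (induction n) (auto simp: one_R imul_mem)

text \<open>As \<open>(r)\<close> is the product of \<open>Q\<close> with its conjugate, cancelling
  one factor \<open>Q\<close> would put a power of \<open>Q\<close> into the conjugate prime, and
  then \<open>Q\<close> itself. It serves to show that generators of powers of \<open>Q\<close> have
  coordinates without common factor \<open>r\<close>.\<close>

lemma ipow_prime_ideal_primitive:
  assumes "prime_ideal R Q" "idn Q = r" "r > 1" "cI Q \<noteq> Q"
  shows "\<not> ipow Q n \<subseteq> pr (of_int r)"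
proof
  assume sub: "ipow Q n \<subseteq> pr (of_int r)"
  have Q: "nzi Q" "idl Q" using prime_ideal_nzi[OF assms(1)] nzi_idl by blast+
  have cQ: "nzi (cI Q)" "idl (cI Q)" using nzi_cI Q nzi_idl by blast+
  have "\<not> Q \<subseteq> cI Q" using subset_idn_eq[OF Q(1) cQ(1)] idn_cI[OF Q(1)] assms(4) by auto
  then obtain x where x: "x \<in> Q" "x \<notin> cI Q" by blast
  have xR: "x \<in> R" "cnj x \<in> R" using x(1) Q idl_in_R cnj_R by blast+
  show False
  proof (cases n)
    case 0
    then have "of_int 1 \<in> pr (of_int r)" using sub one_R by auto
    then have "r dvd 1" using of_int_mem_pr by blast
    then show False using assms(3) by simp
  next
    case (Suc k)
    have "Q \<star> ipow Q k \<subseteq> Q \<star> cI Q" using sub Suc idn_props(2)[OF Q(1)] assms(2) by simp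
    then have "ipow Q k \<subseteq> cI Q" using imul_cancel_subset[OF Q(1)] idl_ipow Q(2) cQ(2) by blast
    then have "x ^ k \<in> cI Q" using power_mem_ipow[OF x(1)] by blast
    then have "cnj (x ^ k) \<in> Q" using mem_cI_iff[OF Q(2)] by blast
    moreover have "cnj (x ^ m) = cnj x ^ m" for m
      using cnj_of_int[of 1] xR by (induction m) (auto simp: cnj_mult power_R)
    ultimately have "cnj x \<in> Q" using prime_ideal_power[OF assms(1) xR(2)] by simp
    then show False using x(2) xR mem_cI_iff[OF Q(2)] by blast
  qed
qed

lemma bas1_mem_iff: "el u v \<in> bas 1 a b \<longleftrightarrow> 2 * a dvd u - b * v"
proof
  assume "el u v \<in> bas 1 a b"
  then show "2 * a dvd u - b * v" by (auto simp: bas_def el_eq_iff)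
next
  assume "2 * a dvd u - b * v"
  then obtain t where "u = 2 * a * t + b * v" by (metis dvdE add.commute diff_add_cancel)
  then show "el u v \<in> bas 1 a b" using bas_mem[of 1 a t b v] by simp
qed

lemma prime_norm_basis:
  assumes "nzi Q" "idn Q = int r" "prime r"
  obtains b where "4 * int r dvd b\<^sup>2 - d" "Q = bas 1 (int r) b"
proof -
  obtain k a b where kab: "k > 0" "a > 0" "4 * a dvd b\<^sup>2 - d" "Q = bas k a b" by (rule basis_exists[OF assms(1)])
  have ka: "k\<^sup>2 * a = int r" using idn_bas[OF kab(1-3)] kab(4) assms(2) by simp
  have pr: "prime (int r)" using assms(3) by simp
  have "k dvd int r" using ka by (metis dvd_mult2 dvd_triv_left power2_eq_square)
  then have "k = 1 \<or> k = int r" using pr kab(1) by (metis prime_int_iff less_imp_le)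
  moreover have "k \<noteq> int r"
  proof
    assume "k = int r"
    then have "int r * (int r * a) = int r * 1" using ka by (simp add: power2_eq_square mult.assoc)
    then have "int r * a = 1" using assms(3) prime_gt_0_nat by simp
    then have "int r dvd 1" by (metis dvd_triv_left)
    then show False using prime_gt_1_nat[OF assms(3)] by simp
  qed
  ultimately have "k = 1" by blast
  then show ?thesis using that kab ka by simp
qed

lemma unramified_conj_neq:
  assumes "4 * int r dvd b\<^sup>2 - d" "prime r" "\<not> int r dvd d"
  shows "cI (bas 1 (int r) b) \<noteq> bas 1 (int r) b"
proof
  assume eq: "cI (bas 1 (int r) b) = bas 1 (int r) b"
  have "el b 1 \<in> bas 1 (int r) b" by (simp add: bas1_mem_iff)
  then have "el b (-1) \<in> bas 1 (int r) b" using eq cnj_el[of b 1] by (metis cI_def image_eqI)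
  then have "2 * int r dvd 2 * b" by (simp add: bas1_mem_iff)
  then have "int r dvd b" by simp
  then have "int r dvd b\<^sup>2" by (simp add: power2_eq_square)
  moreover have "int r dvd b\<^sup>2 - d" using assms(1) by (metis dvd_mult_right)
  ultimately have "int r dvd d" by (metis dvd_diff_right_iff)
  then show False using assms(3) by blast
qed

lemma split_prime_norm:
  assumes "prime_ideal R Q" "prime_ideal R Q'" "Q \<star> Q' = pr (of_nat r)" "prime r"
  shows "idn Q = int r"
proof -
  have Q: "nzi Q" "nzi Q'" "Q \<noteq> R" "Q' \<noteq> R" using assms(1,2) prime_ideal_nzi by (auto simp: prime_ideal_def)
  have r0: "int r > 0" using assms(4) prime_gt_0_nat by simp
  have prod: "idn Q * idn Q' = (int r)\<^sup>2"
    using idn_imul[OF Q(1,2)] assms(3) idn_of_int[OF r0] by simp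
  have pos: "idn Q > 0" "idn Q' > 0" using idn_props Q by blast+
  have ne: "idn Q \<noteq> 1" "idn Q' \<noteq> 1" using idn_1 Q by blast+
  have prodn: "nat (idn Q) * nat (idn Q') = r\<^sup>2"
  proof -
    have "int (nat (idn Q) * nat (idn Q')) = int (r\<^sup>2)" using prod pos by simp
    then show ?thesis by (simp only: of_nat_eq_iff)
  qed
  then have "nat (idn Q) dvd r\<^sup>2" by (metis dvd_triv_left)
  then obtain i where i: "i \<le> 2" "nat (idn Q) = r ^ i" using divides_primepow_nat[OF assms(4)] by blast
  consider "i = 0" | "i = 1" | "i = 2" using i(1) by linarith
  then show ?thesis
  proof cases
    case 1
    then have "idn Q = 1" using i(2) pos(1) by simp
    then show ?thesis using ne by blast
  next
    case 2
    then show ?thesis using i(2) pos(1) by auto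
  next
    case 3
    then have "r\<^sup>2 * nat (idn Q') = r\<^sup>2 * 1" using i(2) prodn by simp
    then have "nat (idn Q') = 1" using r0 by simp
    then show ?thesis using ne pos by linarith
  qed
qed

text \<open>The norm divides 4, and \<open>L = (2)\<close> is impossible: \<open>(1 + s) / 2\<close>
  times its conjugate is \<open>(1 - d) / 4\<close>, which is even as \<open>d = 1\<close> modulo 8,
  while neither factor is in \<open>(2)\<close>.\<close>

lemma prime_above_2_norm:
  assumes "prime_ideal R L" "2 \<in> L"
  shows "idn L = 2"
proof -
  have L: "nzi L" "idl L" "L \<noteq> R" using assms(1) prime_ideal_nzi nzi_idl by (auto simp: prime_ideal_def)
  have two: "(2::real) = of_int 2" by simp
  have nz2: "nzi (pr 2)" using nzi_pr[of 2] of_int_R[of 2] by simp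
  obtain K where K: "nzi K" "pr 2 = L \<star> K" using contains_imp_factor[OF nz2 L(1) pr_subset[OF L(2) assms(2)]] .
  have prod: "idn L * idn K = 4" using idn_imul[OF L(1) K(1)] K(2) idn_of_int[of 2] by simp
  have pos: "idn L > 0" "idn K > 0" using idn_props L K by blast+
  have ne: "idn L \<noteq> 1" using idn_1 L by blast
  have "idn K \<noteq> 1"
  proof
    assume "idn K = 1"
    then have "K = R" using idn_1[OF K(1)] by simp
    then have Lp: "L = pr 2" using K(2) imul_R[OF L(2)] by simp
    obtain c where c: "1\<^sup>2 - d * 1\<^sup>2 = 4 * c" using quarter_norm_int[of 1 1] by auto
    have "d = 8 * (d div 8) + 1" using d_mod_8 by presburger
    moreover have "1 - d = 4 * c" using c by simp
    ultimately have "even c" by presburger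
    then obtain c' where "c = 2 * c'" by (elim evenE)
    then have "el 1 1 * el 1 (-1) = of_int c' * 2" using el_norm[of 1 1] c by simp
    then have "el 1 1 * el 1 (-1) \<in> L" unfolding Lp pr_iff using of_int_R by blast
    then have "el 1 1 \<in> L \<or> el 1 (-1) \<in> L" using assms(1) by (auto simp: prime_ideal_def el_in_OK_iff)
    then show False using el_mem_pr_int(1)[of 1 _ 2] unfolding Lp two by fastforce
  qed
  moreover have "idn L dvd 4" using prod by (metis dvd_triv_left)
  then have "idn L \<le> 4" using zdvd_imp_le by simp
  then have "idn L = 1 \<or> idn L = 2 \<or> idn L = 3 \<or> idn L = 4" using pos(1) by linarith
  ultimately show ?thesis using ne prod by auto
qed

lemma prime_above_2_basis:
  assumes "prime_ideal R L" "2 \<in> L"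
  obtains b where "4 * 2 dvd b\<^sup>2 - d" "L = bas 1 2 b" "cI L \<noteq> L"
proof -
  have 2: "prime (2::nat)" by simp
  obtain b where b: "4 * int 2 dvd b\<^sup>2 - d" "L = bas 1 (int 2) b"
    using prime_norm_basis[OF prime_ideal_nzi[OF assms(1)] _ 2] prime_above_2_norm[OF assms] by auto
  have "\<not> int 2 dvd d" using odd_d by simp
  then have "cI L \<noteq> L" using unramified_conj_neq[OF b(1) 2] b(2) by blast
  then show ?thesis using that b by simp
qed

text \<open>Ensures that the universally quantified condition (3) is not vacuous, so that
  information can be drawn from it.\<close>

lemma prime_above_2_exists: "prime_ideal R (bas 1 2 1)" "2 \<in> bas 1 2 1"
proof -
  have d8: "d = 8 * (d div 8) + 1" using d_mod_8 by presburger
  have "1\<^sup>2 - d = 4 * 2 * (- (d div 8))" using d8 by simp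
  then have dv: "4 * 2 dvd 1\<^sup>2 - d" by (metis dvd_triv_left)
  have n: "nzi (bas 1 2 1)" using nzi_bas[OF _ dv] by simp
  have mem: "el u v \<in> bas 1 2 1 \<longleftrightarrow> 4 dvd u - v" for u v using bas1_mem_iff[of u v 2 1] by simp
  show "2 \<in> bas 1 2 1" using mem[of 4 0] by (simp add: el_def)
  have "1 \<notin> bas 1 2 1" using mem[of 2 0] by (simp add: el_def)
  then have "bas 1 2 1 \<noteq> R" using one_R by blast
  moreover have "x \<in> bas 1 2 1 \<or> y \<in> bas 1 2 1" if xyR: "x \<in> R" "y \<in> R" and xy: "x * y \<in> bas 1 2 1" for x y
  proof -
    obtain u v where uv: "even (u - v)" "x = el u v" using OK_imp_el xyR by blast
    obtain u' v' where uv': "even (u' - v')" "y = el u' v'" using OK_imp_el xyR by blast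
    obtain a b where ab: "2 * a = u * u' + d * (v * v')" "2 * b = u * v' + u' * v" "even (a - b)"
      using el_mult_ex[OF uv(1) uv'(1)] .
    have "4 dvd a - b" using xy uv uv' el_mult[OF ab(1,2)] mem by simp
    then obtain c where c: "a - b = 4 * c" by (auto simp: dvd_def)
    obtain e where e: "u = v + 2 * e" using uv(1) by (metis dvdE diff_add_cancel add.commute)
    obtain e' where e': "u' = v' + 2 * e'" using uv'(1) by (metis dvdE diff_add_cancel add.commute)
    define k where "k = d div 8"
    have dk: "d = 8 * k + 1" using d8 by (simp add: k_def)
    have "2 * (a - b) = (u - v) * (u' - v') + (d - 1) * (v * v')" using ab by (simp add: algebra_simps)
    then have "2 * (4 * c) = 4 * (e * e') + 8 * (k * (v * v'))" unfolding c e e' dk by (simp add: algebra_simps)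
    then have "e * e' = 2 * (c - k * (v * v'))" by simp
    then have "even (e * e')" by simp
    then have "even e \<or> even e'" by simp
    then show ?thesis using uv(2) uv'(2) mem e e' by auto
  qed
  ultimately show "prime_ideal R (bas 1 2 1)" using n by (auto simp: prime_ideal_def nzi_def)
qed

text \<open>\<open>(2)\<close> is the product of two distinct conjugate primes, so the exponent in
  \<open>hyper_primary\<close> is 3.\<close>

lemma ram_index2_eq_1:
  assumes "prime_ideal R L" "2 \<in> L"
  shows "ram_index2 R L = 1"
  unfolding ram_index2_def
proof (rule Greatest_equality)
  have L: "nzi L" "idl L" using assms(1) prime_ideal_nzi nzi_idl by blast+
  have nc: "cI L \<noteq> L" using prime_above_2_basis[OF assms] by metis
  show "pr 2 \<subseteq> ipow L 1" using pr_subset[OF L(2) assms(2)] imul_R L(2) by simp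
  fix e assume e: "pr 2 \<subseteq> ipow L e"
  show "e \<le> 1"
  proof (rule ccontr)
    assume "\<not> e \<le> 1"
    then obtain k where k: "e = Suc (Suc k)" by (metis One_nat_def Suc_le_eq not_le old.nat.exhaust not_less_eq_eq le0)
    have i: "idl (ipow L k)" "idl (cI L)" using idl_ipow idl_cI L by blast+
    have "pr 2 = L \<star> cI L" using idn_props(2)[OF L(1)] prime_above_2_norm[OF assms] by simp
    then have "L \<star> cI L \<subseteq> L \<star> (L \<star> ipow L k)" using e k by simp
    then have "cI L \<subseteq> L \<star> ipow L k" using imul_cancel_subset[OF L(1)] i idl_imul L(2) by blast
    then have "cI L \<subseteq> L" using imul_subset_left[OF L(2) i(1)] by blast
    then show False using subset_idn_eq[OF nzi_cI[OF L(1)] L(1)] idn_cI[OF L(1)] nc by blast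
  qed
qed

text \<open>Modulo this lattice \<open>s\<close> is \<open>- b\<close>, so \<open>el u v\<close> is
  congruent to the integer \<open>(u - b v) / 2\<close>, and \<open>0, ..., r - 1\<close> represent
  the cosets.\<close>

lemma ideal_norm_prime:
  assumes b: "4 * int r dvd b\<^sup>2 - d" and r: "r > 0"
  shows "ideal_norm R (bas 1 (int r) b) = r"
proof -
  let ?Q = "bas 1 (int r) b"
  have Q: "idl ?Q" using idl_bas[OF b] .
  have b_odd: "odd b" using bas_coeffs_odd b by blast
  define cl where "cl x = {y \<in> R. y - x \<in> ?Q}" for x
  have cl_eq: "cl x = cl y" if "x - y \<in> ?Q" for x y
  proof -
    have "z - x \<in> ?Q \<longleftrightarrow> z - y \<in> ?Q" for z
      using idlD(3)[OF Q _ that, of "z - x"] idl_diff[OF Q _ that, of "z - y"] by auto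
    then show ?thesis by (simp add: cl_def)
  qed
  have int_mem: "of_int n \<in> ?Q \<longleftrightarrow> int r dvd n" for n
    using bas1_mem_iff[of "2 * n" 0 "int r" b] by (simp add: el_of_int)
  have "{{y \<in> R. y - x \<in> ?Q} |x. x \<in> R} = (\<lambda>n. cl (of_int n)) ` {0..<int r}"
  proof (intro equalityI subsetI)
    fix X assume "X \<in> {{y \<in> R. y - x \<in> ?Q} |x. x \<in> R}"
    then obtain x where x: "x \<in> R" "X = cl x" by (auto simp: cl_def)
    obtain u v where uv: "even (u - v)" "x = el u v" using OK_imp_el x by blast
    have "even (u - b * v)" using uv(1) b_odd by auto
    then obtain m where m: "u - b * v = 2 * m" by (elim evenE)
    define n where "n = m mod int r"
    have "u - 2 * n - b * v = 2 * (m - n)" using m by simp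
    also have "m - n = int r * (m div int r)" by (simp add: n_def minus_mod_eq_mult_div)
    finally have "2 * int r dvd u - 2 * n - b * v" by simp
    then have "x - of_int n \<in> ?Q" using bas1_mem_iff by (simp add: uv(2) el_of_int el_diff)
    then have "X = cl (of_int n)" using x(2) cl_eq by simp
    moreover have "n \<in> {0..<int r}" using r by (simp add: n_def)
    ultimately show "X \<in> (\<lambda>n. cl (of_int n)) ` {0..<int r}" by blast
  next
    fix X assume "X \<in> (\<lambda>n. cl (of_int n)) ` {0..<int r}"
    then show "X \<in> {{y \<in> R. y - x \<in> ?Q} |x. x \<in> R}" using of_int_R by (auto simp: cl_def)
  qed
  moreover have "inj_on (\<lambda>n. cl (of_int n)) {0..<int r}"
  proof (rule inj_onI)
    fix m n assume mn: "m \<in> {0..<int r}" "n \<in> {0..<int r}" "cl (of_int m) = cl (of_int n)"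
    have "of_int m \<in> cl (of_int m)" using of_int_R idlD(2)[OF Q] by (simp add: cl_def)
    then have "of_int m \<in> cl (of_int n)" unfolding mn(3) .
    then have "of_int m - of_int n \<in> ?Q" by (simp add: cl_def)
    then have "int r dvd m - n" using int_mem[of "m - n"] by simp
    then show "m = n" using mn(1,2) by (metis atLeastLessThan_iff mod_eq_dvd_iff mod_pos_pos_trivial)
  qed
  ultimately show ?thesis unfolding ideal_norm_def by (simp add: card_image)
qed

text \<open>The residue ring is that of the integers modulo \<open>r\<close>, where Euler's
  criterion applies; \<open>r > 2\<close> separates 1 from \<open>-1\<close> and makes the value in
  the definite description unique.\<close>

lemma qr_symbol_eq_Legendre:
  assumes b: "4 * int r dvd b\<^sup>2 - d" and r: "prime r" "2 < r" and a: "a \<in> R" "a - of_int n \<in> bas 1 (int r) b"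
    and n: "\<not> int r dvd n"
  shows "qr_symbol R a (bas 1 (int r) b) = Legendre n (int r)"
proof -
  let ?Q = "bas 1 (int r) b" and ?k = "(r - 1) div 2"
  have Q: "idl ?Q" using idl_bas[OF b] .
  have int_mem: "of_int n \<in> ?Q \<longleftrightarrow> int r dvd n" for n
    using bas1_mem_iff[of "2 * n" 0 "int r" b] by (simp add: el_of_int)
  have pow: "a ^ k - of_int n ^ k \<in> ?Q" for k
  proof (induction k)
    case 0
    then show ?case using idlD(2)[OF Q] by simp
  next
    case (Suc k)
    have "a ^ Suc k - of_int n ^ Suc k = a * (a ^ k - of_int n ^ k) + of_int n ^ k * (a - of_int n)"
      by (simp add: algebra_simps)
    then show ?case using Suc a idlD(3,4)[OF Q] power_R of_int_R by metis
  qed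
  have "[Legendre n (int r) = n ^ ?k] (mod int r)" using euler_criterion[OF r] .
  then have "int r dvd n ^ ?k - Legendre n (int r)" by (simp add: cong_iff_dvd_diff dvd_diff_commute)
  then have "of_int (n ^ ?k - Legendre n (int r)) \<in> ?Q" using int_mem by blast
  then have "(a ^ ?k - of_int n ^ ?k) + of_int (n ^ ?k - Legendre n (int r)) \<in> ?Q" using pow idlD(3)[OF Q] by blast
  then have main: "a ^ ?k - of_int (Legendre n (int r)) \<in> ?Q" by simp
  have nm: "ideal_norm R ?Q = r" using ideal_norm_prime[OF b] r by simp
  show ?thesis unfolding qr_symbol_def nm
  proof (rule the_equality)
    show "Legendre n (int r) \<in> {1, - 1} \<and> a ^ ?k - of_int (Legendre n (int r)) \<in> ?Q"
      using Legendre_values[OF n] main by auto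
    fix s' :: int assume s: "s' \<in> {1, - 1} \<and> a ^ ?k - of_int s' \<in> ?Q"
    have "(a ^ ?k - of_int s') - (a ^ ?k - of_int (Legendre n (int r))) \<in> ?Q" using s main idl_diff[OF Q] by blast
    then have "of_int (Legendre n (int r) - s') \<in> ?Q" by (simp add: algebra_simps)
    then have "[Legendre n (int r) = s'] (mod int r)" using int_mem cong_iff_dvd_diff by blast
    moreover have "\<bar>s'\<bar> \<le> 1" using s by auto
    ultimately show "s' = Legendre n (int r)"
      using small_cong_imp_eq[of "Legendre n (int r)" s' "int r"] Legendre_abs_le r(2) by simp
  qed
qed

lemma residue_mod_prime:
  assumes b: "4 * int r dvd b\<^sup>2 - d" "even (u - v)"
  obtains n where "el u v - of_int n \<in> bas 1 (int r) b" "2 * n = u - b * v"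
    "el u v \<in> bas 1 (int r) b \<longleftrightarrow> int r dvd n"
proof -
  have b_odd: "odd b" using bas_coeffs_odd b(1) by blast
  have "even (u - b * v)" using b(2) b_odd by auto
  then obtain n where n: "u - b * v = 2 * n" by (elim evenE)
  have "u - 2 * n - b * v = 0" using n by simp
  then have "el u v - of_int n \<in> bas 1 (int r) b" by (simp add: el_of_int el_diff bas1_mem_iff)
  moreover have "el u v \<in> bas 1 (int r) b \<longleftrightarrow> int r dvd n" using n by (simp add: bas1_mem_iff)
  ultimately show ?thesis using that n by simp
qed

text \<open>From \<open>k^2 a = 8\<close> only \<open>k = 1\<close> or \<open>k = 2\<close> is
  possible, and \<open>k = 2\<close> would put \<open>L^3\<close> inside \<open>(2)\<close>. With
  this basis, membership in \<open>L^3\<close> is a congruence of coordinates modulo 16.\<close>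

lemma prime_above_2_cube:
  assumes "prime_ideal R L" "2 \<in> L"
  obtains b where "4 * 8 dvd b\<^sup>2 - d" "odd b" "ipow L 3 = bas 1 8 b"
proof -
  have L: "nzi L" using assms(1) prime_ideal_nzi by blast
  have idL: "idn L = 2" using prime_above_2_norm[OF assms] .
  have n3: "nzi (ipow L 3)" "idn (ipow L 3) = 8" using nzi_ipow[OF L] idn_ipow[OF L, of 3] idL by simp_all
  obtain k a b where kab: "k > 0" "a > 0" "4 * a dvd b\<^sup>2 - d" "ipow L 3 = bas k a b" by (rule basis_exists[OF n3(1)])
  have ka: "k\<^sup>2 * a = 8" using idn_bas[OF kab(1-3)] kab(4) n3(2) by simp
  have "k = 1"
  proof (rule ccontr)
    assume "k \<noteq> 1"
    then have k2: "k \<ge> 2" using kab(1) by linarith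
    have "k < 3"
    proof (rule ccontr)
      assume "\<not> k < 3"
      then have "(3::int)\<^sup>2 \<le> k\<^sup>2" by (intro power_mono) auto
      moreover have "k\<^sup>2 * 1 \<le> k\<^sup>2 * a" using kab(2) by (intro mult_left_mono) auto
      ultimately show False using ka by simp
    qed
    then have "k = 2" using k2 by linarith
    then have "ipow L 3 = pr (of_int 2) \<star> bas 1 a b" using kab(4) bas_scale[OF kab(3), of 2] by simp
    then have "ipow L 3 \<subseteq> pr (of_int 2)"
      using imul_subset_left[OF idl_pr[OF of_int_R[of 2]] idl_bas[OF kab(3), of 1]] by simp
    moreover have "cI L \<noteq> L" using prime_above_2_basis[OF assms] by metis
    ultimately show False using ipow_prime_ideal_primitive[OF assms(1) idL] by simp
  qed
  then have "a = 8" using ka by simp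
  then show ?thesis using that \<open>k = 1\<close> kab bas_coeffs_odd by blast
qed

text \<open>Modulo \<open>L^3\<close> the element \<open>C + D s\<close> becomes
  \<open>C - b D\<close> modulo 8, which is \<open>C + D\<close> because \<open>4\<close> divides
  \<open>D\<close> and \<open>b\<close> is odd. It agrees with the square of the residue
  \<open>f\<close> of \<open>\<xi>\<close>, and odd squares are 1 modulo 8.\<close>

lemma hyper_primary_imp:
  assumes "hyper_primary d (el (2 * C) (2 * D))" "prime_ideal R L" "2 \<in> L" "odd C" "4 dvd D"
  shows "(C + D) mod 8 = 1"
proof -
  obtain b where b: "4 * 8 dvd b\<^sup>2 - d" "odd b" "ipow L 3 = bas 1 8 b" by (rule prime_above_2_cube[OF assms(2,3)])
  obtain \<xi> where "\<xi> \<in> R" "el (2 * C) (2 * D) - \<xi>\<^sup>2 \<in> ipow L (2 * ram_index2 R L + 1)"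
    using assms(1-3) unfolding hyper_primary_def by blast
  then have \<xi>: "\<xi> \<in> R" "el (2 * C) (2 * D) - \<xi>\<^sup>2 \<in> bas 1 8 b"
    using ram_index2_eq_1[OF assms(2,3)] b(3) by simp_all
  obtain u v where uv: "even (u - v)" "\<xi> = el u v" using OK_imp_el \<xi>(1) by blast
  obtain x y where xy: "2 * x = u * u + d * (v * v)" "2 * y = u * v + u * v" "even (x - y)"
    using el_mult_ex[OF uv(1) uv(1)] .
  have sq: "\<xi>\<^sup>2 = el x y" using el_mult[OF xy(1,2)] uv(2) by (simp add: power2_eq_square)
  have "2 * 8 dvd (2 * C - x) - b * (2 * D - y)" using \<xi>(2) unfolding sq el_diff bas1_mem_iff .
  then obtain k where k: "(2 * C - x) - b * (2 * D - y) = 16 * k" by (auto simp: dvd_def)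
  obtain j where j: "b\<^sup>2 - d = 32 * j" using b(1) by (auto simp: dvd_def)
  have "even (u - b * v)" using uv(1) b(2) by auto
  then obtain f where f: "u - b * v = 2 * f" by (elim evenE)
  have "(u - b * v) * (u - b * v) = 2 * x - 2 * (b * y) + (b\<^sup>2 - d) * (v * v)"
    using xy(1,2) by (simp add: power2_eq_square algebra_simps)
  then have "4 * (f * f) = 2 * x - 2 * (b * y) + 32 * (j * (v * v))" unfolding f j by simp
  then have "f * f = C - b * D + 8 * (j * (v * v) - k)" using k by (simp add: algebra_simps)
  then have ff: "f\<^sup>2 = C - b * D + 8 * (j * (v * v) - k)" by (simp add: power2_eq_square)
  obtain D' where D': "D = 4 * D'" using assms(5) by (auto simp: dvd_def)
  obtain b' where b': "b = 2 * b' + 1" using oddE[OF b(2)] by blast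
  have bD: "C - b * D = C + D - 8 * (D' + b' * D')" by (simp add: D' b' algebra_simps)
  have "odd (f\<^sup>2)" unfolding ff bD using assms(4) D' by simp
  then have "f\<^sup>2 mod 8 = 1" using odd_square_mod_8 by simp
  moreover have "C + D = f\<^sup>2 + (D' + b' * D' - (j * (v * v) - k)) * 8" using ff bD by simp
  ultimately show ?thesis by (simp only: mod_mult_self1)
qed

text \<open>The choice \<open>\<xi> = 1\<close> works in every condition: modulo 4 by
  \<open>C mod 4 = 1\<close> and \<open>4 dvd D\<close>, modulo \<open>L^3\<close> by
  \<open>C - b D = C + D = 1\<close> modulo 8.\<close>

lemma hyper_primaryI:
  assumes "odd C" "4 dvd D" "(C + D) mod 8 = 1" "totally_positive d (el (2 * C) (2 * D))" "C mod 4 = 1"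
  shows "hyper_primary d (el (2 * C) (2 * D))"
  unfolding hyper_primary_def primary_def
proof (intro conjI allI impI)
  let ?\<rho> = "el (2 * C) (2 * D)"
  show R: "?\<rho> \<in> R" by (simp add: el_in_OK_iff)
  show "totally_positive d ?\<rho>" by fact
  have D2: "even D" using assms(2) by presburger
  have "nrm ?\<rho> = C\<^sup>2 - d * D\<^sup>2" by (rule nrm_el) (simp add: power_mult_distrib algebra_simps)
  moreover have "odd (C\<^sup>2 - d * D\<^sup>2)" using assms(1) D2 by simp
  moreover have "elem_norm d ?\<rho> = of_int (nrm ?\<rho>)" using nrm_eq[OF R] by (simp add: elem_norm_def)
  ultimately show "\<exists>n. odd n \<and> elem_norm d ?\<rho> = of_int n" by metis
  obtain D' where D': "D = 4 * D'" using assms(2) by (auto simp: dvd_def)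
  have "C = 4 * (C div 4) + 1" using assms(5) by presburger
  then obtain C' where C': "C = 4 * C' + 1" by blast
  have one: "(1::real) = el 2 0" by (simp add: el_def)
  have "?\<rho> - 1\<^sup>2 = el (2 * C - 2) (2 * D)" unfolding power_one unfolding one el_diff by simp
  also have "\<dots> = of_int 4 * el (2 * C') (2 * D')" unfolding el_scale by (simp add: C' D')
  finally have r1: "?\<rho> - 1\<^sup>2 = el (2 * C') (2 * D') * 4" by simp
  show "\<exists>\<xi>\<in>R. ?\<rho> - \<xi>\<^sup>2 \<in> pr 4"
    using r1 one_R el_in_OK_iff[of "2 * C'" "2 * D'"] unfolding pr_iff by (intro bexI[of _ 1] bexI[of _ "el (2 * C') (2 * D')"]) auto
  fix L assume "prime_ideal R L \<and> 2 \<in> L"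
  then have L: "prime_ideal R L" "2 \<in> L" by auto
  obtain b where b: "4 * 8 dvd b\<^sup>2 - d" "odd b" "ipow L 3 = bas 1 8 b" by (rule prime_above_2_cube[OF L])
  obtain b' where b': "b = 2 * b' + 1" using oddE[OF b(2)] by blast
  have "C + D = 8 * ((C + D) div 8) + 1" using assms(3) by presburger
  then obtain k where k: "C + D = 8 * k + 1" by blast
  have "(2 * C - 2) - b * (2 * D) = 2 * (C + D - 1) - 16 * (D' + b' * D')" by (simp add: D' b' algebra_simps)
  also have "\<dots> = 2 * 8 * (k - (D' + b' * D'))" using k by simp
  finally have "2 * 8 dvd (2 * C - 2) - b * (2 * D)" by (metis dvd_triv_left)
  then have "el (2 * C - 2) (2 * D) \<in> bas 1 8 b" by (simp only: bas1_mem_iff)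
  then have "?\<rho> - 1\<^sup>2 \<in> ipow L (2 * ram_index2 R L + 1)"
    using \<open>?\<rho> - 1\<^sup>2 = el (2 * C - 2) (2 * D)\<close> ram_index2_eq_1[OF L] b(3) by simp
  then show "\<exists>\<xi>\<in>R. ?\<rho> - \<xi>\<^sup>2 \<in> ipow L (2 * ram_index2 R L + 1)" using one_R by blast
qed

lemma totally_positive_iff: "x \<in> R \<Longrightarrow> totally_positive d x \<longleftrightarrow> x > 0 \<and> nrm x > 0"
proof -
  assume x: "x \<in> R"
  have "(of_int (nrm x) :: real) > 0 \<longleftrightarrow> x * cnj x > 0" using nrm_eq[OF x] by simp
  then show ?thesis unfolding totally_positive_def by (auto simp: zero_less_mult_iff)
qed

end

section \<open>The three criteria\<close>

context real_quad_pq
begin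

lemma Legendre_if_dvd_2:
  assumes "t > 0" "t dvd 2" shows "Legendre t (int q) = 1"
proof -
  have "t \<le> 2" using assms zdvd_imp_le by simp
  then have "t = 1 \<or> t = 2" using assms(1) by linarith
  then show ?thesis using Legendre_1[OF q(1)] Legendre_2_eq_1[OF q] by auto
qed

lemma dvd_2_if_dvd_double_coprime: "(t::int) dvd 2 * x \<Longrightarrow> t dvd 2 * y \<Longrightarrow> coprime x y \<Longrightarrow> t dvd 2"
proof -
  assume *: "t dvd 2 * x" "t dvd 2 * y" "coprime x y"
  have "t dvd gcd (2 * x) (2 * y)" using *(1,2) by simp
  also have "gcd (2 * x) (2 * y) = 2" using *(3) by (simp add: gcd_mult_distrib_int[symmetric])
  finally show ?thesis .
qed

text \<open>\<open>M\<close> is the square root of \<open>(\<gamma>)\<close> up to an integer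
  \<open>t\<close>, where \<open>\<gamma> = x + U sqrt d\<close> has norm \<open>- c^2\<close>.
  Coprimality of \<open>x\<close> and \<open>U\<close> makes \<open>t\<close> a divisor of 2, so the
  character of \<open>M\<close> is the symbol of \<open>c\<close>.\<close>

lemma negative_square_principal:
  assumes "x\<^sup>2 - d * U\<^sup>2 = - (c\<^sup>2)" "\<not> int q dvd c" "coprime x U" "Legendre c (int q) = 1"
  obtains M \<mu> where "nzi M" "\<mu> \<in> R" "M \<star> M = pr \<mu>" "nrm \<mu> < 0" "chi M"
proof -
  define \<gamma> where "\<gamma> = el (2 * x) (2 * U)"
  have \<gamma>: "\<gamma> \<in> R" by (simp add: \<gamma>_def el_in_OK_iff)
  have n\<gamma>: "nrm \<gamma> = - (c\<^sup>2)" unfolding \<gamma>_def by (rule nrm_el) (use assms(1) in \<open>simp add: power_mult_distrib algebra_simps\<close>)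
  have c0: "c \<noteq> 0" using assms(2) by auto
  then have "\<gamma> \<noteq> 0" using n\<gamma> nrm_of_int[of 0] by auto
  then have nz: "nzi (pr \<gamma>)" using nzi_pr \<gamma> by blast
  have "idn (pr \<gamma>) = \<bar>c\<bar>\<^sup>2" using idn_pr[OF \<gamma> \<open>\<gamma> \<noteq> 0\<close>] n\<gamma> by simp
  then obtain M t where M: "nzi M" "t > 0" "pr \<gamma> \<star> pr (of_int t) = M \<star> M" "idn M = \<bar>c\<bar> * t"
    "of_int \<bar>c\<bar> \<in> M" "pr \<gamma> \<subseteq> pr (of_int t)"
    using square_norm_imp_square[OF nz, of "\<bar>c\<bar>"] c0 by auto
  have "el (2 * x) (2 * U) \<in> pr (of_int t)" using M(6) pr_self unfolding \<gamma>_def by blast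
  then have "t dvd 2" using el_mem_pr_int dvd_2_if_dvd_double_coprime assms(3) by blast
  then have Lt: "Legendre t (int q) = 1" using Legendre_if_dvd_2 M(2) by blast
  have "chi M \<longleftrightarrow> Legendre \<bar>c\<bar> (int q) = 1"
    using chi_square_root[OF M(1) _ M(2,4,5) Lt] c0 assms(2) by simp
  then have chi: "chi M" using Legendre_abs[OF q] assms(4) by simp
  have 1: "M \<star> M = pr (\<gamma> * of_int t)" using M(3) pr_imul_pr[OF \<gamma> of_int_R] by simp
  have "nrm (\<gamma> * of_int t) = - (c\<^sup>2 * t\<^sup>2)" using nrm_mult[OF \<gamma> of_int_R] n\<gamma> nrm_of_int by simp
  then have 2: "nrm (\<gamma> * of_int t) < 0" using c0 M(2) by simp
  show ?thesis using that[OF M(1) mult_R[OF \<gamma> of_int_R] 1 2 chi] .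
qed

text \<open>The right-hand side does not involve \<open>L\<close>: one \<open>W\<close> serves every
  prime above 2.\<close>

lemma fourth_power_above_2_iff:
  assumes c: "x'\<^sup>2 - d * U\<^sup>2 = - (c\<^sup>2)" "\<not> int q dvd c" "coprime x' U" "Legendre c (int q) = 1"
    and W: "x\<^sup>2 - d * b\<^sup>2 = 2 * W\<^sup>2" "even W" "odd x" "odd b" "\<not> int q dvd W" "coprime x b"
    and L: "prime_ideal R L" "2 \<in> L"
  shows "class_is_fourth_power R L \<longleftrightarrow> Legendre W (int q) = 1"
proof -
  obtain M0 \<mu> where M0: "nzi M0" "\<mu> \<in> R" "M0 \<star> M0 = pr \<mu>" "nrm \<mu> < 0" "chi M0"
    by (rule negative_square_principal[OF c])
  define \<alpha> where "\<alpha> = el x b"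
  have \<alpha>: "\<alpha> \<in> R" using W(3,4) by (simp add: \<alpha>_def el_in_OK_iff)
  have W0: "W \<noteq> 0" using W(5) by auto
  obtain w where w: "W = 2 * w" using W(2) by (elim evenE)
  have n\<alpha>: "nrm \<alpha> = 2 * w\<^sup>2" unfolding \<alpha>_def by (rule nrm_el) (simp add: W(1) w power_mult_distrib)
  then have "\<alpha> \<noteq> 0" using W0 w nrm_of_int[of 0] by auto
  have nL: "nzi L" using prime_ideal_nzi L by blast
  have nK: "nzi (pr \<alpha> \<star> L)" using nzi_imul nzi_pr \<alpha> \<open>\<alpha> \<noteq> 0\<close> nL by blast
  have "idn (pr \<alpha> \<star> L) = \<bar>W\<bar>\<^sup>2"
    using idn_imul[OF nzi_pr[OF \<alpha> \<open>\<alpha> \<noteq> 0\<close>] nL] idn_pr[OF \<alpha> \<open>\<alpha> \<noteq> 0\<close>] prime_above_2_norm[OF L] n\<alpha>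
    by (simp add: w power_mult_distrib abs_mult)
  then obtain M t where M: "nzi M" "t > 0" "(pr \<alpha> \<star> L) \<star> pr (of_int t) = M \<star> M" "idn M = \<bar>W\<bar> * t"
    "of_int \<bar>W\<bar> \<in> M" "pr \<alpha> \<star> L \<subseteq> pr (of_int t)"
    using square_norm_imp_square[OF nK, of "\<bar>W\<bar>"] W0 by auto
  \<comment> \<open>As \<open>L\<close> contains 2, the number \<open>x + b sqrt d\<close> lies in
    \<open>(t)\<close>; coprimality of \<open>x\<close> and \<open>b\<close> leaves only divisors of
    2 for \<open>t\<close>, and these have symbol 1.\<close>
  have "\<alpha> * of_int 2 \<in> pr \<alpha> \<star> L" using imul_mem[OF pr_self L(2)] by simp
  then have "el (2 * x) (2 * b) \<in> pr (of_int t)" using M(6) el_scale[of 2 x b] by (auto simp: \<alpha>_def mult.commute)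
  then have "t dvd 2" using el_mem_pr_int dvd_2_if_dvd_double_coprime W(6) by blast
  then have Lt: "Legendre t (int q) = 1" using Legendre_if_dvd_2 M(2) by blast
  have "chi M \<longleftrightarrow> Legendre \<bar>W\<bar> (int q) = 1"
    using chi_square_root[OF M(1) _ M(2,4,5) Lt] W0 W(5) by simp
  then have chi: "chi M \<longleftrightarrow> Legendre W (int q) = 1" using Legendre_abs[OF q] by simp
  have t: "of_int t \<in> R" "(of_int t :: real) \<noteq> 0" using M(2) of_int_R by auto
  have "eqv (M \<star> M) (pr \<alpha> \<star> L)" using eqv_mult_pr[OF nK t] M(3) imul_comm by metis
  then have "eqv L (M \<star> M)" using eqv_mult_pr[OF nL \<alpha> \<open>\<alpha> \<noteq> 0\<close>] eqv_sym eqv_trans by blast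
  then show ?thesis using fourth_power_iff[OF M0 _ M(1)] chi by blast
qed

end

section \<open>The field \<open>Q(sqrt p)\<close>: generators above \<open>q\<close> and above
  2\<close>

locale real_quad_prime = real_quad +
  fixes p q :: nat and Q Q' L :: "real set" and lam :: real
  assumes p: "prime p" and d_eq: "d = int p" and q: "prime q" "q mod 8 = 1" and p_neq_q: "p \<noteq> q"
    and Q: "prime_ideal R Q" "prime_ideal R Q'" "Q \<star> Q' = pr (of_nat q)"
    and unit: "qr_symbol R (fund_unit d) Q = 1"
    and L: "prime_ideal R L" "2 \<in> L"
    and lam_gen: "lam \<in> R" "totally_positive d lam" "ipow L (class_number R) = pr lam"
begin

abbreviation h where "h \<equiv> class_number R"

lemma negative_pell_solution: "\<exists>t u. t\<^sup>2 - d * u\<^sup>2 = -1"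
proof -
  have "int p mod 4 = 1" using d_mod_8 d_eq by presburger
  then have "p mod 4 = 1" by (metis of_nat_eq_1_iff of_nat_mod of_nat_numeral)
  then show ?thesis using negative_pell[OF p] pell_solution_exists d_eq by simp
qed

lemma odd_h: "odd h"
  using odd_class_number_if_prime negative_pell_solution p d_eq by simp

lemma h_pos: "h > 0"
  using odd_h by (metis gr0I even_zero)

lemma idn_Q: "idn Q = int q"
  using split_prime_norm[OF Q q(1)] .

lemma nzi_Q: "nzi Q"
  using prime_ideal_nzi Q by blast

lemma q_ndvd_d: "\<not> int q dvd d"
  using d_eq p q(1) p_neq_q primes_dvd_imp_eq by auto

text \<open>The norm \<open>q^h\<close> is 1 modulo 8: being odd it makes both coordinates even, and
  \<open>C^2 - d D^2 = 1\<close> modulo 8 then makes \<open>C\<close> odd and \<open>4\<close> a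
  divisor of \<open>D\<close>. If \<open>q\<close> divided \<open>D\<close> it would divide
  \<open>C\<close> too, and \<open>Q^h\<close> would lie in \<open>(q)\<close>. Positivity of
  \<open>C\<close>, half the trace, is total positivity.\<close>

lemma generator_coefficients:
  assumes "\<gamma> \<in> R" "pr \<gamma> = ipow Q h" "\<gamma> > 0" "nrm \<gamma> > 0" and b: "4 * int q dvd b\<^sup>2 - d" "Q = bas 1 (int q) b"
  obtains C D where "\<gamma> = el (2 * C) (2 * D)" "C\<^sup>2 - d * D\<^sup>2 = int q ^ h" "odd C" "4 dvd D" "\<not> int q dvd D"
    "int q dvd C + D * (- b)" "C > 0"
proof -
  have n: "nrm \<gamma> = int q ^ h"
    using idn_pr[OF assms(1)] assms(2,3,4) idn_ipow[OF nzi_Q, of h] idn_Q by simp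
  have oq: "odd q" using q(2) by presburger
  have "nrm \<gamma> mod 2 = 1" unfolding n using oq by (simp add: mod_2_eq_odd)
  moreover obtain u v where uv: "even (u - v)" "\<gamma> = el u v" using OK_imp_el assms(1) by blast
  ultimately obtain C D where CD: "u = 2 * C" "v = 2 * D" "nrm \<gamma> = C\<^sup>2 - d * D\<^sup>2"
    using even_coeffs[OF uv(1)] by auto
  have \<gamma>: "\<gamma> = el (2 * C) (2 * D)" using uv CD by simp
  have norm: "C\<^sup>2 - d * D\<^sup>2 = int q ^ h" using n CD by simp
  have oqh: "odd (int q ^ h)" using oq by simp
  have q8: "int q ^ h mod 8 = 1"
  proof -
    have "int q mod 8 = 1" using q(2) by presburger
    then show ?thesis using power_mod[of "int q" 8 h] by simp
  qed
  obtain k where k: "int q ^ h = 8 * k + 1" using q8 by (metis mult_div_mod_eq)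
  obtain e where e: "d = 8 * e + 1" using d_mod_8 by (metis mult_div_mod_eq)
  have "even D"
  proof (rule ccontr)
    assume D: "odd D"
    then have "even (C\<^sup>2)" using norm oqh odd_d by (metis even_diff even_mult_iff even_power odd_add diff_add_cancel)
    then have "even C" by simp
    then obtain C' where "C = 2 * C'" by (elim evenE)
    then have C2: "C\<^sup>2 = 4 * (C' * C')" by (simp add: power2_eq_square)
    obtain j where j: "D\<^sup>2 = 8 * j + 1" using odd_square_mod_8[OF D] by (metis mult_div_mod_eq)
    have "C\<^sup>2 = 8 * k + 1 + (8 * e + 1) * (8 * j + 1)" using norm k e j by simp
    also have "\<dots> = 4 * (2 * (k + 8 * (e * j) + e + j)) + 2" by (simp add: algebra_simps)
    finally show False using C2 by presburger
  qed
  have "odd (C\<^sup>2 - d * D\<^sup>2)" unfolding norm by (rule oqh)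
  then have C: "odd C" using \<open>even D\<close> by simp
  obtain i where i: "C\<^sup>2 = 8 * i + 1" using odd_square_mod_8[OF C] by (metis mult_div_mod_eq)
  obtain D' where D': "D = 2 * D'" using \<open>even D\<close> by (elim evenE)
  have "8 * i + 1 - d * (4 * D'\<^sup>2) = 8 * k + 1" using norm i k D' by (simp add: power_mult_distrib)
  then have "d * D'\<^sup>2 = 2 * (i - k)" by simp
  then have "even (d * D'\<^sup>2)" by simp
  then have "even D'" using odd_d by simp
  then have D4: "4 dvd D" using D' by (auto elim!: evenE)
  have "\<gamma> \<in> Q"
  proof -
    obtain j where j: "h = Suc j" using h_pos by (metis Suc_pred)
    have "ipow Q h \<subseteq> Q" unfolding j using imul_subset_left nzi_idl[OF nzi_Q] idl_ipow by simp
    then show ?thesis using assms(2) pr_self by blast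
  qed
  then have "2 * int q dvd 2 * C - b * (2 * D)" unfolding b(2) \<gamma> bas1_mem_iff .
  then have "2 * int q dvd 2 * (C - b * D)" by (simp add: algebra_simps)
  then have "int q dvd C - b * D" by (simp only: dvd_mult_cancel_left) simp
  then have qCD: "int q dvd C + D * (- b)" by (simp add: mult.commute)
  have qD: "\<not> int q dvd D"
  proof
    assume D: "int q dvd D"
    then have "int q dvd (C + D * (- b)) + D * b" using qCD by (meson dvd_add dvd_mult2)
    then have "int q dvd C" by simp
    then obtain C1 D1 where "C = int q * C1" "D = int q * D1" using D by (auto simp: dvd_def)
    then have "\<gamma> = of_int (int q) * el (2 * C1) (2 * D1)" unfolding \<gamma> el_scale by (simp add: mult.left_commute)
    then have "\<gamma> = el (2 * C1) (2 * D1) * of_int (int q)" by (simp add: mult.commute)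
    moreover have "el (2 * C1) (2 * D1) \<in> R" by (simp add: el_in_OK_iff)
    ultimately have "\<gamma> \<in> pr (of_int (int q))" unfolding pr_iff by blast
    then have "ipow Q h \<subseteq> pr (of_int (int q))" using pr_subset[OF idl_pr[OF of_int_R]] assms(2) by blast
    then show False
      using ipow_prime_ideal_primitive[OF Q(1) idn_Q] prime_gt_1_nat[OF q(1)]
        unramified_conj_neq[OF b(1) q(1) q_ndvd_d] b(2) by simp
  qed
  have "cnj \<gamma> > 0" using assms(3,4) nrm_eq[OF assms(1)] by (metis of_int_0_less_iff zero_less_mult_pos)
  moreover have "\<gamma> + cnj \<gamma> = 2 * of_int C" unfolding \<gamma> cnj_el el_add by (simp add: el_def)
  ultimately have "C > 0" using assms(3) by (metis add_pos_pos of_int_0_less_iff zero_less_mult_pos zero_less_numeral)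
  then show ?thesis using that[OF \<gamma> norm C D4 qD qCD] by blast
qed

text \<open>Besides the equivalence of (1) and (2), the conclusions consist of integer equations and
  Legendre symbols. These alone pass to \<open>Q(sqrt (p q))\<close>, so the two fields never
  meet.\<close>

lemma criteria:
  obtains x x' U c b W where "qr_symbol R lam Q = 1 \<longleftrightarrow> (\<exists>\<rho>\<in>R. hyper_primary d \<rho> \<and> ipow Q h = pr \<rho>)"
    "x\<^sup>2 - int p * int q * b\<^sup>2 = 2 * W\<^sup>2" "even W" "odd x" "odd b" "\<not> int q dvd W" "coprime x b"
    "x'\<^sup>2 - int p * int q * U\<^sup>2 = - (c\<^sup>2)" "\<not> int q dvd c" "coprime x' U" "Legendre c (int q) = 1"
    "qr_symbol R lam Q = 1 \<longleftrightarrow> Legendre W (int q) = 1"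
proof -
  have qgt: "2 < q" using q_gt_2[OF q] .
  obtain \<beta> where \<beta>: "4 * int q dvd \<beta>\<^sup>2 - d" "Q = bas 1 (int q) \<beta>"
    using prime_norm_basis[OF nzi_Q idn_Q q(1)] by blast
  \<comment> \<open>This is the residue of \<open>sqrt p\<close> modulo \<open>Q\<close>, since
    \<open>Q\<close> contains \<open>(\<beta> + sqrt p) / 2\<close>.\<close>
  define \<sigma> where "\<sigma> = - \<beta>"
  have \<sigma>: "int q dvd \<sigma>\<^sup>2 - int p" using \<beta>(1) d_eq unfolding \<sigma>_def by (metis dvd_mult_right power2_minus)
  have not_mem: "\<gamma> \<notin> Q" if \<gamma>: "\<not> int q dvd nrm \<gamma>" for \<gamma>
    using idn_dvd_nrm[OF nzi_Q, of \<gamma>] \<gamma> idn_Q by (metis dvd_triv_right)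
  obtain T U where TU: "T > 0" "U > 0" "T\<^sup>2 - d * U\<^sup>2 = -1" "fund_unit d = el (2 * T) (2 * U)"
    by (rule fund_unit_negative_norm[OF negative_pell_solution])
  have U: "odd U"
  proof
    assume "even U"
    then obtain U' where U': "U = 2 * U'" by (elim evenE)
    have e: "T\<^sup>2 = 4 * (d * U'\<^sup>2) - 1" using TU(3) by (simp add: U' power_mult_distrib)
    then have "odd (T\<^sup>2)" by simp
    then have "odd T" by simp
    then obtain i where "T\<^sup>2 = 8 * i + 1" using odd_square_mod_8 by (metis mult_div_mod_eq)
    then show False using e by presburger
  qed
  have T: "even T"
  proof -
    have "T\<^sup>2 = d * U\<^sup>2 - 1" using TU(3) by simp
    then have "even (T\<^sup>2)" using U odd_d by simp
    then show ?thesis by simp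
  qed
  define n1 where "n1 = T + U * \<sigma>"
  have fR: "fund_unit d \<in> R" using TU(4) by (simp add: el_in_OK_iff)
  have m1: "fund_unit d - of_int n1 \<in> Q"
    unfolding TU(4) \<beta>(2) el_of_int el_diff bas1_mem_iff by (simp add: n1_def \<sigma>_def algebra_simps)
  have "nrm (fund_unit d) = -1"
    unfolding TU(4) by (rule nrm_el) (use TU(3) in \<open>simp add: power_mult_distrib algebra_simps\<close>)
  then have "fund_unit d \<notin> Q" using not_mem qgt by simp
  moreover have "of_int n1 \<in> Q \<longleftrightarrow> int q dvd n1"
    unfolding \<beta>(2) el_of_int bas1_mem_iff by simp
  ultimately have n1: "\<not> int q dvd n1"
    using m1 idlD(3)[OF nzi_idl[OF nzi_Q] m1, of "of_int n1"] by auto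
  have L1: "Legendre n1 (int q) = 1"
    using qr_symbol_eq_Legendre[OF \<beta>(1) q(1) qgt fR _ n1] m1 \<beta>(2) unit by simp
  have "nzi L" "idn L = 2" using prime_ideal_nzi prime_above_2_norm L by blast+
  have l0: "lam > 0" "nrm lam > 0" using totally_positive_iff[OF lam_gen(1)] lam_gen(2) by auto
  have nl: "nrm lam = 2 ^ h"
    using idn_pr[OF lam_gen(1)] l0 lam_gen(3) idn_ipow[OF \<open>nzi L\<close>, of h] \<open>idn L = 2\<close> by simp
  obtain a b where ab: "even (a - b)" "lam = el a b" using OK_imp_el lam_gen(1) by blast
  have nab: "a\<^sup>2 - int p * b\<^sup>2 = 2 ^ (h + 2)" using nrm_el_eq[OF ab(1)] nl ab(2) d_eq by simp
  \<comment> \<open>If both coordinates were even, \<open>lam\<close> would be divisible by 2,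
    whereas no power of \<open>L\<close> lies in \<open>(2)\<close>.\<close>
  have a: "odd a"
  proof
    assume "even a"
    then have "even b" using ab(1) by simp
    obtain A B where AB: "a = 2 * A" "b = 2 * B" using \<open>even a\<close> \<open>even b\<close> by (metis evenE)
    have "4 * (A\<^sup>2 - d * B\<^sup>2) = 4 * 2 ^ h" using nab d_eq by (simp add: AB power_mult_distrib algebra_simps)
    then have "A\<^sup>2 - d * B\<^sup>2 = 2 ^ h" by (simp only: mult_cancel_left) simp
    then have "even (A\<^sup>2 - d * B\<^sup>2)" using h_pos by simp
    then have "even (A - B)" using odd_d by simp
    then have "el A B \<in> R" by (simp add: el_in_OK_iff)
    moreover have "lam = el A B * of_int 2" unfolding ab(2) AB el_scale[symmetric] by simp
    ultimately have "lam \<in> pr (of_int 2)" unfolding pr_iff by blast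
    then have "ipow L h \<subseteq> pr (of_int 2)" using pr_subset[OF idl_pr[OF of_int_R]] lam_gen(3) by blast
    moreover have "cI L \<noteq> L" using prime_above_2_basis[OF L] by metis
    ultimately show False using ipow_prime_ideal_primitive[OF L(1) \<open>idn L = 2\<close>] by simp
  qed
  then have b: "odd b" using ab(1) by simp
  obtain n where n: "el a b - of_int n \<in> bas 1 (int q) \<beta>" "2 * n = a - \<beta> * b"
    "el a b \<in> bas 1 (int q) \<beta> \<longleftrightarrow> int q dvd n" using residue_mod_prime[OF \<beta>(1) ab(1)] .
  have "\<not> int q dvd 2 ^ h" using prime_dvd_2_power q(1) qgt by blast
  then have "lam \<notin> Q" using not_mem nl by simp
  then have qn: "\<not> int q dvd n" using n(3) ab(2) \<beta>(2) by simp
  have Ln: "qr_symbol R lam Q = Legendre n (int q)"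
    using qr_symbol_eq_Legendre[OF \<beta>(1) q(1) qgt lam_gen(1) _ qn] n(1) ab(2) \<beta>(2) by simp
  have n2: "int q dvd 2 * n - (a + b * \<sigma>)" using n(2) by (simp add: \<sigma>_def mult.commute)
  have key: "Legendre n (int q) = 1 \<longleftrightarrow> (C + D) mod 8 = 1" "C mod 4 = 1"
    if CD: "C\<^sup>2 - d * D\<^sup>2 = int q ^ h" "odd C" "4 dvd D" "\<not> int q dvd D" "int q dvd C + D * (- \<beta>)" "C > 0" for C D
  proof -
    have CD': "C\<^sup>2 - int p * D\<^sup>2 = int q ^ h" "int q dvd C + D * \<sigma>" using CD d_eq by (simp_all add: \<sigma>_def)
    have "Legendre n1 (int q) = 1 \<longleftrightarrow> C mod 4 = 1"
      by (rule symbol_of_unit[OF q odd_h CD'(1) CD(2-4) CD'(2), where T = T and U = U])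
        (use TU d_eq T U CD(6) n1 in \<open>simp_all add: n1_def\<close>)
    then show C4: "C mod 4 = 1" using L1 by simp
    have "Legendre n (int q) = 1 \<longleftrightarrow> (C + D) mod 8 = 1 \<or> (C + D) mod 8 = 7"
      by (rule symbol_of_prime_above_2[OF q odd_h CD'(1) CD(2-4) CD'(2) nab a b n2 qn])
    \<comment> \<open>The unit symbol enters here: \<open>C = 1\<close> modulo 4 together with
      \<open>4 dvd D\<close> rules out the second residue.\<close>
    moreover have "(C + D) mod 8 \<noteq> 7" using C4 CD(3) by presburger
    ultimately show "Legendre n (int q) = 1 \<longleftrightarrow> (C + D) mod 8 = 1" by blast
  qed
  have equiv: "qr_symbol R lam Q = 1 \<longleftrightarrow> (\<exists>\<rho>\<in>R. hyper_primary d \<rho> \<and> ipow Q h = pr \<rho>)"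
  proof
    assume s1: "qr_symbol R lam Q = 1"
    obtain \<gamma>0 where g0: "\<gamma>0 \<in> R" "\<gamma>0 \<noteq> 0" "ipow Q h = pr \<gamma>0"
      using eqv_R_imp_pr[OF eqv_ipow_class_number[OF nzi_Q]] .
    have "nrm \<gamma>0 \<noteq> 0" using nrm_eq_0 g0 by blast
    have "pr (fund_unit d) = R"
      using idn_1[OF nzi_pr[OF fR]] idn_pr[OF fR] \<open>nrm (fund_unit d) = -1\<close> nrm_of_int[of 0] by fastforce
    then have "pr (fund_unit d * \<gamma>0) = pr \<gamma>0" using pr_imul_pr[OF fR g0(1)] R_imul idl_pr g0(1) by simp
    moreover have "nrm (fund_unit d * \<gamma>0) = - nrm \<gamma>0"
      using nrm_mult[OF fR g0(1)] \<open>nrm (fund_unit d) = -1\<close> by simp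
    \<comment> \<open>Multiplication by the fundamental unit, of norm \<open>-1\<close>, changes the
      sign of the norm of the generator without changing its ideal.\<close>
    ultimately obtain \<gamma>1 where g1: "\<gamma>1 \<in> R" "ipow Q h = pr \<gamma>1" "nrm \<gamma>1 > 0"
      using g0 fR mult_R \<open>nrm \<gamma>0 \<noteq> 0\<close> by (metis linorder_neqE_linordered_idom neg_0_less_iff_less)
    \<comment> \<open>With positive norm the generator and its conjugate have the same sign, so the
      absolute value is totally positive.\<close>
    define \<gamma> where "\<gamma> = \<bar>\<gamma>1\<bar>"
    have "\<gamma>1 \<noteq> 0" using g1(3) nrm_of_int[of 0] by auto
    have "nrm (- \<gamma>1) = nrm \<gamma>1" using g1(1) by (simp add: nrm_def cnj_uminus)
    then have g: "\<gamma> \<in> R" "pr \<gamma> = ipow Q h" "\<gamma> > 0" "nrm \<gamma> > 0"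
      using g1 \<open>\<gamma>1 \<noteq> 0\<close> uminus_R pr_uminus[OF g1(1)] by (auto simp: \<gamma>_def abs_if)
    obtain C D where CD: "\<gamma> = el (2 * C) (2 * D)" "C\<^sup>2 - d * D\<^sup>2 = int q ^ h" "odd C" "4 dvd D" "\<not> int q dvd D"
      "int q dvd C + D * (- \<beta>)" "C > 0" by (rule generator_coefficients[OF g \<beta>])
    have "hyper_primary d (el (2 * C) (2 * D))"
      using hyper_primaryI[OF CD(3,4)] key[OF CD(2-7)] s1 Ln totally_positive_iff[OF g(1)] g(3,4) CD(1) by simp
    then show "\<exists>\<rho>\<in>R. hyper_primary d \<rho> \<and> ipow Q h = pr \<rho>" using g CD(1) by metis
  next
    assume "\<exists>\<rho>\<in>R. hyper_primary d \<rho> \<and> ipow Q h = pr \<rho>"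
    then obtain \<rho> where \<rho>: "\<rho> \<in> R" "hyper_primary d \<rho>" "pr \<rho> = ipow Q h" by metis
    have "totally_positive d \<rho>" using \<rho>(2) by (simp add: hyper_primary_def primary_def)
    then have pos: "\<rho> > 0" "nrm \<rho> > 0" using totally_positive_iff[OF \<rho>(1)] by auto
    obtain C D where CD: "\<rho> = el (2 * C) (2 * D)" "C\<^sup>2 - d * D\<^sup>2 = int q ^ h" "odd C" "4 dvd D" "\<not> int q dvd D"
      "int q dvd C + D * (- \<beta>)" "C > 0" by (rule generator_coefficients[OF \<rho>(1,3) pos \<beta>])
    have "(C + D) mod 8 = 1" using hyper_primary_imp[OF _ L CD(3,4)] \<rho>(2) CD(1) by simp
    then show "qr_symbol R lam Q = 1" using key(1)[OF CD(2-7)] Ln by simp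
  qed
  obtain x W where xW: "x\<^sup>2 - int p * int q * b\<^sup>2 = 2 * W\<^sup>2" "even W" "odd x" "\<not> int q dvd W" "coprime x b"
    "Legendre W (int q) = Legendre n (int q)"
    by (rule sqrt2_conic[OF p p_neq_q q odd_h nab a b \<sigma> n2 qn])
  have TU': "T\<^sup>2 - int p * U\<^sup>2 = -1" using TU(3) d_eq by simp
  have n1': "int q dvd n1 - (T + U * \<sigma>)" by (simp add: n1_def)
  obtain x' c where xc: "x'\<^sup>2 - int p * int q * U\<^sup>2 = - (c\<^sup>2)" "\<not> int q dvd c" "coprime x' U"
    "Legendre c (int q) = Legendre n1 (int q)"
    by (rule gaussian_conic[OF q TU' U \<sigma> n1' n1])
  show ?thesis using that[OF equiv xW(1-3) b xW(4,5) xc(1-3)] xc(4) L1 Ln xW(6) by simp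
qed

end

theorem theorem7:
  fixes p q :: nat and Q1 Q1' P1 P1' L2 :: "real set" and lam :: real
  assumes "prime p" and "prime q" and "p mod 8 = 1" and "q mod 8 = 1"
    and "Legendre (int p) (int q) = 1"
    and "prime_ideal (OK (int p)) Q1" and "prime_ideal (OK (int p)) Q1'"
    and "ideal_mult (OK (int p)) Q1 Q1' = principal_ideal (OK (int p)) (of_nat q)"
    and "prime_ideal (OK (int q)) P1" and "prime_ideal (OK (int q)) P1'"
    and "ideal_mult (OK (int q)) P1 P1' = principal_ideal (OK (int q)) (of_nat p)"
    and "qr_symbol (OK (int p)) (fund_unit (int p)) Q1 = 1"
    and "qr_symbol (OK (int q)) (fund_unit (int q)) P1 = 1"
    and "prime_ideal (OK (int p)) L2" and "2 \<in> L2"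
    and "lam \<in> OK (int p)" and "totally_positive (int p) lam"
    and "ideal_pow (OK (int p)) L2 (class_number (OK (int p))) = principal_ideal (OK (int p)) lam"
  shows "(qr_symbol (OK (int p)) lam Q1 = 1
            \<longleftrightarrow> (\<exists>\<rho> \<in> OK (int p). hyper_primary (int p) \<rho> \<and>
                   ideal_pow (OK (int p)) Q1 (class_number (OK (int p))) = principal_ideal (OK (int p)) \<rho>))
       \<and> ((\<exists>\<rho> \<in> OK (int p). hyper_primary (int p) \<rho> \<and>
                   ideal_pow (OK (int p)) Q1 (class_number (OK (int p))) = principal_ideal (OK (int p)) \<rho>)
            \<longleftrightarrow> (\<forall>L. prime_ideal (OK (int (p * q))) L \<and> 2 \<in> L \<longrightarrow>
                    class_is_fourth_power (OK (int (p * q))) L))"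
proof -
  have p_neq_q: "p \<noteq> q" using assms(5) Legendre_eq_0_iff[of "int p" q] by auto
  have p8: "int p mod 8 = 1" "int q mod 8 = 1" using assms(3,4) by presburger+
  have pi: "prime (int p)" "prime (int q)" using assms(1,2) by simp_all
  have cop: "coprime (int p) (int q)" using assms(1,2) p_neq_q by (simp add: primes_coprime)
  \<comment> \<open>The development is used twice: \<open>K\<close> for \<open>Q(sqrt p)\<close>,
    where (1) and (2) live, and \<open>F\<close> for \<open>Q(sqrt (p q))\<close>, where (3) lives.
    All three conditions are compared with the symbol of \<open>W\<close>.\<close>
  interpret K: real_quad_prime "int p" p q Q1 Q1' L2 lam
  proof
    show "squarefree (int p)" using pi(1) by (simp add: squarefree_prime)
  qed (use assms p_neq_q p8 prime_gt_1_nat[OF assms(1)] in simp_all)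
  interpret F: real_quad_pq "int (p * q)" p q
  proof
    show "1 < int (p * q)" using prime_gt_1_nat[OF assms(1)] prime_gt_1_nat[OF assms(2)]
      by (metis less_1_mult of_nat_1 of_nat_less_iff)
    have "int (p * q) mod 8 = ((int p mod 8) * (int q mod 8)) mod 8" by (simp add: mod_mult_eq)
    then show "int (p * q) mod 8 = 1" using p8 by simp
    show "squarefree (int (p * q))"
      using squarefree_mult_coprime[OF cop] pi by (simp add: squarefree_prime)
  qed (use assms p_neq_q in simp_all)
  obtain x x' U c b W where *: "qr_symbol (OK (int p)) lam Q1 = 1 \<longleftrightarrow>
      (\<exists>\<rho>\<in>OK (int p). hyper_primary (int p) \<rho> \<and>
        ideal_pow (OK (int p)) Q1 (class_number (OK (int p))) = principal_ideal (OK (int p)) \<rho>)"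
    "x\<^sup>2 - int p * int q * b\<^sup>2 = 2 * W\<^sup>2" "even W" "odd x" "odd b" "\<not> int q dvd W" "coprime x b"
    "x'\<^sup>2 - int p * int q * U\<^sup>2 = - (c\<^sup>2)" "\<not> int q dvd c" "coprime x' U" "Legendre c (int q) = 1"
    "qr_symbol (OK (int p)) lam Q1 = 1 \<longleftrightarrow> Legendre W (int q) = 1"
    by (rule K.criteria)
  have eqs: "x\<^sup>2 - int (p * q) * b\<^sup>2 = 2 * W\<^sup>2" "x'\<^sup>2 - int (p * q) * U\<^sup>2 = - (c\<^sup>2)"
    using *(2,8) by simp_all
  have "class_is_fourth_power (OK (int (p * q))) L \<longleftrightarrow> Legendre W (int q) = 1"
    if "prime_ideal (OK (int (p * q))) L" "2 \<in> L" for L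
    by (rule F.fourth_power_above_2_iff[OF eqs(2) *(9-11) eqs(1) *(3-7) that])
  then have "(\<forall>L. prime_ideal (OK (int (p * q))) L \<and> 2 \<in> L \<longrightarrow> class_is_fourth_power (OK (int (p * q))) L)
      \<longleftrightarrow> Legendre W (int q) = 1"
    using F.prime_above_2_exists by blast
  then show ?thesis using *(1,12) by blast
qed

end
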